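(* Let $d\ge1$, let $r_i,s_i>0$, $\gamma_i:=1/r_i-1/(r_i+s_i)$, and $\theta_i:=\sqrt{\lambda_i/\gamma_i}$, $i=1,\dots,d$. Let $h\in\mathcal{C}^2(\mathbb{R}^d)$ be a superharmonic function and let $$f(\theta)=\sum_{a\in\{1,-1\}^d}h(a_1\theta_1,a_2\theta_2,\dots,a_d\theta_d),\qquad \theta\in[0,\infty)^d,$$ be nonnegative and not identically zero. Suppose that for every $z\in\mathbb{N}^d$, every scalar $\rho>0$ and every $i\in\{1,\dots,d\}$, $$\int f(\theta)\prod_{j=1}^d\theta_j^{2z_j}e^{-\rho\theta_j^2}\,\mathrm{d}\theta<\infty,\quad \int\Bigl|\frac{\partial f}{\partial\theta_i}(\theta)\Bigr|\prod_{j=1}^d\theta_j^{2z_j}e^{-\rho\theta_j^2}\,\mathrm{d}\theta<\infty,\quad \int\Bigl|\frac{\partial^2 f}{\partial\theta_i^2}(\theta)\Bigr|\prod_{j=1}^d\theta_j^{2z_j}e^{-\rho\theta_j^2}\,\mathrm{d}\theta<\infty$$ (integrals over $[0,\infty)^d$). Then the Bayesian predictive distribution $p_{f,\mathrm J}(y\mid x)$ weakly dominates the Bayesian predictive distribution $p_{\mathrm J}(y\mid x)$ based on the Jeffreys prior. Furthermore, if $F(z,r)$ is not a constant function of $z$ on $\mathbb{N}^d$, then $p_{f,\mathrm J}(y\mid x)$ dominates $p_{\mathrm J}(y\mid x)$.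
   Context: $\mathbb{N}=\{0,1,2,\dots\}$. A function $h\in\mathcal C^2(\mathbb{R}^d)$ is superharmonic if $\sum_i\partial^2h/\partial\theta_i^2\le0$ everywhere. Model (different durations): for unknown $\lambda\in(0,\infty)^d$ and known $r_i,s_i>0$, $x$ and $y$ are independent with $p(x\mid\lambda)=\prod_{i=1}^d (r_i\lambda_i)^{x_i}e^{-r_i\lambda_i}/x_i!$ and $p(y\mid\lambda)=\prod_{i=1}^d (s_i\lambda_i)^{y_i}e^{-s_i\lambda_i}/y_i!$, $x,y\in\mathbb{N}^d$. For a (possibly improper) prior density $\pi(\lambda)$, the Bayesian predictive distribution is $p_\pi(y\mid x)=\int p(x\mid\lambda)p(y\mid\lambda)\pi(\lambda)\,\mathrm{d}\lambda\big/\int p(x\mid\lambda)\pi(\lambda)\,\mathrm{d}\lambda$. The Jeffreys prior is $\pi_{\mathrm J}(\lambda)\propto\prod_{i=1}^d\lambda_i^{-1/2}$, with predictive distribution $p_{\mathrm J}$. For nonnegative $f$ on $[0,\infty)^d$, $\pi_{f,\mathrm J}(\lambda)\propto f(\theta_1,\dots,\theta_d)\prod_{i=1}^d\lambda_i^{-1/2}$ with $\theta_i=\sqrt{\lambda_i/\gamma_i}$, and $p_{f,\mathrm J}$ is the corresponding predictive distribution. The Kullback–Leibler (K-L) risk of a predictive distribution $q(y\mid x)$ at $\lambda$ is $\sum_x p(x\mid\lambda)\sum_y p(y\mid\lambda)\log\frac{p(y\mid\lambda)}{q(y\mid x)}$. $q_1$ weakly dominates $q_2$ if the K-L risk of $q_1$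 is at most that of $q_2$ at every $\lambda$; $q_1$ dominates $q_2$ if moreover the inequality is strict for some $\lambda$. $$F(z,r)=\int_{(0,\infty)^d} f\bigl(\sqrt{\lambda_1/\gamma_1},\dots,\sqrt{\lambda_d/\gamma_d}\bigr)\prod_{i=1}^d\frac{r_i^{z_i+1/2}\lambda_i^{z_i-1/2}e^{-r_i\lambda_i}}{\Gamma(z_i+1/2)}\,\mathrm{d}\lambda,\quad z\in\mathbb{N}^d.$$ *)

theory Defs
  imports "HOL-Analysis.Analysis"
begin

definition partial :: "'d \<Rightarrow> (real ^ 'd \<Rightarrow> real) \<Rightarrow> real ^ 'd \<Rightarrow> real"
  where "partial i g x = deriv (\<lambda>t. g (x + t *\<^sub>R axis i 1)) 0"

definition C1_on_space :: "(real ^ 'd::finite \<Rightarrow> real) \<Rightarrow> bool"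
  where "C1_on_space g \<longleftrightarrow>
    (\<forall>i. (\<forall>x. (\<lambda>t. g (x + t *\<^sub>R axis i 1)) differentiable (at 0)) \<and>
         continuous_on UNIV (partial i g))"

definition C2_on_space :: "(real ^ 'd::finite \<Rightarrow> real) \<Rightarrow> bool"
  where "C2_on_space g \<longleftrightarrow> C1_on_space g \<and> (\<forall>i. C1_on_space (partial i g))"

definition superharmonic :: "(real ^ 'd::finite \<Rightarrow> real) \<Rightarrow> bool"
  where "superharmonic h \<longleftrightarrow>
    C2_on_space h \<and> (\<forall>\<theta>. (\<Sum>i\<in>UNIV. partial i (partial i h) \<theta>) \<le> 0)"

definition pos_orthant :: "(real ^ 'd) set"
  where "pos_orthant = {x. \<forall>i. 0 < x $ i}"

definition nonneg_orthant :: "(real ^ 'd) set"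
  where "nonneg_orthant = {x. \<forall>i. 0 \<le> x $ i}"

definition sign_vectors :: "(real ^ 'd) set"
  where "sign_vectors = {a. \<forall>i. a $ i \<in> {1, -1}}"

lemma finite_sign_vectors: "finite (sign_vectors :: (real ^ 'd::finite) set)"
proof (rule finite_subset)
  show "(sign_vectors :: (real ^ 'd) set) \<subseteq> vec_lambda ` (UNIV \<rightarrow>\<^sub>E {1, -1})"
  proof
    fix a :: "real ^ 'd"
    assume "a \<in> sign_vectors"
    then have "vec_nth a \<in> UNIV \<rightarrow>\<^sub>E {1, -1}"
      by (auto simp: sign_vectors_def)
    then show "a \<in> vec_lambda ` (UNIV \<rightarrow>\<^sub>E {1, -1})"
      by (metis image_eqI vec_nth_inverse)
  qed
qed (simp add: finite_PiE)

(* The sum is taken as a function on the whole space. It is even in each coordinate, so its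
   two-sided partial derivatives agree on the orthant, boundary included, with those (one-sided
   where necessary) of its restriction to the orthant. *)
definition sign_sum :: "(real ^ 'd::finite \<Rightarrow> real) \<Rightarrow> real ^ 'd \<Rightarrow> real"
  where "sign_sum h \<theta> = (\<Sum>a\<in>sign_vectors. h (\<chi> i. a $ i * \<theta> $ i))"

definition poisson_prob :: "real ^ 'd::finite \<Rightarrow> real ^ 'd \<Rightarrow> nat ^ 'd \<Rightarrow> real"
  where "poisson_prob r lam x =
    (\<Prod>i\<in>UNIV. (r $ i * lam $ i) ^ (x $ i) * exp (- (r $ i * lam $ i)) / fact (x $ i))"

(* Unchanged when the prior is multiplied by a positive constant, so priors are given by an
   unnormalised representative. *)
definition bayes_predictive ::
    "real ^ 'd::finite \<Rightarrow> real ^ 'd \<Rightarrow> (real ^ 'd \<Rightarrow> real) \<Rightarrow> nat ^ 'd \<Rightarrow> nat ^ 'd \<Rightarrow> real"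
  where "bayes_predictive r s prior y x =
    (LINT lam:pos_orthant|lborel. poisson_prob r lam x * poisson_prob s lam y * prior lam) /
    (LINT lam:pos_orthant|lborel. poisson_prob r lam x * prior lam)"

definition jeffreys_prior :: "real ^ 'd::finite \<Rightarrow> real"
  where "jeffreys_prior lam = (\<Prod>i\<in>UNIV. lam $ i powr (- 1 / 2))"

definition theta_of :: "real ^ 'd::finite \<Rightarrow> real ^ 'd \<Rightarrow> real ^ 'd"
  where "theta_of \<gamma> lam = (\<chi> i. sqrt (lam $ i / \<gamma> $ i))"

definition tilted_jeffreys_prior ::
    "real ^ 'd::finite \<Rightarrow> (real ^ 'd \<Rightarrow> real) \<Rightarrow> real ^ 'd \<Rightarrow> real"
  where "tilted_jeffreys_prior \<gamma> f lam = f (theta_of \<gamma> lam) * jeffreys_prior lam"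

(* Sum of a signed family as the difference of the sums of its positive and negative parts
   (e2ennreal truncates at 0), so that divergence to infinity is not collapsed to 0 as it is
   for the real-valued suminf and infsum. *)
definition ereal_sum :: "('a \<Rightarrow> ereal) \<Rightarrow> ereal"
  where "ereal_sum g =
    enn2ereal (\<integral>\<^sup>+ x. e2ennreal (g x) \<partial>count_space UNIV) -
    enn2ereal (\<integral>\<^sup>+ x. e2ennreal (- g x) \<partial>count_space UNIV)"

(* log (p / 0) = \<infinity> for p > 0, whereas ln (p / 0) = 0 on the reals. *)
definition log_ratio :: "real \<Rightarrow> real \<Rightarrow> ereal"
  where "log_ratio p q = (if q = 0 then \<infinity> else ereal (ln (p / q)))"

definition kl_risk ::
    "real ^ 'd::finite \<Rightarrow> real ^ 'd \<Rightarrow> (nat ^ 'd \<Rightarrow> nat ^ 'd \<Rightarrow> real) \<Rightarrow> real ^ 'd \<Rightarrow> ereal"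
  where "kl_risk r s q lam =
    ereal_sum (\<lambda>x. ereal (poisson_prob r lam x) *
      ereal_sum (\<lambda>y. ereal (poisson_prob s lam y) * log_ratio (poisson_prob s lam y) (q y x)))"

definition weakly_dominates ::
    "real ^ 'd::finite \<Rightarrow> real ^ 'd \<Rightarrow> (nat ^ 'd \<Rightarrow> nat ^ 'd \<Rightarrow> real) \<Rightarrow>
     (nat ^ 'd \<Rightarrow> nat ^ 'd \<Rightarrow> real) \<Rightarrow> bool"
  where "weakly_dominates r s q1 q2 \<longleftrightarrow>
    (\<forall>lam\<in>pos_orthant. kl_risk r s q1 lam \<le> kl_risk r s q2 lam)"

definition dominates ::
    "real ^ 'd::finite \<Rightarrow> real ^ 'd \<Rightarrow> (nat ^ 'd \<Rightarrow> nat ^ 'd \<Rightarrow> real) \<Rightarrow>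
     (nat ^ 'd \<Rightarrow> nat ^ 'd \<Rightarrow> real) \<Rightarrow> bool"
  where "dominates r s q1 q2 \<longleftrightarrow> weakly_dominates r s q1 q2 \<and>
    (\<exists>lam\<in>pos_orthant. kl_risk r s q1 lam < kl_risk r s q2 lam)"

definition F_gamma ::
    "real ^ 'd::finite \<Rightarrow> (real ^ 'd \<Rightarrow> real) \<Rightarrow> nat ^ 'd \<Rightarrow> real ^ 'd \<Rightarrow> real"
  where "F_gamma \<gamma> f z r =
    (LINT lam:pos_orthant|lborel. f (theta_of \<gamma> lam) *
      (\<Prod>i\<in>UNIV. r $ i powr (real (z $ i) + 1 / 2) * lam $ i powr (real (z $ i) - 1 / 2) *
         exp (- (r $ i * lam $ i)) / Gamma (real (z $ i) + 1 / 2)))"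

definition gauss_weight :: "nat ^ 'd::finite \<Rightarrow> real \<Rightarrow> real ^ 'd \<Rightarrow> real"
  where "gauss_weight z \<rho> \<theta> =
    (\<Prod>j\<in>UNIV. (\<theta> $ j) ^ (2 * z $ j) * exp (- \<rho> * (\<theta> $ j)\<^sup>2))"

end

theory Submission imports Defs begin

text \<open>Write \<open>G v z\<close> for the integral of \<open>f\<close> against the product of the densities of the signed square roots of
  gamma variables with shapes \<open>z\<^sub>i + 1/2\<close> and scales \<open>v\<^sub>i\<close>. Up to a constant, \<open>F(z, r + s)\<close> is \<open>G V z\<close>
  and \<open>F(z, r)\<close> is \<open>G (V + 1) z\<close>, where \<open>V = r / s\<close>; the ratio of the two predictive distributions at \<open>(x, y)\<close> is
  \<open>F(x + y, r + s) / F(x, r)\<close>. Running the heat flow for unit time from the density with parameters \<open>(z, V)\<close> gives the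
  mixture of the densities with parameters \<open>(x, V + 1)\<close>, where \<open>x\<close> is binomial with parameters \<open>z\<close> and \<open>r / (r + s)\<close>,
  that is, distributed as \<open>x\<close> given \<open>x + y = z\<close>. Integrals of a superharmonic function decrease along the heat
  flow, so \<open>E[F(x, r) | x + y = z] \<le> F(z, r + s)\<close>. The risk difference is
  \<open>E[ln F(x + y, r + s) - ln F(x, r)]\<close>, which is nonnegative by Jensen's inequality, applied conditionally on
  \<open>x + y\<close>.\<close>

subsection \<open>Integration over orthants\<close>

text \<open>The scaling by \<open>\<gamma>\<close> lets one isotropic heat flow serve all
  coordinates: in the variables \<open>\<theta>\<close> the scales belonging to \<open>r + s\<close>
  and to \<open>r\<close> differ by exactly one in every coordinate, whatever the durations. Summing
  \<open>h\<close> over sign changes gives an even function that is still C2 across the coordinate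
  hyperplanes, so orthant integrals become integrals over the whole space and integration by parts
  leaves no boundary terms. Two obstacles shape the rest. The function \<open>f\<close> may be
  unbounded and is only integrable against Gaussian weights, so the flow and its first two space
  derivatives need a Gaussian majorant that is uniform over unit time. And the risks are iterated
  sums of extended reals, so both must be proved finite before they can be subtracted and regrouped
  by \<open>x + y\<close>. This needs growth bounds on the logarithms of the mixtures; the lower one
  comes from the monotonicity inequality itself.\<close>

lemma prod_Basis_vec: "(\<Prod>b\<in>Basis. F b) = (\<Prod>i\<in>UNIV. F (axis i (1::real)))"
  for F :: "real ^ 'd::finite \<Rightarrow> 'b::comm_monoid_mult"
  by (simp add: Basis_vec_def UNION_singleton_eq_range prod.reindex axis_eq_axis inj_on_def)

lemma sum_Basis_vec: "(\<Sum>b\<in>Basis. F b) = (\<Sum>i\<in>UNIV. F (axis i (1::real)))"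
  for F :: "real ^ 'd::finite \<Rightarrow> 'b::comm_monoid_add"
  by (simp add: Basis_vec_def UNION_singleton_eq_range sum.reindex axis_eq_axis inj_on_def)

lemma nn_integral_lborel_vec_prod:
  fixes g :: "'d::finite \<Rightarrow> real \<Rightarrow> ennreal"
  assumes [measurable]: "\<And>i. g i \<in> borel_measurable borel"
  shows "(\<integral>\<^sup>+x. (\<Prod>i\<in>UNIV. g i (x $ i)) \<partial>lborel) = (\<Prod>i\<in>UNIV. \<integral>\<^sup>+t. g i t \<partial>lborel)"
proof -
  have "(\<integral>\<^sup>+x. (\<Prod>b\<in>Basis. g (axis_index b) (x \<bullet> b)) \<partial>(lborel :: (real ^ 'd) measure)) =
      (\<Prod>b\<in>(Basis :: (real ^ 'd) set). \<integral>\<^sup>+t. g (axis_index b) t \<partial>lborel)"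
    by (rule nn_integral_lborel_prod) auto
  then show ?thesis
    by (simp add: prod_Basis_vec axis_index_axis cart_eq_inner_axis)
qed

lemma borel_measurable_times_vec [measurable]:
  "(\<lambda>x. a * x) \<in> borel_measurable borel" for a :: "real ^ 'd::finite"
  by (intro borel_measurable_continuous_onI, unfold times_vec_def) (intro continuous_intros)

lemma AE_lborel_nth_neq: "AE x :: real ^ 'd::finite in lborel. \<forall>i. x $ i \<noteq> c"
  unfolding cart_eq_inner_axis by (intro AE_finite_allI[where S=UNIV, simplified] AE_lborel_inner_neq) simp_all

lemma times_sign_vector:
  assumes "a \<in> sign_vectors"
  shows "a * (a * x) = x" "\<bar>a $ i\<bar> = 1" "(a $ i)\<^sup>2 = 1" "a $ i * (a $ i * t) = t"
proof -
  have *: "a $ i = 1 \<or> a $ i = -1" for i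
    using assms by (auto simp: sign_vectors_def)
  show 1: "\<bar>a $ i\<bar> = 1" "(a $ i)\<^sup>2 = 1" "a $ i * (a $ i * t) = t" for i t
    using *[of i] by auto
  show "a * (a * x) = x"
    by (simp add: vec_eq_iff times_vec_def 1)
qed

lemma lborel_distr_sign_vector:
  assumes "a \<in> sign_vectors"
  shows "distr lborel borel ((*) a) = (lborel :: (real ^ 'd::finite) measure)"
proof -
  let ?c = "\<lambda>b. a \<bullet> b"
  have T: "(\<lambda>x. 0 + (\<Sum>j\<in>Basis. (?c j * (x \<bullet> j)) *\<^sub>R j)) = (*) a"
  proof
    fix x :: "real ^ 'd"
    have "(\<Sum>j\<in>Basis. (?c j * (x \<bullet> j)) *\<^sub>R j) = (\<Sum>i\<in>UNIV. (a $ i * x $ i) *\<^sub>R axis i 1)"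
      by (simp add: sum_Basis_vec inner_axis)
    also have "\<dots> = a * x"
      by (simp add: vec_eq_iff axis_def times_vec_def if_distrib cong: if_cong)
    finally show "0 + (\<Sum>j\<in>Basis. (?c j * (x \<bullet> j)) *\<^sub>R j) = a * x" by simp
  qed
  have "a $ i \<noteq> 0" for i
    using times_sign_vector(2)[OF assms, of i] by auto
  then have "?c j \<noteq> 0" if "j \<in> Basis" for j
    using that by (auto simp: Basis_vec_def inner_axis)
  then have "(lborel :: (real ^ 'd) measure) = density (distr lborel borel ((*) a)) (\<lambda>_. (\<Prod>j\<in>Basis. \<bar>?c j\<bar>))"
    by (subst T[symmetric], rule lborel_affine_euclidean)
  also have "(\<lambda>_. ennreal (\<Prod>j\<in>Basis. \<bar>?c j\<bar>)) = (\<lambda>_::real^'d. 1)"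
    using times_sign_vector(2)[OF assms] by (simp add: prod_Basis_vec inner_axis)
  finally show ?thesis by (simp add: density_1)
qed

lemma card_sign_vectors_neq_0: "real (card (sign_vectors :: (real ^ 'd::finite) set)) \<noteq> 0"
proof -
  have "(\<chi> i. 1) \<in> (sign_vectors :: (real ^ 'd) set)" by (simp add: sign_vectors_def)
  then show ?thesis by (auto simp: finite_sign_vectors)
qed

lemma pos_orthant_measurable [measurable]: "pos_orthant \<in> sets (borel :: (real ^ 'd::finite) measure)"
proof -
  have "pos_orthant = (\<Inter>i. {x :: real ^ 'd. 0 < x $ i})"
    by (auto simp: pos_orthant_def)
  also have "\<dots> \<in> sets borel"
    by (intro sets.countable_INT'' ) (auto intro!: borel_open open_Collect_less continuous_intros)
  finally show ?thesis .
qed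

text \<open>Exactly one reflection moves \<open>x\<close> into the open orthant, the one given by
  the signs of its coordinates.\<close>

lemma sum_indicator_sign_vectors:
  fixes x :: "real ^ 'd::finite"
  assumes "\<And>i. x $ i \<noteq> 0"
  shows "(\<Sum>a\<in>sign_vectors. indicator pos_orthant (a * x)) = (1::real)"
proof -
  let ?s = "\<chi> i. sgn (x $ i)"
  have s: "?s \<in> sign_vectors"
    using assms by (auto simp: sign_vectors_def sgn_if)
  have "a * x \<in> pos_orthant \<longleftrightarrow> a = ?s" if a: "a \<in> sign_vectors" for a
  proof -
    have "0 < a $ i * x $ i \<longleftrightarrow> a $ i = sgn (x $ i)" for i
      using a assms[of i] by (auto simp: sign_vectors_def sgn_if zero_less_mult_iff dest: spec[of _ i])
    then show ?thesis
      by (auto simp: pos_orthant_def times_vec_def vec_eq_iff)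
  qed
  then have "(\<Sum>a\<in>sign_vectors. indicator pos_orthant (a * x)) = (\<Sum>a\<in>sign_vectors. if a = ?s then 1 else (0::real))"
    by (intro sum.cong) (auto simp: indicator_def)
  then show ?thesis
    using s by (simp add: finite_sign_vectors)
qed

text \<open>The reflected copies of the orthant tile the space up to the coordinate hyperplanes, a
  null set, and reflections preserve Lebesgue measure, so each copy contributes the same
  amount.\<close>

lemma integral_even_orthant:
  fixes g :: "real ^ 'd::finite \<Rightarrow> real"
  assumes [measurable]: "g \<in> borel_measurable borel"
    and even: "\<And>a x. a \<in> sign_vectors \<Longrightarrow> g (a * x) = g x"
    and int: "set_integrable lborel pos_orthant g"
  shows "integrable lborel g"
    and "(\<integral>x. g x \<partial>lborel) = real (card (sign_vectors :: (real ^ 'd) set)) * (LINT x:pos_orthant|lborel. g x)"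
proof -
  let ?h = "\<lambda>x. indicator pos_orthant x * g x"
  have h: "integrable lborel ?h"
    using int by (simp add: set_integrable_def)
  have ha: "integrable lborel (\<lambda>x. ?h (a * x))" "(\<integral>x. ?h (a * x) \<partial>lborel) = (\<integral>x. ?h x \<partial>lborel)"
    if a: "a \<in> sign_vectors" for a
  proof -
    show "integrable lborel (\<lambda>x. ?h (a * x))"
      using integrable_distr[of "(*) a" lborel borel ?h] lborel_distr_sign_vector[OF a] h by simp
    show "(\<integral>x. ?h (a * x) \<partial>lborel) = (\<integral>x. ?h x \<partial>lborel)"
      using integral_distr[of "(*) a" lborel borel ?h] lborel_distr_sign_vector[OF a] by simp
  qed
  have eq: "AE x in lborel. (\<Sum>a\<in>sign_vectors. ?h (a * x)) = g x"
    using AE_lborel_nth_neq[of 0]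
  proof eventually_elim
    case (elim x)
    have "(\<Sum>a\<in>sign_vectors. ?h (a * x)) = (\<Sum>a\<in>sign_vectors. indicator pos_orthant (a * x)) * g x"
      using even by (simp add: sum_distrib_right)
    then show ?case
      using sum_indicator_sign_vectors[of x] elim by simp
  qed
  have s: "integrable lborel (\<lambda>x. \<Sum>a\<in>sign_vectors. ?h (a * x))"
    using ha by (intro Bochner_Integration.integrable_sum)
  show "integrable lborel g"
    by (rule integrable_cong_AE_imp[OF s]) (use eq in \<open>auto elim: eventually_mono\<close>)
  have "(\<integral>x. g x \<partial>lborel) = (\<integral>x. (\<Sum>a\<in>sign_vectors. ?h (a * x)) \<partial>lborel)"
    using s eq by (intro integral_cong_AE) (auto elim: eventually_mono)
  also have "\<dots> = (\<Sum>a\<in>(sign_vectors :: (real ^ 'd) set). \<integral>x. ?h x \<partial>lborel)"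
    using ha by (subst Bochner_Integration.integral_sum) auto
  finally show "(\<integral>x. g x \<partial>lborel) = real (card (sign_vectors :: (real ^ 'd) set)) * (LINT x:pos_orthant|lborel. g x)"
    by (simp add: set_lebesgue_integral_def)
qed

text \<open>The map \<open>t \<mapsto> c * (t * \<bar>t\<bar>)\<close> is a strictly increasing C1
  bijection of the line with derivative \<open>2 * c * \<bar>t\<bar>\<close>, so the set is an
  interval and the fundamental theorem evaluates the integral.\<close>

lemma nn_integral_signed_square:
  fixes c l u :: real
  assumes c: "0 < c" and lu: "l \<le> u"
  shows "(\<integral>\<^sup>+t. ennreal (2 * c * \<bar>t\<bar>) * indicator {t. l < c * (t * \<bar>t\<bar>) \<and> c * (t * \<bar>t\<bar>) < u} t \<partial>lborel) = ennreal (u - l)"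
proof -
  define S where "S t = c * (t * \<bar>t\<bar>)" for t
  define R where "R x = sgn x * sqrt (\<bar>x\<bar> / c)" for x
  have SR: "S (R x) = x" for x
    using c by (auto simp: S_def R_def sgn_if abs_mult)
  have mono: "S x < S y" if "x < y" for x y
  proof (cases "0 \<le> x")
    case True
    then have "x * x < y * y" using that by (intro mult_strict_mono') auto
    then show ?thesis using True that c by (auto simp: S_def)
  next
    case False
    show ?thesis
    proof (cases "0 \<le> y")
      case True
      have "x * \<bar>x\<bar> < 0" using False by (intro mult_neg_pos) auto
      also have "0 \<le> y * \<bar>y\<bar>" using True by simp
      finally show ?thesis using c by (simp add: S_def)
    next
      case f2: False
      then have "(-y) * (-y) < (-x) * (-x)" using that by (intro mult_strict_mono') auto
      then have "y * y < x * x" by simp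
      then show ?thesis using False f2 c by (auto simp: S_def)
    qed
  qed
  have iff: "S x < S y \<longleftrightarrow> x < y" for x y
    by (cases rule: linorder_cases[of x y]) (auto dest: mono)
  have le: "R l \<le> R u"
    using iff[of "R u" "R l"] lu by (simp add: SR)
  have set: "{t. l < c * (t * \<bar>t\<bar>) \<and> c * (t * \<bar>t\<bar>) < u} = {R l <..< R u}"
    using iff[of "R l"] iff[of _ "R u"] unfolding SR S_def[symmetric] by auto
  have D: "DERIV S t :> 2 * c * \<bar>t\<bar>" for t
  proof (cases t "0::real" rule: linorder_cases)
    case less
    have "((\<lambda>t. c * (t * -t)) has_real_derivative 2 * c * \<bar>t\<bar>) (at t)"
      using less by (auto intro!: derivative_eq_intros)
    then show ?thesis
      by (rule has_field_derivative_transform_within_open[where S="{..<0}"]) (use less in \<open>auto simp: S_def\<close>)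
  next
    case greater
    have "((\<lambda>t. c * (t * t)) has_real_derivative 2 * c * \<bar>t\<bar>) (at t)"
      using greater by (auto intro!: derivative_eq_intros)
    then show ?thesis
      by (rule has_field_derivative_transform_within_open[where S="{0<..}"]) (use greater in \<open>auto simp: S_def\<close>)
  next
    case equal
    \<comment> \<open>At the origin, where the two quadratic branches meet, the difference quotient
      is \<open>c * \<bar>h\<bar>\<close>.\<close>
    have "(\<lambda>h. c * \<bar>h\<bar>) \<midarrow>0\<rightarrow> 0"
      by (rule tendsto_eq_intros refl | simp)+
    then have "(\<lambda>h. (S (0 + h) - S 0) / h) \<midarrow>0\<rightarrow> 0"
      by (rule Lim_transform_eventually) (auto simp: S_def eventually_at_filter)
    then show ?thesis using equal by (simp add: DERIV_def)
  qed
  have "(\<integral>\<^sup>+t. ennreal (2 * c * \<bar>t\<bar>) * indicator {R l<..<R u} t \<partial>lborel) =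
      (\<integral>\<^sup>+t. ennreal (2 * c * \<bar>t\<bar>) * indicator {R l..R u} t \<partial>lborel)"
    using AE_lborel_singleton[of "R l"] AE_lborel_singleton[of "R u"]
    by (intro nn_integral_cong_AE) (auto simp: indicator_def elim: eventually_elim2)
  also have "\<dots> = S (R u) - S (R l)"
    using D c le by (intro nn_integral_FTC_Icc) (auto intro!: DERIV_subset)
  finally show ?thesis by (simp add: set SR)
qed

section \<open>The signed square as a change of variables\<close>

definition signed_square :: "real ^ 'd::finite \<Rightarrow> real ^ 'd \<Rightarrow> real ^ 'd"
  where "signed_square c x = (\<chi> i. c $ i * (x $ i * \<bar>x $ i\<bar>))"

lemma signed_square_measurable [measurable]: "signed_square c \<in> borel_measurable borel"
  unfolding signed_square_def by (intro borel_measurable_continuous_onI continuous_intros)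

text \<open>Keeping the sign makes coordinatewise squaring a bijection of the whole space, so the
  image measure can be identified on boxes, where it splits into one-dimensional integrals. Plain
  squaring would only reach the orthant.\<close>

lemma lborel_signed_square:
  fixes c :: "real ^ 'd::finite"
  assumes c: "\<And>i. 0 < c $ i"
  shows "lborel = distr (density lborel (\<lambda>x. ennreal (\<Prod>i\<in>UNIV. 2 * c $ i * \<bar>x $ i\<bar>))) borel (signed_square c)"
proof (rule lborel_eqI)
  fix l u :: "real ^ 'd"
  assume "\<And>b. b \<in> Basis \<Longrightarrow> l \<bullet> b \<le> u \<bullet> b"
  then have "l \<bullet> axis i 1 \<le> u \<bullet> axis i 1" for i
    by simp
  then have lu: "l $ i \<le> u $ i" for i
    by (simp add: inner_axis)
  let ?S = "\<lambda>i. {t. l $ i < c $ i * (t * \<bar>t\<bar>) \<and> c $ i * (t * \<bar>t\<bar>) < u $ i}"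
  have S [measurable]: "?S i \<in> sets borel" for i
    by measurable
  have "emeasure (distr (density lborel (\<lambda>x. ennreal (\<Prod>i\<in>UNIV. 2 * c $ i * \<bar>x $ i\<bar>))) borel (signed_square c)) (box l u)
     = (\<integral>\<^sup>+x. ennreal (\<Prod>i\<in>UNIV. 2 * c $ i * \<bar>x $ i\<bar>) * indicator (signed_square c -` box l u) x \<partial>lborel)"
    by (simp add: emeasure_distr emeasure_density measurable_sets_borel[OF signed_square_measurable])
  also have "\<dots> = (\<integral>\<^sup>+x. (\<Prod>i\<in>UNIV. ennreal (2 * c $ i * \<bar>x $ i\<bar>) * indicator (?S i) (x $ i)) \<partial>lborel)"
  proof (intro nn_integral_cong)
    fix x :: "real ^ 'd"
    have "indicator (signed_square c -` box l u) x = (\<Prod>i\<in>UNIV. indicator (?S i) (x $ i) :: ennreal)"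
      by (auto simp: indicator_def mem_box_cart signed_square_def intro!: prod_zero)
    then show "ennreal (\<Prod>i\<in>UNIV. 2 * c $ i * \<bar>x $ i\<bar>) * indicator (signed_square c -` box l u) x =
       (\<Prod>i\<in>UNIV. ennreal (2 * c $ i * \<bar>x $ i\<bar>) * indicator (?S i) (x $ i))"
      using c by (simp add: prod.distrib prod_ennreal less_imp_le)
  qed
  also have "\<dots> = (\<Prod>i\<in>UNIV. \<integral>\<^sup>+t. ennreal (2 * c $ i * \<bar>t\<bar>) * indicator (?S i) t \<partial>lborel)"
    by (rule nn_integral_lborel_vec_prod) measurable
  also have "\<dots> = (\<Prod>i\<in>UNIV. ennreal (u $ i - l $ i))"
    using nn_integral_signed_square[OF c lu] by simp
  also have "\<dots> = ennreal (\<Prod>b\<in>Basis. (u - l) \<bullet> b)"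
    using lu by (simp add: prod_ennreal prod_Basis_vec inner_axis)
  finally show "emeasure (distr (density lborel (\<lambda>x. ennreal (\<Prod>i\<in>UNIV. 2 * c $ i * \<bar>x $ i\<bar>))) borel (signed_square c)) (box l u)
     = ennreal (\<Prod>b\<in>Basis. (u - l) \<bullet> b)" .
qed simp

text \<open>On the positive orthant the signed square is the inverse of \<^const>\<open>theta_of\<close>.\<close>

lemma set_integral_theta_of:
  fixes c :: "real ^ 'd::finite" and H :: "real ^ 'd \<Rightarrow> real"
  assumes c: "\<And>i. 0 < c $ i" and [measurable]: "H \<in> borel_measurable borel"
  shows "(LINT x:pos_orthant|lborel. H x) =
    (LINT x:pos_orthant|lborel. (\<Prod>i\<in>UNIV. 2 * c $ i * x $ i) * H (\<chi> i. c $ i * (x $ i)\<^sup>2))"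
proof -
  have pos: "signed_square c x \<in> pos_orthant \<longleftrightarrow> x \<in> pos_orthant" for x
    using c by (auto simp: pos_orthant_def signed_square_def zero_less_mult_iff dest: order_less_asym)
      (metis abs_ge_zero order_less_asym not_less zero_less_abs_iff)+
  have "(LINT x:pos_orthant|lborel. H x) =
     (\<integral>x. indicator pos_orthant x * H x \<partial>distr (density lborel (\<lambda>x. ennreal (\<Prod>i\<in>UNIV. 2 * c $ i * \<bar>x $ i\<bar>))) borel (signed_square c))"
    by (subst lborel_signed_square[OF c, symmetric]) (simp add: set_lebesgue_integral_def)
  also have "\<dots> = (\<integral>x. (\<Prod>i\<in>UNIV. 2 * c $ i * \<bar>x $ i\<bar>) *
       (indicator pos_orthant (signed_square c x) * H (signed_square c x)) \<partial>lborel)"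
    using c by (subst integral_distr) (auto simp: integral_density prod_nonneg less_imp_le)
  also have "\<dots> = (LINT x:pos_orthant|lborel. (\<Prod>i\<in>UNIV. 2 * c $ i * x $ i) * H (\<chi> i. c $ i * (x $ i)\<^sup>2))"
    unfolding set_lebesgue_integral_def
  proof (intro Bochner_Integration.integral_cong refl)
    fix x :: "real ^ 'd"
    show "(\<Prod>i\<in>UNIV. 2 * c $ i * \<bar>x $ i\<bar>) * (indicator pos_orthant (signed_square c x) * H (signed_square c x))
       = indicator pos_orthant x *\<^sub>R ((\<Prod>i\<in>UNIV. 2 * c $ i * x $ i) * H (\<chi> i. c $ i * (x $ i)\<^sup>2))"
    proof (cases "x \<in> pos_orthant")
      case True
      then have "\<bar>x $ i\<bar> = x $ i" for i by (auto simp: pos_orthant_def less_imp_le)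
      then have "signed_square c x = (\<chi> i. c $ i * (x $ i)\<^sup>2)"
        by (simp add: signed_square_def power2_eq_square)
      moreover have "(\<Prod>i\<in>UNIV. 2 * c $ i * \<bar>x $ i\<bar>) = (\<Prod>i\<in>UNIV. 2 * c $ i * x $ i)"
        using \<open>\<And>i. \<bar>x $ i\<bar> = x $ i\<close> by simp
      moreover have "signed_square c x \<in> pos_orthant"
        using True by (simp add: pos)
      ultimately show ?thesis using True by simp
    qed (simp add: pos)
  qed
  finally show ?thesis .
qed

subsection \<open>Monotonicity along the heat flow\<close>

lemma borel_measurable_nth_vec [measurable (raw)]:
  fixes f :: "'a \<Rightarrow> real ^ 'd::finite"
  assumes "f \<in> borel_measurable M"
  shows "(\<lambda>x. f x $ i) \<in> borel_measurable M"
  using assms by (rule borel_measurable_continuous_on[rotated]) (intro continuous_intros)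

text \<open>The derivative need not be continuous: a derivative always has a gauge integral, and
  absolute integrability serves to identify it with the Lebesgue integral.\<close>

lemma set_integral_FTC:
  fixes g g' :: "real \<Rightarrow> real"
  assumes "set_integrable lborel {0..1} g'"
    and "\<And>s. s \<in> {0..1} \<Longrightarrow> (g has_real_derivative g' s) (at s within {0..1})"
  shows "(LINT s:{0..1}|lborel. g' s) = g 1 - g 0"
proof -
  have "(g' has_integral g 1 - g 0) {0..1}"
    using assms(2) by (intro fundamental_theorem_of_calculus) (auto simp: has_real_derivative_iff_has_vector_derivative)
  then show ?thesis
    using set_borel_integral_eq_integral(2)[OF assms(1)] by (simp add: integral_unique)
qed

text \<open>Fubini replaces differentiation under the integral sign. A bound on the integrals of
  \<open>\<bar>H' s x\<bar>\<close> that is uniform in \<open>s\<close> gives integrability on the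
  product, whereas a common majorant in \<open>x\<close> may fail to exist for the translates of an
  integrable function.\<close>

lemma integral_parametric_FTC:
  fixes H H' :: "real \<Rightarrow> 'a::euclidean_space \<Rightarrow> real"
  assumes meas: "(\<lambda>(s, x). H' s x) \<in> borel_measurable (borel \<Otimes>\<^sub>M borel)"
    and int: "\<And>s. s \<in> {0..1} \<Longrightarrow> integrable lborel (H' s)"
    and bound: "\<And>s. s \<in> {0..1} \<Longrightarrow> (\<integral>x. \<bar>H' s x\<bar> \<partial>lborel) \<le> B"
    and deriv: "\<And>s x. s \<in> {0..1} \<Longrightarrow> ((\<lambda>s. H s x) has_real_derivative H' s x) (at s within {0..1})"
    and int01: "integrable lborel (H 0)" "integrable lborel (H 1)"
  shows "(\<integral>x. H 1 x \<partial>lborel) - (\<integral>x. H 0 x \<partial>lborel) = (LINT s:{0..1}|lborel. (\<integral>x. H' s x \<partial>lborel))"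
proof -
  let ?K = "\<lambda>s x. indicator {0..1} s * H' s x"
  note [measurable] = meas
  have K [measurable]: "(\<lambda>(s, x). ?K s x) \<in> borel_measurable (lborel \<Otimes>\<^sub>M lborel)"
    by measurable
  have Kint: "integrable (lborel \<Otimes>\<^sub>M lborel) (\<lambda>(s, x). ?K s x)"
  proof (rule lborel_pair.Fubini_integrable[OF K])
    have "integrable lborel (\<lambda>s. indicator {0..1::real} s * B)"
      by (intro integrable_mult_left) simp
    then show "integrable lborel (\<lambda>s. \<integral>x. norm (case (s, x) of (s, x) \<Rightarrow> ?K s x) \<partial>lborel)"
    proof (rule Bochner_Integration.integrable_bound)
      show "AE s in lborel. norm (\<integral>x. norm (case (s, x) of (s, x) \<Rightarrow> ?K s x) \<partial>lborel) \<le> norm (indicator {0..1} s * B)"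
        using bound by (intro AE_I2) (auto simp: indicator_def abs_mult intro: order_trans[OF _ abs_ge_self])
    qed measurable
    show "AE s in lborel. integrable lborel (\<lambda>x. case (s, x) of (s, x) \<Rightarrow> ?K s x)"
      using int by (intro AE_I2) (auto simp: indicator_def)
  qed
  \<comment> \<open>Integrability in \<open>s\<close> is known only for almost every
    \<open>x\<close>, which is all that the outer integral sees.\<close>
  have "AE x in lborel. (\<integral>s. ?K s x \<partial>lborel) = H 1 x - H 0 x"
    using lborel_pair.AE_integrable_snd[OF Kint]
  proof eventually_elim
    case (elim x)
    then have "(LINT s:{0..1}|lborel. H' s x) = H 1 x - H 0 x"
      using deriv by (intro set_integral_FTC) (auto simp: set_integrable_def)
    then show ?case by (simp add: set_lebesgue_integral_def)
  qed
  then have "(\<integral>x. (\<integral>s. ?K s x \<partial>lborel) \<partial>lborel) = (\<integral>x. H 1 x - H 0 x \<partial>lborel)"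
    using int01 by (intro integral_cong_AE) auto
  then show ?thesis
    using int01 lborel_pair.Fubini_integral[OF Kint] by (simp add: set_lebesgue_integral_def)
qed

lemma lborel_translate:
  fixes g :: "'a::euclidean_space \<Rightarrow> real"
  assumes "integrable lborel g"
  shows "integrable lborel (\<lambda>x. g (x + c))" and "(\<integral>x. g (x + c) \<partial>lborel) = (\<integral>x. g x \<partial>lborel)"
proof -
  have [measurable]: "g \<in> borel_measurable borel"
    using assms by auto
  have "(\<lambda>x. g (c + x)) = (\<lambda>x. g (x + c))" by (simp add: add.commute)
  then show "integrable lborel (\<lambda>x. g (x + c))" "(\<integral>x. g (x + c) \<partial>lborel) = (\<integral>x. g x \<partial>lborel)"
    using integrable_distr[of "(+) c" lborel borel g] integral_distr[of "(+) c" lborel borel g] assms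
    by (simp_all add: lborel_distr_plus)
qed

lemma has_real_derivative_along_line:
  fixes g :: "'a::real_vector \<Rightarrow> real"
  assumes "\<And>x. ((\<lambda>t. g (x + t *\<^sub>R e)) has_real_derivative g' x) (at 0)"
  shows "((\<lambda>t. g (x + t *\<^sub>R e)) has_real_derivative g' (x + s *\<^sub>R e)) (at s)"
  using assms[of "x + s *\<^sub>R e"] DERIV_shift[of "\<lambda>t. g (x + t *\<^sub>R e)" "g' (x + s *\<^sub>R e)" 0 s]
  by (simp add: scaleR_add_left ac_simps)

text \<open>Translation invariance gives \<open>\<integral>(G (x + e) - G x) dx = 0\<close>, and by Fubini the left-hand side is
  \<open>\<integral>\<^sub>0\<^sup>1 \<integral>G' (x + s e) dx ds = \<integral>G'\<close>.\<close>

lemma integral_directional_derivative_eq_0: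
  fixes G G' :: "'a::euclidean_space \<Rightarrow> real"
  assumes G: "integrable lborel G" and G': "integrable lborel G'"
    and deriv: "\<And>x. ((\<lambda>t. G (x + t *\<^sub>R e)) has_real_derivative G' x) (at 0)"
  shows "(\<integral>x. G' x \<partial>lborel) = 0"
proof -
  have [measurable]: "G' \<in> borel_measurable borel"
    using G' by auto
  have abs: "integrable lborel (\<lambda>x. \<bar>G' x\<bar>)"
    using G' by simp
  have "(\<integral>x. G (x + 1 *\<^sub>R e) \<partial>lborel) - (\<integral>x. G (x + 0 *\<^sub>R e) \<partial>lborel) =
      (LINT s:{0..1}|lborel. (\<integral>x. G' (x + s *\<^sub>R e) \<partial>lborel))"
  proof (rule integral_parametric_FTC[where B="\<integral>x. \<bar>G' x\<bar> \<partial>lborel"])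
    show "(\<lambda>(s, x). G' (x + s *\<^sub>R e)) \<in> borel_measurable (borel \<Otimes>\<^sub>M borel)"
      by measurable
    show "integrable lborel (\<lambda>x. G' (x + s *\<^sub>R e))" for s
      by (rule lborel_translate[OF G'])
    show "(\<integral>x. \<bar>G' (x + s *\<^sub>R e)\<bar> \<partial>lborel) \<le> (\<integral>x. \<bar>G' x\<bar> \<partial>lborel)" for s
      using lborel_translate(2)[OF abs] by simp
    show "((\<lambda>s. G (x + s *\<^sub>R e)) has_real_derivative G' (x + s *\<^sub>R e)) (at s within {0..1})" for s x
      using has_real_derivative_along_line[OF deriv] by (rule DERIV_subset) simp
  qed (use lborel_translate(1)[OF G, of e] G in auto)
  then show ?thesis
    using lborel_translate[OF G] lborel_translate[OF G']
    by (simp add: set_lebesgue_integral_def)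
qed

lemma prod_nth_has_derivative:
  fixes x :: "real ^ 'd::finite"
  assumes "(\<psi> i has_real_derivative D) (at (x $ i))"
  shows "((\<lambda>t. \<Prod>j\<in>UNIV. \<psi> j ((x + t *\<^sub>R axis i 1) $ j)) has_real_derivative
     D * (\<Prod>j\<in>UNIV - {i}. \<psi> j (x $ j))) (at 0)"
proof -
  have "(\<Prod>j\<in>UNIV. \<psi> j ((x + t *\<^sub>R axis i 1) $ j)) = \<psi> i (x $ i + t) * (\<Prod>j\<in>UNIV - {i}. \<psi> j (x $ j))" for t
    by (subst prod.remove[where x=i]) (auto simp: axis_def intro!: prod.cong)
  moreover have "((\<lambda>t. \<psi> i (x $ i + t)) has_real_derivative D) (at 0)"
    using assms DERIV_shift[of "\<psi> i" D 0 "x $ i"] by (simp add: add.commute)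
  ultimately show ?thesis
    by (simp add: DERIV_cmult_right)
qed

lemma gauss_weight_0: "gauss_weight 0 \<rho> x = (\<Prod>j\<in>UNIV. exp (- \<rho> * (x $ j)\<^sup>2))"
  by (simp add: gauss_weight_def)

lemma abs_prod_le_gauss_weight:
  fixes x :: "real ^ 'd::finite"
  assumes "\<And>j y. \<bar>g j y\<bar> \<le> C * exp (- \<rho> * y\<^sup>2)"
  shows "\<bar>\<Prod>j\<in>UNIV. g j (x $ j)\<bar> \<le> C ^ CARD('d) * gauss_weight 0 \<rho> x"
proof -
  have "\<bar>\<Prod>j\<in>UNIV. g j (x $ j)\<bar> \<le> (\<Prod>j\<in>(UNIV::'d set). C * exp (- \<rho> * (x $ j)\<^sup>2))"
    unfolding abs_prod by (intro prod_mono) (use assms in auto)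
  then show ?thesis
    by (simp add: prod.distrib gauss_weight_0)
qed

lemma integrable_times_gauss_bounded:
  fixes g w :: "real ^ 'd::finite \<Rightarrow> real"
  assumes g: "integrable lborel (\<lambda>x. \<bar>g x\<bar> * gauss_weight 0 \<rho> x)" and w: "\<And>x. \<bar>w x\<bar> \<le> C * gauss_weight 0 \<rho> x"
    and [measurable]: "g \<in> borel_measurable borel" "w \<in> borel_measurable borel"
  shows "integrable lborel (\<lambda>x. g x * w x)"
    and "(\<integral>x. \<bar>g x * w x\<bar> \<partial>lborel) \<le> C * (\<integral>x. \<bar>g x\<bar> * gauss_weight 0 \<rho> x \<partial>lborel)"
proof -
  have le: "\<bar>g x * w x\<bar> \<le> C * (\<bar>g x\<bar> * gauss_weight 0 \<rho> x)" for x
    using mult_left_mono[OF w[of x], of "\<bar>g x\<bar>"] by (simp add: abs_mult mult_ac)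
  show 1: "integrable lborel (\<lambda>x. g x * w x)"
    using integrable_mult_right[OF g, of C]
    by (rule Bochner_Integration.integrable_bound) (auto intro!: AE_I2 order_trans[OF le])
  have "(\<integral>x. \<bar>g x * w x\<bar> \<partial>lborel) \<le> (\<integral>x. C * (\<bar>g x\<bar> * gauss_weight 0 \<rho> x) \<partial>lborel)"
    using 1 g le by (intro integral_mono) auto
  then show "(\<integral>x. \<bar>g x * w x\<bar> \<partial>lborel) \<le> C * (\<integral>x. \<bar>g x\<bar> * gauss_weight 0 \<rho> x \<partial>lborel)"
    using g by simp
qed

definition gauss_integrable :: "real \<Rightarrow> (real ^ 'd::finite \<Rightarrow> real) \<Rightarrow> bool"
  where "gauss_integrable \<rho> g \<longleftrightarrow> g \<in> borel_measurable borel \<and> integrable lborel (\<lambda>x. \<bar>g x\<bar> * gauss_weight 0 \<rho> x)"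

text \<open>The time derivative of the integral is a quarter of the integral of \<open>f\<close>
  times the Laplacian of the kernel. Green's identity moves the Laplacian to \<open>f\<close>, where
  superharmonicity and a nonnegative kernel make it nonpositive. The kernel is a product over
  coordinates, so one-variable hypotheses with a common Gaussian majorant suffice. The factor 1/4
  belongs to a Gaussian whose variance grows like \<open>t / 2\<close>.\<close>

theorem superharmonic_heat_flow_mono:
  fixes f :: "real ^ 'd::finite \<Rightarrow> real" and \<psi> \<psi>1 \<psi>2 :: "'d \<Rightarrow> real \<Rightarrow> real \<Rightarrow> real"
  assumes sh: "superharmonic f"
    and gi: "gauss_integrable \<rho> f" "\<And>i. gauss_integrable \<rho> (partial i f)" "\<And>i. gauss_integrable \<rho> (partial i (partial i f))"
    and d1: "\<And>i t y. t \<in> {0..1} \<Longrightarrow> (\<psi> i t has_real_derivative \<psi>1 i t y) (at y)"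
    and d2: "\<And>i t y. t \<in> {0..1} \<Longrightarrow> (\<psi>1 i t has_real_derivative \<psi>2 i t y) (at y)"
    and dt: "\<And>i t y. t \<in> {0..1} \<Longrightarrow> ((\<lambda>t. \<psi> i t y) has_real_derivative \<psi>2 i t y / 4) (at t)"
    and b0: "\<And>i t y. t \<in> {0..1} \<Longrightarrow> \<bar>\<psi> i t y\<bar> \<le> C * exp (- \<rho> * y\<^sup>2)"
    and b1: "\<And>i t y. t \<in> {0..1} \<Longrightarrow> \<bar>\<psi>1 i t y\<bar> \<le> C * exp (- \<rho> * y\<^sup>2)"
    and b2: "\<And>i t y. t \<in> {0..1} \<Longrightarrow> \<bar>\<psi>2 i t y\<bar> \<le> C * exp (- \<rho> * y\<^sup>2)"
    and m [measurable]: "\<And>i. case_prod (\<psi> i) \<in> borel_measurable (borel \<Otimes>\<^sub>M borel)"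
      "\<And>i. case_prod (\<psi>1 i) \<in> borel_measurable (borel \<Otimes>\<^sub>M borel)"
      "\<And>i. case_prod (\<psi>2 i) \<in> borel_measurable (borel \<Otimes>\<^sub>M borel)"
    and nonneg: "\<And>i t y. t \<in> {0..1} \<Longrightarrow> 0 \<le> \<psi> i t y"
  shows "(\<integral>x. f x * (\<Prod>i\<in>UNIV. \<psi> i 1 (x $ i)) \<partial>lborel) \<le> (\<integral>x. f x * (\<Prod>i\<in>UNIV. \<psi> i 0 (x $ i)) \<partial>lborel)"
proof -
  define \<Phi> where "\<Phi> t x = (\<Prod>i\<in>UNIV. \<psi> i t (x $ i))" for t and x :: "real ^ 'd"
  define \<Phi>1 where "\<Phi>1 i t x = \<psi>1 i t (x $ i) * (\<Prod>j\<in>UNIV - {i}. \<psi> j t (x $ j))" for i t and x :: "real ^ 'd"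
  define \<Phi>2 where "\<Phi>2 i t x = \<psi>2 i t (x $ i) * (\<Prod>j\<in>UNIV - {i}. \<psi> j t (x $ j))" for i t and x :: "real ^ 'd"
  have mf [measurable]: "f \<in> borel_measurable borel" "\<And>i. partial i f \<in> borel_measurable borel"
    "\<And>i. partial i (partial i f) \<in> borel_measurable borel"
    using gi by (auto simp: gauss_integrable_def)
  have mPhi [measurable]: "(\<lambda>(t, x). \<Phi> t x) \<in> borel_measurable (borel \<Otimes>\<^sub>M borel)"
    "(\<lambda>(t, x). \<Phi>1 i t x) \<in> borel_measurable (borel \<Otimes>\<^sub>M borel)"
    "(\<lambda>(t, x). \<Phi>2 i t x) \<in> borel_measurable (borel \<Otimes>\<^sub>M borel)" for i
    unfolding \<Phi>_def \<Phi>1_def \<Phi>2_def by measurable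
  have mPhi' [measurable]: "\<Phi> t \<in> borel_measurable borel" "\<Phi>1 i t \<in> borel_measurable borel" 
    "\<Phi>2 i t \<in> borel_measurable borel" for i t
    using measurable_compose[OF measurable_Pair1' mPhi(1), of t]  measurable_compose[OF measurable_Pair1' mPhi(2), of t i]
      measurable_compose[OF measurable_Pair1' mPhi(3), of t i] by auto
  \<comment> \<open>Absorbing the exceptional factor gives a full product again, so the bound and
    the derivative rule for products also apply to \<open>\<Phi>1\<close> and
    \<open>\<Phi>2\<close>.\<close>
  have upd: "g i (x $ i) * (\<Prod>j\<in>UNIV - {i}. \<psi> j t (x $ j)) = (\<Prod>j\<in>UNIV. (if j = i then g i else \<psi> j t) (x $ j))"
    for g i t and x :: "real ^ 'd"
    by (subst prod.remove[where x=i]) (auto intro!: prod.cong)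
  have bPhi: "\<bar>\<Phi> t x\<bar> \<le> C ^ CARD('d) * gauss_weight 0 \<rho> x" "\<bar>\<Phi>1 i t x\<bar> \<le> C ^ CARD('d) * gauss_weight 0 \<rho> x"
    "\<bar>\<Phi>2 i t x\<bar> \<le> C ^ CARD('d) * gauss_weight 0 \<rho> x" if "t \<in> {0..1}" for t i x
    unfolding \<Phi>_def \<Phi>1_def \<Phi>2_def upd[where g="\<lambda>i. \<psi>1 i t"] upd[where g="\<lambda>i. \<psi>2 i t"]
    by (intro abs_prod_le_gauss_weight; use b0[OF that] b1[OF that] b2[OF that] in simp)+
  have dPhi: "((\<lambda>s. \<Phi> t (x + s *\<^sub>R axis i 1)) has_real_derivative \<Phi>1 i t x) (at 0)"
    "((\<lambda>s. \<Phi>1 i t (x + s *\<^sub>R axis i 1)) has_real_derivative \<Phi>2 i t x) (at 0)" if "t \<in> {0..1}" for t i x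
  proof -
    show "((\<lambda>s. \<Phi> t (x + s *\<^sub>R axis i 1)) has_real_derivative \<Phi>1 i t x) (at 0)"
      unfolding \<Phi>_def \<Phi>1_def by (rule prod_nth_has_derivative) (rule d1[OF that])
    have "((\<lambda>s. \<Prod>j\<in>UNIV. (if j = i then \<psi>1 i t else \<psi> j t) ((x + s *\<^sub>R axis i 1) $ j)) has_real_derivative 
        \<psi>2 i t (x $ i) * (\<Prod>j\<in>UNIV - {i}. (if j = i then \<psi>1 i t else \<psi> j t) (x $ j))) (at 0)"
      by (rule prod_nth_has_derivative) (simp add: d2[OF that])
    moreover have "(\<Prod>j\<in>UNIV - {i}. (if j = i then \<psi>1 i t else \<psi> j t) (x $ j)) = (\<Prod>j\<in>UNIV - {i}. \<psi> j t (x $ j))"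
      by (intro prod.cong) auto
    ultimately show "((\<lambda>s. \<Phi>1 i t (x + s *\<^sub>R axis i 1)) has_real_derivative \<Phi>2 i t x) (at 0)"
      unfolding \<Phi>1_def \<Phi>2_def upd[where g="\<lambda>i. \<psi>1 i t"] by simp
  qed
  have fd: "((\<lambda>s. f (x + s *\<^sub>R axis i 1)) has_real_derivative partial i f x) (at 0)"
    "((\<lambda>s. partial i f (x + s *\<^sub>R axis i 1)) has_real_derivative partial i (partial i f) x) (at 0)" for x i
    using sh by (auto simp: superharmonic_def C2_on_space_def C1_on_space_def partial_def DERIV_deriv_iff_real_differentiable)
  note I = integrable_times_gauss_bounded
  have gi': "integrable lborel (\<lambda>x. \<bar>f x\<bar> * gauss_weight 0 \<rho> x)" "integrable lborel (\<lambda>x. \<bar>partial i f x\<bar> * gauss_weight 0 \<rho> x)"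
    "integrable lborel (\<lambda>x. \<bar>partial i (partial i f) x\<bar> * gauss_weight 0 \<rho> x)" for i
    using gi by (auto simp: gauss_integrable_def)
  have ibp: "(\<integral>x. f x * \<Phi>2 i t x \<partial>lborel) = (\<integral>x. partial i (partial i f) x * \<Phi> t x \<partial>lborel)" if t: "t \<in> {0..1}" for i t
  proof -
    have ints: "integrable lborel (\<lambda>x. f x * \<Phi>2 i t x)" "integrable lborel (\<lambda>x. partial i (partial i f) x * \<Phi> t x)"
       "integrable lborel (\<lambda>x. f x * \<Phi>1 i t x)" "integrable lborel (\<lambda>x. partial i f x * \<Phi> t x)"
      by (rule I(1)[OF gi'(1) bPhi(3)[OF t]] I(1)[OF gi'(3) bPhi(1)[OF t]] I(1)[OF gi'(1) bPhi(2)[OF t]] I(1)[OF gi'(2) bPhi(1)[OF t]]; measurable)+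
    \<comment> \<open>Green's identity one coordinate at a time: the integrand is the derivative of
      \<open>f x * \<Phi>1 i t x - partial i f x * \<Phi> t x\<close> along the axis
      \<open>i\<close>, because the mixed products cancel.\<close>
    have "(\<integral>x. f x * \<Phi>2 i t x - partial i (partial i f) x * \<Phi> t x \<partial>lborel) = 0"
    proof (rule integral_directional_derivative_eq_0)
      show "integrable lborel (\<lambda>x. f x * \<Phi>1 i t x - partial i f x * \<Phi> t x)"
        "integrable lborel (\<lambda>x. f x * \<Phi>2 i t x - partial i (partial i f) x * \<Phi> t x)"
        using ints by auto
      show "((\<lambda>s. f (x + s *\<^sub>R axis i 1) * \<Phi>1 i t (x + s *\<^sub>R axis i 1) -
           partial i f (x + s *\<^sub>R axis i 1) * \<Phi> t (x + s *\<^sub>R axis i 1)) has_real_derivative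
          f x * \<Phi>2 i t x - partial i (partial i f) x * \<Phi> t x) (at 0)" for x
        by (rule derivative_eq_intros fd dPhi[OF t] refl)+ (simp add: algebra_simps)
    qed
    then show ?thesis using ints by simp
  qed
  have dtPhi: "((\<lambda>t. \<Phi> t x) has_real_derivative (\<Sum>i\<in>UNIV. \<Phi>2 i t x) / 4) (at t)" if t: "t \<in> {0..1}" for t x
  proof -
    have "((\<lambda>t. \<Prod>i\<in>UNIV. \<psi> i t (x $ i)) has_real_derivative
        (\<Sum>i\<in>UNIV. \<psi>2 i t (x $ i) / 4 * (\<Prod>j\<in>UNIV - {i}. \<psi> j t (x $ j)))) (at t)"
      by (rule has_field_derivative_prod) (rule dt[OF t])
    then show ?thesis
      by (simp add: \<Phi>_def[abs_def] \<Phi>2_def sum_divide_distrib)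
  qed
  let ?L = "\<lambda>t x. f x * ((\<Sum>i\<in>UNIV. \<Phi>2 i t x) / 4)"
  have intf: "integrable lborel (\<lambda>x. f x * \<Phi>2 i t x)" "(\<integral>x. \<bar>f x * \<Phi>2 i t x\<bar> \<partial>lborel) \<le>
      C ^ CARD('d) * (\<integral>x. \<bar>f x\<bar> * gauss_weight 0 \<rho> x \<partial>lborel)" if t: "t \<in> {0..1}" for t i
    by (rule I[OF gi'(1) bPhi(3)[OF t]]; measurable)+
  have L: "?L t x = (\<Sum>i\<in>UNIV. f x * \<Phi>2 i t x) / 4" for t x
    by (simp add: sum_distrib_left)
  have "(\<integral>x. f x * \<Phi> 1 x \<partial>lborel) - (\<integral>x. f x * \<Phi> 0 x \<partial>lborel) = (LINT t:{0..1}|lborel. (\<integral>x. ?L t x \<partial>lborel))"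
  proof (rule integral_parametric_FTC)
    show "(\<lambda>(t, x). ?L t x) \<in> borel_measurable (borel \<Otimes>\<^sub>M borel)"
      by measurable
    show "integrable lborel (?L t)" if "t \<in> {0..1}" for t
      unfolding L using intf[OF that] by (intro Bochner_Integration.integrable_divide Bochner_Integration.integrable_sum) auto
    show "(\<integral>x. \<bar>?L t x\<bar> \<partial>lborel) \<le> (\<Sum>i\<in>(UNIV::'d set). C ^ CARD('d) * (\<integral>x. \<bar>f x\<bar> * gauss_weight 0 \<rho> x \<partial>lborel))"
      if t: "t \<in> {0..1}" for t
    proof -
      have "(\<integral>x. \<bar>?L t x\<bar> \<partial>lborel) \<le> (\<integral>x. (\<Sum>i\<in>UNIV. \<bar>f x * \<Phi>2 i t x\<bar>) \<partial>lborel)"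
      proof (rule integral_mono)
        show "integrable lborel (\<lambda>x. \<bar>?L t x\<bar>)"
          unfolding L using intf[OF t] 
          by (intro integrable_abs Bochner_Integration.integrable_divide Bochner_Integration.integrable_sum) auto
        show "integrable lborel (\<lambda>x. \<Sum>i\<in>UNIV. \<bar>f x * \<Phi>2 i t x\<bar>)"
          using intf[OF t] by (intro Bochner_Integration.integrable_sum integrable_abs) auto
        show "\<bar>?L t x\<bar> \<le> (\<Sum>i\<in>UNIV. \<bar>f x * \<Phi>2 i t x\<bar>)" for x
          unfolding L abs_divide abs_numeral
          using sum_abs[of "\<lambda>i. f x * \<Phi>2 i t x" UNIV] abs_ge_zero[of "\<Sum>i\<in>UNIV. f x * \<Phi>2 i t x"] by linarith
      qed
      also have "\<dots> = (\<Sum>i\<in>UNIV. \<integral>x. \<bar>f x * \<Phi>2 i t x\<bar> \<partial>lborel)"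
        using intf[OF t] by (intro Bochner_Integration.integral_sum) auto
      also have "\<dots> \<le> (\<Sum>i\<in>(UNIV::'d set). C ^ CARD('d) * (\<integral>x. \<bar>f x\<bar> * gauss_weight 0 \<rho> x \<partial>lborel))"
        using intf[OF t] by (intro sum_mono) auto
      finally show ?thesis .
    qed
    show "((\<lambda>t. f x * \<Phi> t x) has_real_derivative ?L t x) (at t within {0..1})" if "t \<in> {0..1}" for t x
      by (rule has_field_derivative_at_within[OF DERIV_cmult[OF dtPhi[OF that]]])
    show "integrable lborel (\<lambda>x. f x * \<Phi> 0 x)" "integrable lborel (\<lambda>x. f x * \<Phi> 1 x)"
      using I(1)[OF gi'(1) bPhi(1)[of 0] mf(1) mPhi'(1)] I(1)[OF gi'(1) bPhi(1)[of 1] mf(1) mPhi'(1)] by simp_all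
  qed
  also have "\<dots> \<le> 0"
  proof -
    have "(\<integral>x. ?L t x \<partial>lborel) \<le> 0" if t: "t \<in> {0..1}" for t
    proof -
      have i2: "integrable lborel (\<lambda>x. partial i (partial i f) x * \<Phi> t x)" for i
        by (rule I(1)[OF gi'(3) bPhi(1)[OF t]]; measurable)
      have "(\<integral>x. ?L t x \<partial>lborel) = (\<Sum>i\<in>UNIV. \<integral>x. f x * \<Phi>2 i t x \<partial>lborel) / 4"
        unfolding L using intf[OF t] by simp
      also have "\<dots> = (\<integral>x. (\<Sum>i\<in>UNIV. partial i (partial i f) x * \<Phi> t x) \<partial>lborel) / 4"
        using i2 by (simp add: ibp[OF t])
      also have "\<dots> = (\<integral>x. (\<Sum>i\<in>UNIV. partial i (partial i f) x) * \<Phi> t x \<partial>lborel) / 4"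
        by (simp add: sum_distrib_right)
      also have "\<dots> \<le> 0"
      proof -
        have "(\<integral>x. - ((\<Sum>i\<in>UNIV. partial i (partial i f) x) * \<Phi> t x) \<partial>lborel) \<ge> 0"
          using sh nonneg[OF t]
          by (intro integral_nonneg_AE AE_I2) (auto simp: superharmonic_def \<Phi>_def intro!: mult_nonpos_nonneg prod_nonneg)
        then show ?thesis by simp
      qed
      finally show ?thesis .
    qed
    then have "0 \<le> (\<integral>t. - (indicator {0..1} t * (\<integral>x. ?L t x \<partial>lborel)) \<partial>lborel)"
      by (intro integral_nonneg_AE AE_I2) (auto simp: indicator_def)
    then show ?thesis by (simp add: set_lebesgue_integral_def)
  qed
  finally show ?thesis by (simp add: \<Phi>_def)
qed

subsection \<open>The Gaussian heat flow of a square-root gamma density\<close>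

definition root_gamma_density :: "nat \<Rightarrow> real \<Rightarrow> real \<Rightarrow> real"
  where "root_gamma_density k v y =
    y ^ (2 * k) * exp (- (y\<^sup>2 / v)) / (Gamma (real k + 1 / 2) * v powr (real k + 1 / 2))"

text \<open>At \<open>k = 0\<close> the truncated exponent \<open>2 * k - 1\<close> is harmless,
  since its factor \<open>2 * real k\<close> vanishes.\<close>

definition root_gamma_density' :: "nat \<Rightarrow> real \<Rightarrow> real \<Rightarrow> real"
  where "root_gamma_density' k v y =
    (2 * real k * y ^ (2 * k - 1) - 2 * y ^ (2 * k + 1) / v) * exp (- (y\<^sup>2 / v)) /
    (Gamma (real k + 1 / 2) * v powr (real k + 1 / 2))"

text \<open>Multiplying by the square of \<open>y\<close> raises the shape by one, so the second
  derivative stays in the span of the family. The three coefficients add up to zero, as they must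
  for densities of equal mass; at \<open>k = 0\<close> the term with \<open>k - 1\<close> has
  coefficient zero.\<close>

definition root_gamma_density'' :: "nat \<Rightarrow> real \<Rightarrow> real \<Rightarrow> real"
  where "root_gamma_density'' k v y =
    4 * real k / v * root_gamma_density (k - 1) v y - (8 * real k + 2) / v * root_gamma_density k v y
    + (4 * real k + 2) / v * root_gamma_density (Suc k) v y"

lemma root_gamma_density_nonneg: "0 < v \<Longrightarrow> 0 \<le> root_gamma_density k v y"
  by (auto simp: root_gamma_density_def intro!: divide_nonneg_nonneg mult_nonneg_nonneg Gamma_real_nonneg)

lemma Gamma_Suc_half: "Gamma (real (Suc k) + 1 / 2) = (real k + 1 / 2) * Gamma (real k + 1 / 2)"
proof -
  have "real k + 1 / 2 \<notin> \<int>\<^sub>\<le>\<^sub>0"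
    by (auto elim!: nonpos_Ints_cases')
  then show ?thesis
    using Gamma_plus1[of "real k + 1 / 2"] by (simp add: add_ac)
qed

lemma root_gamma_density_Suc:
  assumes "0 < v"
  shows "root_gamma_density (Suc k) v y = y\<^sup>2 / ((real k + 1 / 2) * v) * root_gamma_density k v y"
proof -
  note Gamma_Suc_half[of k]
  moreover have "v powr (real (Suc k) + 1 / 2) = v * v powr (real k + 1 / 2)"
    using assms powr_add[of v 1 "real k + 1 / 2"] by (simp add: add_ac)
  moreover have "y ^ (2 * Suc k) = y\<^sup>2 * y ^ (2 * k)"
    by (simp add: power2_eq_square)
  ultimately show ?thesis
    unfolding root_gamma_density_def by (simp only: times_divide_times_eq mult_ac)
qed

lemma root_gamma_density_has_derivative:
  assumes "0 < v"
  shows "(root_gamma_density k v has_real_derivative root_gamma_density' k v y) (at y)"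
proof -
  have "((\<lambda>y. y ^ (2 * k) * exp (- (y\<^sup>2 / v))) has_real_derivative
     (2 * real k * y ^ (2 * k - 1) - 2 * y ^ (2 * k + 1) / v) * exp (- (y\<^sup>2 / v))) (at y)"
    using assms by (auto intro!: derivative_eq_intros simp: algebra_simps)
  from DERIV_cdivide[OF this, of "Gamma (real k + 1 / 2) * v powr (real k + 1 / 2)"]
  show ?thesis
    unfolding root_gamma_density_def[abs_def] root_gamma_density'_def .
qed

lemma root_gamma_density'_has_derivative:
  assumes v: "0 < v"
  shows "(root_gamma_density' k v has_real_derivative root_gamma_density'' k v y) (at y)"
proof -
  define c where "c = Gamma (real k + 1 / 2) * v powr (real k + 1 / 2)"
  define E where "E = exp (- (y\<^sup>2 / v))"
  have P: "((\<lambda>y. 2 * real k * y ^ (2 * k - 1) - 2 * y ^ (2 * k + 1) / v) has_real_derivative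
     2 * real k * (real (2 * k - 1) * y ^ (2 * k - 1 - Suc 0)) - 2 * (real (2 * k + 1) * y ^ (2 * k + 1 - Suc 0)) / v) (at y)"
    by (intro DERIV_diff DERIV_cmult DERIV_cdivide DERIV_pow)
  have Q: "((\<lambda>y. exp (- (y\<^sup>2 / v))) has_real_derivative E * - (2 * y / v)) (at y)"
    using v by (auto intro!: derivative_eq_intros simp: E_def)
  have y1: "real k * y ^ (2 * k - 1) * y = real k * y ^ (2 * k)"
    by (cases k) auto
  have "(2 * real k * (real (2 * k - 1) * y ^ (2 * k - 1 - Suc 0)) - 2 * (real (2 * k + 1) * y ^ (2 * k + 1 - Suc 0)) / v) * E +
      E * - (2 * y / v) * (2 * real k * y ^ (2 * k - 1) - 2 * y ^ (2 * k + 1) / v) =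
      (2 * real k * (real (2 * k - 1) * y ^ (2 * k - 2)) - 2 * real (2 * k + 1) * y ^ (2 * k) / v
       - 4 / v * (real k * y ^ (2 * k - 1) * y) + 4 * y\<^sup>2 * y ^ (2 * k) / v\<^sup>2) * E"
    by (simp add: algebra_simps power2_eq_square numeral_2_eq_2)
  also have "\<dots> = (2 * real k * (real (2 * k - 1) * y ^ (2 * k - 2)) - (8 * real k + 2) * y ^ (2 * k) / v + 4 * y\<^sup>2 * y ^ (2 * k) / v\<^sup>2) * E"
    unfolding y1 by (simp add: algebra_simps add_divide_distrib)
  finally have "((\<lambda>y. (2 * real k * y ^ (2 * k - 1) - 2 * y ^ (2 * k + 1) / v) * exp (- (y\<^sup>2 / v))) has_real_derivative
     (2 * real k * (real (2 * k - 1) * y ^ (2 * k - 2)) - (8 * real k + 2) * y ^ (2 * k) / v + 4 * y\<^sup>2 * y ^ (2 * k) / v\<^sup>2) * E) (at y)"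
    using DERIV_mult[OF P Q] by (simp only: E_def)
  from DERIV_cdivide[OF this, of c]
  have d: "(root_gamma_density' k v has_real_derivative
     (2 * real k * (real (2 * k - 1) * y ^ (2 * k - 2)) - (8 * real k + 2) * y ^ (2 * k) / v + 4 * y\<^sup>2 * y ^ (2 * k) / v\<^sup>2) * E / c) (at y)"
    unfolding root_gamma_density'_def[abs_def] c_def .
  have k: "root_gamma_density k v y = y ^ (2 * k) * E / c"
    by (simp add: root_gamma_density_def c_def E_def)
  \<comment> \<open>For \<open>k = Suc m\<close> the Gamma recursion trades the normalising constant
    of \<open>m\<close> for that of \<open>k\<close>; for \<open>k = 0\<close> both sides
    vanish.\<close>
  have low: "4 * real k / v * root_gamma_density (k - 1) v y = 2 * real k * (real (2 * k - 1) * y ^ (2 * k - 2)) * E / c"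
  proof (cases k)
    case (Suc m)
    have "c = (real m + 1 / 2) * v * (Gamma (real m + 1 / 2) * v powr (real m + 1 / 2))"
      using Gamma_Suc_half[of m] powr_add[of v 1 "real m + 1 / 2"] v
      by (simp add: c_def Suc add_ac)
    then have "root_gamma_density m v y = (real m + 1 / 2) * v * (y ^ (2 * m) * E / c)"
      using v by (simp add: root_gamma_density_def E_def)
    moreover have "4 * real k / v * ((real m + 1 / 2) * v * X) = 2 * real k * real (2 * k - 1) * X" for X
      using v by (simp add: Suc field_simps)
    ultimately show ?thesis
      by (simp add: Suc)
  qed simp
  have high: "(4 * real k + 2) / v * root_gamma_density (Suc k) v y = 4 * y\<^sup>2 * y ^ (2 * k) / v\<^sup>2 * E / c"
  proof -
    have "4 * x / v * (a / (x * v) * q) = 4 * a / v\<^sup>2 * q" if "x \<noteq> 0" for a q x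
      using v that by (simp add: field_simps power2_eq_square)
    from this[of "real k + 1 / 2" "y\<^sup>2" "y ^ (2 * k) * E / c"] show ?thesis
      by (simp add: root_gamma_density_Suc[OF v] k)
  qed
  have "root_gamma_density'' k v y = (2 * real k * (real (2 * k - 1) * y ^ (2 * k - 2)) - (8 * real k + 2) * y ^ (2 * k) / v + 4 * y\<^sup>2 * y ^ (2 * k) / v\<^sup>2) * E / c"
    unfolding root_gamma_density''_def low high k by (simp add: algebra_simps diff_divide_distrib add_divide_distrib)
  with d show ?thesis by simp
qed

text \<open>A single density does not solve the heat equation: this derivative exceeds a quarter of
  \<open>root_gamma_density'' k v y\<close> by \<open>k / v\<close> times the difference of the
  densities of index \<open>k\<close> and \<open>k - 1\<close>. The binomial weights have to cancel
  that defect.\<close>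

lemma root_gamma_density_has_derivative_scale:
  assumes v: "0 < v"
  shows "((\<lambda>v. root_gamma_density k v y) has_real_derivative
    (real k + 1 / 2) / v * (root_gamma_density (Suc k) v y - root_gamma_density k v y)) (at v)"
proof -
  define c where "c = Gamma (real k + 1 / 2)"
  have c: "c \<noteq> 0"
    using Gamma_real_pos[of "real k + 1 / 2"] unfolding c_def by linarith
  have 1: "(real k + 1 / 2) / v * (root_gamma_density (Suc k) v y - root_gamma_density k v y) =
      (y\<^sup>2 / v\<^sup>2 - (real k + 1 / 2) / v) * (y ^ (2 * k) * exp (- (y\<^sup>2 / v)) / (c * v powr (real k + 1 / 2)))"
  proof -
    have "x / v * (a / (x * v) * q - q) = (a / v\<^sup>2 - x / v) * q" if "x \<noteq> 0" for a q x
      using v that by (simp add: field_simps power2_eq_square)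
    moreover have "real k + 1 / 2 \<noteq> 0" by linarith
    ultimately show ?thesis
      by (simp only: root_gamma_density_Suc[OF v]) (simp only: root_gamma_density_def c_def)
  qed
  define a where "a = real k + 1 / 2"
  have "((\<lambda>v. v powr - a) has_real_derivative - a * v powr - a / v) (at v)"
    using has_real_derivative_powr[OF v, of "- a"] v by (simp add: powr_diff)
  moreover have "((\<lambda>v. exp (- (y\<^sup>2 / v))) has_real_derivative exp (- (y\<^sup>2 / v)) * (y\<^sup>2 / v\<^sup>2)) (at v)"
    using v by (auto intro!: derivative_eq_intros simp: power2_eq_square)
  ultimately have "((\<lambda>v. y ^ (2 * k) / c * (exp (- (y\<^sup>2 / v)) * v powr - a)) has_real_derivative
      y ^ (2 * k) / c * (exp (- (y\<^sup>2 / v)) * (y\<^sup>2 / v\<^sup>2) * v powr - a + - a * v powr - a / v * exp (- (y\<^sup>2 / v)))) (at v)"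
    by (intro DERIV_cmult DERIV_mult)
  moreover have "y ^ (2 * k) / c * (exp (- (y\<^sup>2 / u)) * u powr - a) = y ^ (2 * k) * exp (- (y\<^sup>2 / u)) / (c * u powr a)" for u
    by (simp add: powr_minus_divide)
  moreover have "y ^ (2 * k) / c * (exp (- (y\<^sup>2 / v)) * (y\<^sup>2 / v\<^sup>2) * q + - a * q / v * exp (- (y\<^sup>2 / v))) =
      (y\<^sup>2 / v\<^sup>2 - a / v) * (y ^ (2 * k) / c * (exp (- (y\<^sup>2 / v)) * q))" for q
    by (simp add: algebra_simps diff_divide_distrib)
  ultimately have "((\<lambda>v. y ^ (2 * k) * exp (- (y\<^sup>2 / v)) / (c * v powr a)) has_real_derivative
      (y\<^sup>2 / v\<^sup>2 - a / v) * (y ^ (2 * k) * exp (- (y\<^sup>2 / v)) / (c * v powr a))) (at v)"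
    by (simp only:)
  then show ?thesis
    unfolding 1 unfolding root_gamma_density_def[abs_def] c_def a_def .
qed

section \<open>Binomial weights that restore the heat equation\<close>

definition binomial_coeff :: "nat \<Rightarrow> real \<Rightarrow> nat \<Rightarrow> real \<Rightarrow> real"
  where "binomial_coeff z V k t = real (z choose k) * V ^ k * t ^ (z - k) / (V + t) ^ z"

text \<open>This is the forward equation of a pure death chain in which each of \<open>z\<close>
  units dies at rate \<open>1 / (V + t)\<close>, the rate dictated by the defect
  \<open>k / (V + t)\<close> of the densities. A unit survives until \<open>t\<close> with
  probability \<open>V / (V + t)\<close>, whence the binomial weights.\<close>

lemma binomial_coeff_has_derivative:
  assumes V: "0 < V" "0 \<le> t" and k: "k \<le> z"
  shows "((binomial_coeff z V k) has_real_derivative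
    (real (Suc k) * binomial_coeff z V (Suc k) t - real k * binomial_coeff z V k t) / (V + t)) (at t)"
proof -
  define v where "v = V + t"
  have v: "0 < v" using V by (simp add: v_def)
  have "(binomial_coeff z V k has_real_derivative
      real (z choose k) * V ^ k * (real (z - k) * t ^ (z - k - 1) * v ^ z - t ^ (z - k) * (real z * v ^ (z - 1))) / (v ^ z * v ^ z)) (at t)"
    unfolding binomial_coeff_def[abs_def] v_def
    using v by (auto intro!: derivative_eq_intros simp: v_def) (simp add: algebra_simps)
  moreover have "real (z choose k) * V ^ k * (real (z - k) * t ^ (z - k - 1) * v ^ z - t ^ (z - k) * (real z * v ^ (z - 1))) / (v ^ z * v ^ z)
     = (real (Suc k) * binomial_coeff z V (Suc k) t - real k * binomial_coeff z V k t) / v"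
  \<comment> \<open>For \<open>k = z\<close> the weight of index \<open>Suc k\<close> vanishes with
    its binomial coefficient, and the truncated power of \<open>t\<close> carries the factor
    \<open>real (z - k) = 0\<close>.\<close>
  proof (cases "k = z")
    case True
    show ?thesis
    proof -
      have "real z * v ^ (z - 1) = real z * v ^ z / v"
        using v by (cases z) auto
      then show ?thesis
        using v True by (simp add: binomial_coeff_def v_def[symmetric] binomial_eq_0 mult_ac)
    qed
  next
    case False
    then obtain m where m: "z = Suc (k + m)"
      using k by (metis add_Suc_right le_neq_implies_less less_imp_Suc_add)
    have "Suc k * (z choose Suc k) = (z - k) * (z choose k)"
      using binomial_absorb_comp[of z k] by (metis binomial_absorption times_binomial_minus1_eq binomial_absorb_comp mult.commute
         diff_Suc_1 zero_less_Suc)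
    then have c: "real (Suc k) * real (z choose Suc k) = real (Suc m) * real (z choose k)"
      unfolding m by (metis (no_types) Suc_diff_le add_diff_cancel_left' le_add1 of_nat_mult)
    have "real (Suc k) * binomial_coeff z V (Suc k) t = real (Suc m) * real (z choose k) * V ^ Suc k * t ^ m / v ^ z"
      unfolding binomial_coeff_def c[symmetric] v_def by (simp add: m)
    then have "(real (Suc k) * binomial_coeff z V (Suc k) t - real k * binomial_coeff z V k t) / v =
      real (z choose k) * V ^ k * t ^ m * (real (Suc m) * V - real k * t) / (v ^ z * v)"
      using v by (simp add: binomial_coeff_def v_def[symmetric] m field_simps)
    also have "real (Suc m) * V - real k * t = real (Suc m) * v - real z * t"
      by (simp add: m v_def algebra_simps)
    also have "real (z choose k) * V ^ k * t ^ m * (real (Suc m) * v - real z * t) / (v ^ z * v) =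
       real (z choose k) * V ^ k * (real (z - k) * t ^ (z - k - 1) * v ^ z - t ^ (z - k) * (real z * v ^ (z - 1))) / (v ^ z * v ^ z)"
    proof -
      have "v ^ (z - 1) = v ^ z / v" using v by (simp add: m)
      moreover have "z - k - 1 = m" "z - k = Suc m" by (simp_all add: m)
      moreover have "v ^ z \<noteq> 0" using v by simp
      ultimately show ?thesis using v by (simp add: field_simps)
    qed
    finally show ?thesis by simp
  qed
  ultimately show ?thesis by (simp add: v_def)
qed

text \<open>The convolution of \<open>root_gamma_density z V\<close> with the centred Gaussian of variance \<open>t / 2\<close>.\<close>

definition root_gamma_flow :: "nat \<Rightarrow> real \<Rightarrow> real \<Rightarrow> real \<Rightarrow> real"
  where "root_gamma_flow z V t y = (\<Sum>k\<le>z. binomial_coeff z V k t * root_gamma_density k (V + t) y)"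

definition root_gamma_flow' :: "nat \<Rightarrow> real \<Rightarrow> real \<Rightarrow> real \<Rightarrow> real"
  where "root_gamma_flow' z V t y = (\<Sum>k\<le>z. binomial_coeff z V k t * root_gamma_density' k (V + t) y)"

definition root_gamma_flow'' :: "nat \<Rightarrow> real \<Rightarrow> real \<Rightarrow> real \<Rightarrow> real"
  where "root_gamma_flow'' z V t y = (\<Sum>k\<le>z. binomial_coeff z V k t * root_gamma_density'' k (V + t) y)"

text \<open>The flow of weight from \<open>k\<close> to \<open>k - 1\<close> supplies exactly what
  separates the scale derivative of each density from a quarter of its second space
  derivative.\<close>

lemma root_gamma_flow_heat_equation:
  assumes V: "0 < V" "0 \<le> t"
  shows "((\<lambda>t. root_gamma_flow z V t y) has_real_derivative root_gamma_flow'' z V t y / 4) (at t)"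
proof -
  define v where "v = V + t"
  define b where "b k = binomial_coeff z V k t" for k
  define e where "e k = root_gamma_density k v y" for k
  have v: "0 < v" using V by (simp add: v_def)
  have de: "((\<lambda>t. root_gamma_density k (V + t) y) has_real_derivative (real k + 1 / 2) / v * (e (Suc k) - e k)) (at t)" for k
    using DERIV_shift[of "\<lambda>v. root_gamma_density k v y" _ t V] root_gamma_density_has_derivative_scale[OF v, of k y]
    by (simp add: e_def v_def add.commute)
  have "((\<lambda>t. root_gamma_flow z V t y) has_real_derivative
    (\<Sum>k\<le>z. (real (Suc k) * b (Suc k) - real k * b k) / v * e k + (real k + 1 / 2) / v * (e (Suc k) - e k) * b k)) (at t)"
    unfolding root_gamma_flow_def b_def
    by (intro DERIV_sum) (use DERIV_mult[OF binomial_coeff_has_derivative[OF V] de] in \<open>simp add: e_def v_def\<close>)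
  moreover have "(\<Sum>k\<le>z. (real (Suc k) * b (Suc k) - real k * b k) / v * e k + (real k + 1 / 2) / v * (e (Suc k) - e k) * b k)
     = root_gamma_flow'' z V t y / 4"
  proof -
    \<comment> \<open>The reindexing charges the gain at \<open>k\<close> to the index
      \<open>k + 1\<close> that it comes from. The top term vanishes because
      \<open>b (Suc z) = 0\<close>, and the truncation in \<open>e (k - 1)\<close> at
      \<open>k = 0\<close> is multiplied by zero.\<close>
    have shift: "(\<Sum>k\<le>z. real (Suc k) * b (Suc k) * e k) = (\<Sum>k\<le>z. real k * b k * e (k - 1))"
    proof -
      have "b (Suc z) = 0" by (simp add: b_def binomial_coeff_def)
      then have "(\<Sum>k\<le>z. real (Suc k) * b (Suc k) * e k) = (\<Sum>k<z. real (Suc k) * b (Suc k) * e k)"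
        by (simp add: lessThan_Suc_atMost[symmetric])
      also have "\<dots> = (\<Sum>k\<le>z. real k * b k * e (k - 1))"
        by (subst sum.atMost_shift) simp
      finally show ?thesis .
    qed
    have "root_gamma_flow'' z V t y / 4 = (\<Sum>k\<le>z. b k * (real k * e (k - 1) - (2 * real k + 1 / 2) * e k + (real k + 1 / 2) * e (Suc k)) / v)"
      unfolding root_gamma_flow''_def sum_divide_distrib root_gamma_density''_def b_def e_def v_def[symmetric]
      using v by (intro sum.cong refl) (simp add: field_simps)
    also have "\<dots> = ((\<Sum>k\<le>z. real k * b k * e (k - 1)) + (\<Sum>k\<le>z. b k * (- (2 * real k + 1 / 2) * e k + (real k + 1 / 2) * e (Suc k)))) / v"
      unfolding sum.distrib[symmetric] sum_divide_distrib by (intro sum.cong refl) (simp add: algebra_simps)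
    also have "\<dots> = (\<Sum>k\<le>z. (real (Suc k) * b (Suc k) - real k * b k) / v * e k + (real k + 1 / 2) / v * (e (Suc k) - e k) * b k)"
      unfolding shift[symmetric] sum.distrib[symmetric] sum_divide_distrib
      using v by (intro sum.cong refl) (simp add: field_simps)
    finally show ?thesis by simp
  qed
  ultimately show ?thesis by (simp only:)
qed

section \<open>Gaussian bounds uniform over unit time\<close>

definition gauss_bounded :: "real \<Rightarrow> (real \<Rightarrow> real \<Rightarrow> real) \<Rightarrow> bool"
  where "gauss_bounded \<rho> g \<longleftrightarrow> (\<exists>C. \<forall>t\<in>{0..1}. \<forall>y. \<bar>g t y\<bar> \<le> C * exp (- \<rho> * y\<^sup>2))"

lemma gauss_bounded_add:
  assumes "gauss_bounded \<rho> g" "gauss_bounded \<rho> h"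
  shows "gauss_bounded \<rho> (\<lambda>t y. g t y + h t y)"
proof -
  obtain C D where *: "\<And>t y. t \<in> {0..1} \<Longrightarrow> \<bar>g t y\<bar> \<le> C * exp (- \<rho> * y\<^sup>2)"
    "\<And>t y. t \<in> {0..1} \<Longrightarrow> \<bar>h t y\<bar> \<le> D * exp (- \<rho> * y\<^sup>2)"
    using assms unfolding gauss_bounded_def by blast
  have "\<bar>g t y + h t y\<bar> \<le> (C + D) * exp (- \<rho> * y\<^sup>2)" if "t \<in> {0..1}" for t y
    using *(1)[OF that, of y] *(2)[OF that, of y] abs_triangle_ineq[of "g t y" "h t y"]
    unfolding distrib_right by linarith
  then show ?thesis unfolding gauss_bounded_def by blast
qed

lemma gauss_bounded_sum:
  assumes "finite A" "\<And>k. k \<in> A \<Longrightarrow> gauss_bounded \<rho> (g k)"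
  shows "gauss_bounded \<rho> (\<lambda>t y. \<Sum>k\<in>A. g k t y)"
  using assms
proof (induction A rule: finite_induct)
  case empty
  show ?case by (auto simp: gauss_bounded_def intro!: exI[of _ 0])
next
  case (insert k A)
  then show ?case by (simp add: gauss_bounded_add)
qed

lemma gauss_bounded_mult:
  assumes c: "continuous_on {0..1} c" and g: "gauss_bounded \<rho> g"
  shows "gauss_bounded \<rho> (\<lambda>t y. c t * g t y)"
proof -
  have "bounded (c ` {0..1})"
    using c by (intro compact_imp_bounded compact_continuous_image) auto
  then obtain K where K: "\<And>t. t \<in> {0..1} \<Longrightarrow> \<bar>c t\<bar> \<le> K"
    unfolding bounded_iff real_norm_def by blast
  obtain C where C: "\<And>t y. t \<in> {0..1} \<Longrightarrow> \<bar>g t y\<bar> \<le> C * exp (- \<rho> * y\<^sup>2)"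
    using g unfolding gauss_bounded_def by blast
  have "\<bar>c t * g t y\<bar> \<le> K * C * exp (- \<rho> * y\<^sup>2)" if t: "t \<in> {0..1}" for t y
    using mult_mono[OF K[OF t] C[OF t, of y]] K[OF t] by (simp add: abs_mult mult.assoc)
  then show ?thesis unfolding gauss_bounded_def by blast
qed

lemma power_le_fact_exp: "x ^ n \<le> fact n * exp x" if "0 \<le> x" for x :: real
proof -
  have "x ^ n / fact n = (\<Sum>k\<in>{n}. x ^ k /\<^sub>R fact k)"
    by (simp add: divide_inverse mult.commute)
  also have "\<dots> \<le> (\<Sum>k. x ^ k /\<^sub>R fact k)"
    using that summable_exp_generic[of x] by (intro sum_le_suminf) auto
  finally show ?thesis
    by (simp add: exp_def field_simps)
qed

text \<open>The condition on \<open>\<rho>\<close> makes the exponent at least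
  \<open>2 * \<rho> * y\<^sup>2\<close> at every time up to one. One half of it absorbs the
  monomial, the other half remains as the bound.\<close>

lemma gauss_bounded_monomial:
  assumes V: "0 < V" and \<rho>: "0 < \<rho>" "2 * \<rho> * (V + 1) \<le> 1"
  shows "gauss_bounded \<rho> (\<lambda>t y. y ^ m * exp (- (y\<^sup>2 / (V + t))))"
proof -
  have "\<bar>y ^ m * exp (- (y\<^sup>2 / (V + t)))\<bar> \<le> (1 + fact m / \<rho> ^ m) * exp (- \<rho> * y\<^sup>2)" if t: "t \<in> {0..1}" for t y :: real
  proof -
    have "2 * \<rho> * (V + t) \<le> 2 * \<rho> * (V + 1)"
      using t \<rho> by (intro mult_left_mono) auto
    then have "2 * \<rho> \<le> 1 / (V + t)"
      using \<rho>(2) V t by (subst pos_le_divide_eq) auto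
    then have "2 * \<rho> * y\<^sup>2 \<le> 1 / (V + t) * y\<^sup>2"
      by (intro mult_right_mono) auto
    then have 1: "exp (- (y\<^sup>2 / (V + t))) \<le> exp (- \<rho> * y\<^sup>2) * exp (- \<rho> * y\<^sup>2)"
      by (simp add: exp_add[symmetric])
    \<comment> \<open>A power of \<open>y\<^sup>2\<close> is needed for the comparison with the
      exponential of \<open>\<rho> * y\<^sup>2\<close>; the summand 1 covers small
      \<open>y\<close>.\<close>
    have "\<bar>y\<bar> ^ m \<le> 1 + (y\<^sup>2) ^ m"
    proof (cases "\<bar>y\<bar> \<le> 1")
      case True
      then have "\<bar>y\<bar> ^ m \<le> 1" by (intro power_le_one) auto
      then show ?thesis by (meson add_increasing2 zero_le_power zero_le_power2)
    next
      case False
      then have "\<bar>y\<bar> ^ m \<le> (\<bar>y\<bar>\<^sup>2) ^ m"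
        using mult_left_mono[of 1 "\<bar>y\<bar>" "\<bar>y\<bar>"] by (intro power_mono) (auto simp: power2_eq_square)
      then show ?thesis by simp
    qed
    also have "(y\<^sup>2) ^ m = (\<rho> * y\<^sup>2) ^ m / \<rho> ^ m"
      using \<rho> by (simp add: power_mult_distrib)
    also have "\<dots> \<le> fact m * exp (\<rho> * y\<^sup>2) / \<rho> ^ m"
      using \<rho> by (intro divide_right_mono power_le_fact_exp) auto
    also have "1 + fact m * exp (\<rho> * y\<^sup>2) / \<rho> ^ m \<le> (1 + fact m / \<rho> ^ m) * exp (\<rho> * y\<^sup>2)"
      using \<rho> by (simp add: distrib_right)
    finally have 2: "\<bar>y\<bar> ^ m \<le> (1 + fact m / \<rho> ^ m) * exp (\<rho> * y\<^sup>2)" by simp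
    have "\<bar>y ^ m * exp (- (y\<^sup>2 / (V + t)))\<bar> \<le> ((1 + fact m / \<rho> ^ m) * exp (\<rho> * y\<^sup>2)) * (exp (- \<rho> * y\<^sup>2) * exp (- \<rho> * y\<^sup>2))"
      unfolding abs_mult power_abs abs_exp_cancel using 1 2 \<rho> by (intro mult_mono) auto
    also have "\<dots> = (1 + fact m / \<rho> ^ m) * exp (- \<rho> * y\<^sup>2)"
      by (simp add: exp_minus)
    finally show ?thesis .
  qed
  then show ?thesis unfolding gauss_bounded_def by blast
qed

lemma gauss_bounded_root_gamma_density:
  assumes "0 < V" "0 < \<rho>" "2 * \<rho> * (V + 1) \<le> 1"
  shows "gauss_bounded \<rho> (\<lambda>t. root_gamma_density k (V + t))"
    and "gauss_bounded \<rho> (\<lambda>t. root_gamma_density' k (V + t))"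
    and "gauss_bounded \<rho> (\<lambda>t. root_gamma_density'' k (V + t))"
proof -
  note M = gauss_bounded_monomial[OF assms]
  define c where "c k t = 1 / (Gamma (real k + 1 / 2) * (V + t) powr (real k + 1 / 2))" for k t
  have c: "continuous_on {0..1} (c k)" for k
  proof -
    have "Gamma (real k + 1 / 2) \<noteq> 0"
      using Gamma_real_pos[of "real k + 1 / 2"] by linarith
    then show ?thesis
      using assms(1) unfolding c_def by (intro continuous_intros) auto
  qed
  have e: "gauss_bounded \<rho> (\<lambda>t. root_gamma_density k (V + t))" for k
    using gauss_bounded_mult[OF c M, of k "2 * k"] by (simp add: c_def root_gamma_density_def[abs_def])
  then show "gauss_bounded \<rho> (\<lambda>t. root_gamma_density k (V + t))" .
  have "continuous_on {0..1} (\<lambda>t. - 2 / (V + t) * c k t)"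
    using assms(1) by (intro continuous_intros c) auto
  moreover have "continuous_on {0..1} (\<lambda>t. 2 * real k * c k t)"
    by (intro continuous_intros c)
  ultimately have "gauss_bounded \<rho> (\<lambda>t y. 2 * real k * c k t * (y ^ (2 * k - 1) * exp (- (y\<^sup>2 / (V + t)))) +
      - 2 / (V + t) * c k t * (y ^ (2 * k + 1) * exp (- (y\<^sup>2 / (V + t)))))"
    by (intro gauss_bounded_add gauss_bounded_mult M)
  also have "(\<lambda>t y. 2 * real k * c k t * (y ^ (2 * k - 1) * exp (- (y\<^sup>2 / (V + t)))) +
      - 2 / (V + t) * c k t * (y ^ (2 * k + 1) * exp (- (y\<^sup>2 / (V + t))))) = (\<lambda>t. root_gamma_density' k (V + t))"
    by (intro ext) (simp add: c_def root_gamma_density'_def algebra_simps diff_divide_distrib)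
  finally show "gauss_bounded \<rho> (\<lambda>t. root_gamma_density' k (V + t))" .
  \<comment> \<open>Since the second derivative is a combination of densities, the bound on the
    densities is reused, with coefficients that are continuous in time.\<close>
  have "gauss_bounded \<rho> (\<lambda>t y. 4 * real k / (V + t) * root_gamma_density (k - 1) (V + t) y
     + - (8 * real k + 2) / (V + t) * root_gamma_density k (V + t) y
     + (4 * real k + 2) / (V + t) * root_gamma_density (Suc k) (V + t) y)"
    using assms(1) by (intro gauss_bounded_add gauss_bounded_mult e continuous_intros) auto
  then show "gauss_bounded \<rho> (\<lambda>t. root_gamma_density'' k (V + t))"
    by (simp only: root_gamma_density''_def[abs_def] minus_divide_left[symmetric] mult_minus_left diff_conv_add_uminus)
qed

lemma gauss_bounded_root_gamma_flow:
  assumes "0 < V" "0 < \<rho>" "2 * \<rho> * (V + 1) \<le> 1"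
  shows "gauss_bounded \<rho> (root_gamma_flow z V)" "gauss_bounded \<rho> (root_gamma_flow' z V)" "gauss_bounded \<rho> (root_gamma_flow'' z V)"
proof -
  have "continuous_on {0..1} (binomial_coeff z V k)" for k
    unfolding binomial_coeff_def[abs_def] using assms(1) by (intro continuous_intros) auto
  then show "gauss_bounded \<rho> (root_gamma_flow z V)" "gauss_bounded \<rho> (root_gamma_flow' z V)" "gauss_bounded \<rho> (root_gamma_flow'' z V)"
    unfolding root_gamma_flow_def[abs_def] root_gamma_flow'_def[abs_def] root_gamma_flow''_def[abs_def]
    by (intro gauss_bounded_sum gauss_bounded_mult gauss_bounded_root_gamma_density[OF assms]; simp)+
qed

subsection \<open>Superharmonic functions symmetrised over the orthants\<close>

lemma C1_on_spaceI:
  assumes "\<And>i x. ((\<lambda>t. g (x + t *\<^sub>R axis i 1)) has_real_derivative g' i x) (at 0)"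
    and "\<And>i. continuous_on UNIV (g' i)"
  shows "C1_on_space g" and "partial i g = g' i"
proof -
  show p: "partial i g = g' i" for i
    using assms(1) by (auto simp: partial_def fun_eq_iff intro: DERIV_imp_deriv)
  show "C1_on_space g"
    using assms by (auto simp: C1_on_space_def p real_differentiable_def)
qed

lemma C1_on_spaceD:
  assumes "C1_on_space g"
  shows "((\<lambda>t. g (x + t *\<^sub>R axis i 1)) has_real_derivative partial i g x) (at 0)"
    and "continuous_on UNIV (partial i g)"
  using assms by (auto simp: C1_on_space_def partial_def DERIV_deriv_iff_real_differentiable)

text \<open>\<open>C1_on_space\<close> asks for continuity of the partial derivatives only, so that
  of the function has to be derived. On a cube the partial derivatives are bounded, and the way from
  \<open>x\<close> to \<open>y\<close> is split into moves along single axes, each controlled by a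
  mean value estimate.\<close>

lemma C1_on_space_imp_continuous:
  fixes g :: "real ^ 'd::finite \<Rightarrow> real"
  assumes g: "C1_on_space g"
  shows "continuous_on UNIV g"
proof -
  have "(g \<longlongrightarrow> g x) (at x)" for x
  proof -
    let ?Q = "cbox (x - (\<chi> i. 1)) (x + (\<chi> i. 1))"
    have Q: "y \<in> ?Q \<longleftrightarrow> (\<forall>i. \<bar>y $ i - x $ i\<bar> \<le> 1)" for y
      by (auto simp: mem_box_cart abs_le_iff algebra_simps)
    have "\<forall>i. \<exists>B. \<forall>y\<in>?Q. \<bar>partial i g y\<bar> \<le> B"
    proof
      fix i
      have "compact (partial i g ` ?Q)"
        by (intro compact_continuous_image compact_cbox continuous_on_subset[OF C1_on_spaceD(2)[OF g]]) simp
      then show "\<exists>B. \<forall>y\<in>?Q. \<bar>partial i g y\<bar> \<le> B"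
        by (auto dest: compact_imp_bounded simp: bounded_iff)
    qed
    from choice[OF this] obtain B where B: "\<And>i y. y \<in> ?Q \<Longrightarrow> \<bar>partial i g y\<bar> \<le> B i"
      by blast
    \<comment> \<open>\<open>S\<close> holds the coordinates already moved from \<open>x\<close> to
      \<open>y\<close>; all intermediate points stay in the cube.\<close>
    have path: "\<bar>g (\<chi> i. if i \<in> S then y $ i else x $ i) - g x\<bar> \<le> (\<Sum>i\<in>S. B i * \<bar>y $ i - x $ i\<bar>)"
      if y: "y \<in> ?Q" and "finite S" for y S
      using \<open>finite S\<close>
    proof (induction S rule: finite_induct)
      case empty
      then show ?case by (simp add: vec_lambda_eta)
    next
      case (insert k S)
      define w where "w = (\<chi> i. if i \<in> S then y $ i else x $ i)"
      define d where "d = y $ k - x $ k"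
      have seg: "w + t *\<^sub>R axis k 1 \<in> ?Q" if "t \<in> closed_segment 0 d" for t
      proof -
        have "\<bar>t\<bar> \<le> \<bar>d\<bar>"
          using segment_bound1[OF that] by simp
        moreover have "\<bar>d\<bar> \<le> 1" using y by (simp add: Q d_def)
        ultimately show ?thesis
          using y insert.hyps(2) by (auto simp: Q w_def axis_def)
      qed
      have "norm (g (w + d *\<^sub>R axis k 1) - g (w + 0 *\<^sub>R axis k 1)) \<le> B k * norm (d - 0)"
      proof (rule field_differentiable_bound[of "closed_segment 0 d" _ "\<lambda>t. partial k g (w + t *\<^sub>R axis k 1)"])
        show "((\<lambda>t. g (w + t *\<^sub>R axis k 1)) has_field_derivative partial k g (w + t *\<^sub>R axis k 1)) (at t within closed_segment 0 d)" for t
          by (rule has_field_derivative_at_within, rule has_real_derivative_along_line) (rule C1_on_spaceD(1)[OF g])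
      qed (use B seg in auto)
      moreover have "w + d *\<^sub>R axis k 1 = (\<chi> i. if i \<in> insert k S then y $ i else x $ i)"
        using insert.hyps(2) by (auto simp: vec_eq_iff w_def d_def axis_def)
      ultimately show ?case
        using insert unfolding w_def d_def by simp
    qed
    have le: "\<bar>g y - g x\<bar> \<le> (\<Sum>i\<in>UNIV. B i * \<bar>y $ i - x $ i\<bar>)" if "y \<in> ?Q" for y
      using path[OF that, of UNIV] by (simp add: vec_lambda_eta)
    have "\<forall>\<^sub>F y in at x. y \<in> box (x - (\<chi> i. 1)) (x + (\<chi> i. 1))"
      by (intro eventually_at_in_open' open_box) (simp add: mem_box_cart)
    then have "\<forall>\<^sub>F y in at x. norm (g y - g x) \<le> (\<Sum>i\<in>UNIV. B i * \<bar>y $ i - x $ i\<bar>)"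
      by (rule eventually_mono) (unfold real_norm_def, rule le, rule subsetD[OF box_subset_cbox])
    moreover have "((\<lambda>y. \<Sum>i\<in>UNIV. B i * \<bar>y $ i - x $ i\<bar>) \<longlongrightarrow> (\<Sum>i\<in>UNIV. B i * \<bar>x $ i - x $ i\<bar>)) (at x)"
      by (intro tendsto_intros)
    then have "((\<lambda>y. \<Sum>i\<in>UNIV. B i * \<bar>y $ i - x $ i\<bar>) \<longlongrightarrow> 0) (at x)"
      by simp
    ultimately have "((\<lambda>y. g y - g x) \<longlongrightarrow> 0) (at x)"
      by (rule Lim_null_comparison)
    then show ?thesis by (simp add: LIM_zero_iff)
  qed
  then show ?thesis
    by (simp add: continuous_on_def)
qed

section \<open>Reflections and the symmetrised function\<close>

lemma times_add_axis: "a * (x + t *\<^sub>R axis i 1) = a * x + (a $ i * t) *\<^sub>R axis i (1::real)"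
  by (simp add: vec_eq_iff times_vec_def axis_def algebra_simps)

lemma has_derivative_flip:
  assumes "C1_on_space g"
  shows "((\<lambda>t. g (a * (x + t *\<^sub>R axis i 1))) has_real_derivative a $ i * partial i g (a * x)) (at 0)"
proof -
  have "((\<lambda>u. g (a * x + u *\<^sub>R axis i 1)) has_real_derivative partial i g (a * x)) (at (a $ i * 0))"
    using C1_on_spaceD(1)[OF assms] by simp
  moreover have "((\<lambda>t. a $ i * t) has_real_derivative a $ i) (at 0)"
    by (auto intro!: derivative_eq_intros)
  ultimately have "((\<lambda>t. g (a * x + (a $ i * t) *\<^sub>R axis i 1)) has_real_derivative partial i g (a * x) * a $ i) (at 0)"
    by (rule DERIV_chain2)
  then show ?thesis
    unfolding times_add_axis by (subst mult.commute)
qed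

lemma continuous_on_flip:
  fixes g :: "real ^ 'd::finite \<Rightarrow> real"
  assumes "continuous_on UNIV g"
  shows "continuous_on UNIV (\<lambda>x. g (a * x))"
  using assms by (rule continuous_on_compose2) (auto simp: times_vec_def intro!: continuous_intros)

text \<open>The coefficients \<open>c\<close> are carried along because a partial derivative of a
  reflected summand acquires the sign \<open>a $ i\<close>; with them the lemma applies again to its
  own result.\<close>

lemma C1_on_space_flip_sum:
  fixes g :: "real ^ 'd::finite \<Rightarrow> real"
  assumes "C1_on_space g"
  shows "C1_on_space (\<lambda>x. \<Sum>a\<in>A. c a * g (a * x))"
    and "partial i (\<lambda>x. \<Sum>a\<in>A. c a * g (a * x)) = (\<lambda>x. \<Sum>a\<in>A. c a * a $ i * partial i g (a * x))"
proof -
  have d: "((\<lambda>t. \<Sum>a\<in>A. c a * g (a * (x + t *\<^sub>R axis i 1))) has_real_derivative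
      (\<Sum>a\<in>A. c a * (a $ i * partial i g (a * x)))) (at 0)" for x i
    by (intro DERIV_sum DERIV_cmult has_derivative_flip assms)
  have c: "continuous_on UNIV (\<lambda>x. \<Sum>a\<in>A. c a * (a $ i * partial i g (a * x)))" for i
    by (intro continuous_intros continuous_on_flip C1_on_spaceD(2) assms)
  show "C1_on_space (\<lambda>x. \<Sum>a\<in>A. c a * g (a * x))"
    "partial i (\<lambda>x. \<Sum>a\<in>A. c a * g (a * x)) = (\<lambda>x. \<Sum>a\<in>A. c a * a $ i * partial i g (a * x))"
    using C1_on_spaceI[OF d c] by (simp_all add: mult.assoc)
qed

lemma sign_sum_eq: "sign_sum h = (\<lambda>x. \<Sum>a\<in>sign_vectors. 1 * h (a * x))"
  by (simp add: sign_sum_def times_vec_def fun_eq_iff)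

text \<open>A repeated partial derivative acquires the sign \<open>a $ i\<close> twice, so the
  Laplacian of the sum is a sum of reflected Laplacians.\<close>

lemma superharmonic_sign_sum:
  fixes h :: "real ^ 'd::finite \<Rightarrow> real"
  assumes "superharmonic h"
  shows "superharmonic (sign_sum h)"
proof -
  have h: "C1_on_space h" "\<And>i. C1_on_space (partial i h)" "\<And>x. (\<Sum>i\<in>UNIV. partial i (partial i h) x) \<le> 0"
    using assms by (auto simp: superharmonic_def C2_on_space_def)
  have "partial i (partial i (sign_sum h)) x = (\<Sum>a\<in>sign_vectors. partial i (partial i h) (a * x))" for i x
    unfolding sign_sum_eq C1_on_space_flip_sum(2)[OF h(1)] C1_on_space_flip_sum(2)[OF h(2)]
    by (intro sum.cong refl) (simp add: times_sign_vector(3)[unfolded power2_eq_square])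
  then have "(\<Sum>i\<in>UNIV. partial i (partial i (sign_sum h)) x) \<le> 0" for x
    using h(3) by (simp, subst sum.swap) (simp add: sum_nonpos)
  then show ?thesis
    unfolding superharmonic_def C2_on_space_def sign_sum_eq C1_on_space_flip_sum(2)[OF h(1)]
    using C1_on_space_flip_sum(1)[OF h(1), where c="\<lambda>_. 1"] C1_on_space_flip_sum(1)[OF h(2)] by auto
qed

lemma sign_vectors_times: "a \<in> sign_vectors \<Longrightarrow> b \<in> sign_vectors \<Longrightarrow> a * b \<in> sign_vectors"
  unfolding sign_vectors_def times_vec_def by (simp, metis minus_mult_minus mult.left_neutral mult_minus1)

lemma sign_sum_even:
  fixes h :: "real ^ 'd::finite \<Rightarrow> real"
  assumes a: "a \<in> sign_vectors"
  shows "sign_sum h (a * x) = sign_sum h x"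
proof -
  have [simp]: "(b * a) * a = b" "b * (a * x) = (b * a) * x" for b
    using times_sign_vector(1)[OF a, of b] by (simp_all add: times_vec_def vec_eq_iff mult_ac)
  show ?thesis
    unfolding sign_sum_eq
    by (rule sum.reindex_bij_witness[where i="\<lambda>b. b * a" and j="\<lambda>b. b * a"]) (simp_all add: sign_vectors_times a)
qed

text \<open>The factor \<open>c\<close> permits two uses: \<open>c = 1\<close> for the function, and
  \<open>c = a $ i\<close> for its first partial derivative, where the two signs cancel.\<close>

lemma partial_even:
  assumes g: "C1_on_space g" and a: "a \<in> sign_vectors" and even: "\<And>x. g (a * x) = c * g x"
  shows "partial i g (a * x) = a $ i * c * partial i g x"
proof -
  have "((\<lambda>t. c * g (x + t *\<^sub>R axis i 1)) has_real_derivative a $ i * partial i g (a * x)) (at 0)"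
    using has_derivative_flip[OF g, of a x i] by (simp add: even)
  moreover have "((\<lambda>t. c * g (x + t *\<^sub>R axis i 1)) has_real_derivative c * partial i g x) (at 0)"
    by (intro DERIV_cmult C1_on_spaceD g)
  ultimately have "a $ i * partial i g (a * x) = c * partial i g x"
    by (rule DERIV_unique)
  then have "a $ i * (a $ i * partial i g (a * x)) = a $ i * (c * partial i g x)"
    by simp
  then show ?thesis
    using times_sign_vector(4)[OF a] by (simp add: mult.assoc)
qed

lemma gauss_weight_0_even: "a \<in> sign_vectors \<Longrightarrow> gauss_weight 0 \<rho> (a * x) = gauss_weight 0 \<rho> x"
  by (simp add: gauss_weight_0 times_vec_def power_mult_distrib times_sign_vector(3))

lemma gauss_weight_0_measurable [measurable]: "gauss_weight 0 \<rho> \<in> borel_measurable borel"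
  unfolding gauss_weight_0[abs_def] by measurable

text \<open>Evenness is asked of the modulus only, since a first partial derivative may change sign
  under a reflection.\<close>

lemma gauss_integrable_even:
  fixes g :: "real ^ 'd::finite \<Rightarrow> real"
  assumes cont: "continuous_on UNIV g" and even: "\<And>a x. a \<in> sign_vectors \<Longrightarrow> \<bar>g (a * x)\<bar> = \<bar>g x\<bar>"
    and int: "set_integrable lborel nonneg_orthant (\<lambda>x. \<bar>g x\<bar> * gauss_weight 0 \<rho> x)"
  shows "gauss_integrable \<rho> g"
  unfolding gauss_integrable_def
proof
  show [measurable]: "g \<in> borel_measurable borel"
    using cont by (rule borel_measurable_continuous_onI)
  show "integrable lborel (\<lambda>x. \<bar>g x\<bar> * gauss_weight 0 \<rho> x)"
  proof (rule integral_even_orthant)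
    show "set_integrable lborel pos_orthant (\<lambda>x. \<bar>g x\<bar> * gauss_weight 0 \<rho> x)"
      using int by (rule set_integrable_subset) (auto simp: pos_orthant_def nonneg_orthant_def less_imp_le)
  qed (simp_all add: even gauss_weight_0_even)
qed

section \<open>Expansion, uniform constants and measurability of the flow\<close>

lemma prod_sum_vec:
  fixes F :: "'d::finite \<Rightarrow> nat \<Rightarrow> real"
  shows "(\<Prod>i\<in>UNIV. \<Sum>k\<le>z $ i. F i k) = (\<Sum>x\<in>{x. \<forall>i. x $ i \<le> z $ i}. \<Prod>i\<in>UNIV. F i (x $ i))"
proof -
  have "(\<Prod>i\<in>UNIV. \<Sum>k\<le>z $ i. F i k) = (\<Sum>g\<in>(\<Pi>\<^sub>E i\<in>UNIV. {..z $ i}). \<Prod>i\<in>UNIV. F i (g i))"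
    by (rule prod_sum_PiE) auto
  also have "\<dots> = (\<Sum>x\<in>{x. \<forall>i. x $ i \<le> z $ i}. \<Prod>i\<in>UNIV. F i (x $ i))"
    by (rule sum.reindex_bij_witness[where i=vec_nth and j=vec_lambda]) (auto simp: vec_lambda_inverse vec_nth_inverse PiE_iff)
  finally show ?thesis .
qed

lemma finite_vec_le: "finite {x :: nat ^ 'd::finite. \<forall>i. x $ i \<le> z $ i}"
proof (rule finite_subset)
  show "{x. \<forall>i. x $ i \<le> z $ i} \<subseteq> vec_lambda ` (\<Pi>\<^sub>E i\<in>UNIV. {..z $ i})"
  proof
    fix x :: "nat ^ 'd" assume "x \<in> {x. \<forall>i. x $ i \<le> z $ i}"
    then have "vec_nth x \<in> (\<Pi>\<^sub>E i\<in>UNIV. {..z $ i})" by auto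
    then show "x \<in> vec_lambda ` (\<Pi>\<^sub>E i\<in>UNIV. {..z $ i})" by (metis image_eqI vec_nth_inverse)
  qed
qed (simp add: finite_PiE)

lemma gauss_bounded_uniform:
  fixes g :: "'d::finite \<Rightarrow> real \<Rightarrow> real \<Rightarrow> real"
  assumes "\<And>i. gauss_bounded \<rho> (g i)"
  shows "\<exists>C\<ge>0. \<forall>i. \<forall>t\<in>{0..1}. \<forall>y. \<bar>g i t y\<bar> \<le> C * exp (- \<rho> * y\<^sup>2)"
proof -
  obtain C where C: "\<And>i t y. t \<in> {0..1} \<Longrightarrow> \<bar>g i t y\<bar> \<le> C i * exp (- \<rho> * y\<^sup>2)"
    using assms unfolding gauss_bounded_def by metis
  have "C i \<le> (\<Sum>j\<in>UNIV. \<bar>C j\<bar>)" for i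
    using member_le_sum[of i UNIV "\<lambda>j. \<bar>C j\<bar>"] by simp
  then have "\<bar>g i t y\<bar> \<le> (\<Sum>j\<in>UNIV. \<bar>C j\<bar>) * exp (- \<rho> * y\<^sup>2)" if "t \<in> {0..1}" for i t y
    using C[OF that, of i y] by (meson exp_ge_zero mult_right_mono order_trans)
  then show ?thesis by (intro exI[of _ "\<Sum>j\<in>UNIV. \<bar>C j\<bar>"]) (auto intro: sum_nonneg)
qed

lemma root_gamma_density_measurable [measurable]:
  "case_prod (root_gamma_density k) \<in> borel_measurable (borel \<Otimes>\<^sub>M borel)"
  "case_prod (root_gamma_density' k) \<in> borel_measurable (borel \<Otimes>\<^sub>M borel)"
  "case_prod (root_gamma_density'' k) \<in> borel_measurable (borel \<Otimes>\<^sub>M borel)"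
proof -
  show 1 [measurable]: "case_prod (root_gamma_density k) \<in> borel_measurable (borel \<Otimes>\<^sub>M borel)" for k
    unfolding root_gamma_density_def[abs_def] by measurable
  show "case_prod (root_gamma_density' k) \<in> borel_measurable (borel \<Otimes>\<^sub>M borel)"
    unfolding root_gamma_density'_def[abs_def] by measurable
  show "case_prod (root_gamma_density'' k) \<in> borel_measurable (borel \<Otimes>\<^sub>M borel)"
    unfolding root_gamma_density''_def[abs_def] by measurable
qed

lemma root_gamma_density_measurable' [measurable]: "root_gamma_density k v \<in> borel_measurable borel"
  using measurable_compose[OF measurable_Pair1' root_gamma_density_measurable(1), of v] by simp

lemma binomial_coeff_measurable [measurable]: "binomial_coeff z V k \<in> borel_measurable borel"
  unfolding binomial_coeff_def[abs_def] by measurable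

lemma root_gamma_flow_measurable [measurable]:
  "case_prod (root_gamma_flow z V) \<in> borel_measurable (borel \<Otimes>\<^sub>M borel)"
  "case_prod (root_gamma_flow' z V) \<in> borel_measurable (borel \<Otimes>\<^sub>M borel)"
  "case_prod (root_gamma_flow'' z V) \<in> borel_measurable (borel \<Otimes>\<^sub>M borel)"
  unfolding root_gamma_flow_def[abs_def] root_gamma_flow'_def[abs_def] root_gamma_flow''_def[abs_def]
  by measurable

lemma root_gamma_flow_0: "0 < V \<Longrightarrow> root_gamma_flow z V 0 y = root_gamma_density z V y"
proof -
  assume V: "0 < V"
  \<comment> \<open>At time zero the power \<open>t ^ (z - k)\<close> vanishes except for
    \<open>k = z\<close>, where it is \<open>0 ^ 0 = 1\<close>.\<close>
  have "binomial_coeff z V k 0 = (if k = z then 1 else 0)" if "k \<le> z" for k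
    using that V by (simp add: binomial_coeff_def)
  then have "root_gamma_flow z V 0 y = (\<Sum>k\<le>z. if k = z then root_gamma_density k V y else 0)"
    unfolding root_gamma_flow_def by (intro sum.cong) auto
  then show ?thesis by simp
qed

lemma root_gamma_flow_nonneg: "0 < V \<Longrightarrow> 0 \<le> t \<Longrightarrow> 0 \<le> root_gamma_flow z V t y"
  unfolding root_gamma_flow_def binomial_coeff_def
  by (intro sum_nonneg mult_nonneg_nonneg divide_nonneg_nonneg root_gamma_density_nonneg) auto

text \<open>Doubling the scale leaves half of the exponent to absorb \<open>y ^ (2 * k)\<close>. The
  cost is one factor \<open>2 ^ k\<close> from the scale and one from comparing
  \<open>fact k\<close> with the Gamma function; \<open>sqrt 2\<close> comes from renormalising the
  Gaussian, which is the case \<open>k = 0\<close>. The resulting bound on the mixtures is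
  exponential in the counts.\<close>

lemma root_gamma_density_le:
  assumes v: "0 < v"
  shows "root_gamma_density k v y \<le> 4 ^ k * sqrt 2 * root_gamma_density 0 (2 * v) y"
proof -
  \<comment> \<open>From \<open>k\<close> to \<open>Suc k\<close> the left side gains the factor
    \<open>k + 1\<close> and the right side the larger \<open>2 * k + 1\<close>; at
    \<open>k = 0\<close> both are \<open>sqrt pi\<close>.\<close>
  have G: "fact k * sqrt pi \<le> 2 ^ k * Gamma (real k + 1 / 2)"
  proof (induction k)
    case 0
    then show ?case by (simp add: Gamma_one_half_real)
  next
    case (Suc k)
    have "fact (Suc k) * sqrt pi = real (Suc k) * (fact k * sqrt pi)" by simp
    also have "\<dots> \<le> real (Suc k) * (2 ^ k * Gamma (real k + 1 / 2))"
      using Suc by (intro mult_left_mono) auto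
    also have "\<dots> \<le> (2 * (real k + 1 / 2)) * (2 ^ k * Gamma (real k + 1 / 2))"
      using Gamma_real_pos[of "real k + 1 / 2"] by (intro mult_right_mono) auto
    also have "\<dots> = 2 ^ Suc k * Gamma (real (Suc k) + 1 / 2)"
      unfolding Gamma_Suc_half by simp
    finally show ?case .
  qed
  define g where "g = Gamma (real k + 1 / 2)"
  have g: "0 < g" unfolding g_def by (rule Gamma_real_pos) simp
  have "y ^ (2 * k) = (2 * v) ^ k * (y\<^sup>2 / (2 * v)) ^ k"
    using v by (simp add: power_divide power_mult)
  also have "\<dots> \<le> (2 * v) ^ k * (fact k * exp (y\<^sup>2 / (2 * v)))"
    using v by (intro mult_left_mono power_le_fact_exp) auto
  finally have "y ^ (2 * k) * exp (- (y\<^sup>2 / v)) \<le> (2 * v) ^ k * (fact k * exp (y\<^sup>2 / (2 * v))) * exp (- (y\<^sup>2 / v))"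
    by (intro mult_right_mono) auto
  also have "\<dots> = (2 * v) ^ k * fact k * exp (- (y\<^sup>2 / (2 * v)))"
    using v by (simp add: mult.assoc exp_add[symmetric])
  finally have "root_gamma_density k v y \<le> (2 * v) ^ k * fact k * exp (- (y\<^sup>2 / (2 * v))) / (g * v powr (real k + 1 / 2))"
    unfolding root_gamma_density_def g_def[symmetric] using g by (intro divide_right_mono) auto
  also have "\<dots> = 2 ^ k * (fact k / g) * exp (- (y\<^sup>2 / (2 * v))) / sqrt v"
    using v by (simp add: powr_add powr_realpow powr_half_sqrt power_mult_distrib)
  also have "\<dots> \<le> 2 ^ k * (2 ^ k / sqrt pi) * exp (- (y\<^sup>2 / (2 * v))) / sqrt v"
    using G g v by (intro divide_right_mono mult_right_mono mult_left_mono) (auto simp: g_def field_simps)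
  also have "\<dots> = 4 ^ k * (sqrt 2 * root_gamma_density 0 (2 * v) y)"
    using v by (simp add: root_gamma_density_def Gamma_one_half_real powr_half_sqrt real_sqrt_mult
      power_mult_distrib[symmetric] mult.assoc[symmetric])
  finally show ?thesis by (simp add: mult.assoc)
qed

subsection \<open>Gamma mixtures of an even superharmonic function\<close>

text \<open>Integrability is required at every rate because the admissible rate shrinks as the
  scales grow.\<close>

locale even_superharmonic =
  fixes f :: "real ^ 'd::finite \<Rightarrow> real"
  assumes superharmonic: "superharmonic f"
    and even: "\<And>a x. a \<in> sign_vectors \<Longrightarrow> f (a * x) = f x"
    and nonneg: "\<And>x. 0 \<le> f x"
    and nonzero: "\<exists>x. f x \<noteq> 0"
    and integrable: "\<And>\<rho>. 0 < \<rho> \<Longrightarrow> gauss_integrable \<rho> f"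
      "\<And>\<rho> i. 0 < \<rho> \<Longrightarrow> gauss_integrable \<rho> (partial i f)"
      "\<And>\<rho> i. 0 < \<rho> \<Longrightarrow> gauss_integrable \<rho> (partial i (partial i f))"
begin

text \<open>This is the quantity written \<open>G v z\<close> in the overview.\<close>

definition mixture :: "real ^ 'd \<Rightarrow> nat ^ 'd \<Rightarrow> real"
  where "mixture v z = (\<integral>x. f x * (\<Prod>i\<in>UNIV. root_gamma_density (z $ i) (v $ i) (x $ i)) \<partial>lborel)"

lemma continuous: "continuous_on UNIV f"
  using superharmonic by (intro C1_on_space_imp_continuous) (auto simp: superharmonic_def C2_on_space_def)

lemma measurable_f [measurable]: "f \<in> borel_measurable borel"
  using continuous by (rule borel_measurable_continuous_onI)

text \<open>One rate for all coordinates turns the product of the coordinate bounds into a single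
  Gaussian weight.\<close>

lemma common_rate:
  fixes v :: "real ^ 'd"
  assumes "\<And>i. 0 < v $ i"
  obtains \<rho> where "0 < \<rho>" "\<And>i. 2 * \<rho> * (v $ i + 1) \<le> 1"
proof -
  have s: "v $ i \<le> (\<Sum>j\<in>UNIV. v $ j)" for i
    using assms by (intro member_le_sum) (auto intro: less_imp_le)
  have p: "0 \<le> (\<Sum>j\<in>UNIV. v $ j)"
    using assms by (intro sum_nonneg) (auto intro: less_imp_le)
  show ?thesis
  proof (rule that[of "1 / (2 * ((\<Sum>j\<in>UNIV. v $ j) + 1))"])
    show "2 * (1 / (2 * ((\<Sum>j\<in>UNIV. v $ j) + 1))) * (v $ i + 1) \<le> 1" for i
      using s[of i] p by (simp add: divide_simps)
  qed (use p in simp)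
qed

lemma integrable_mixture:
  assumes v: "\<And>i. 0 < v $ i"
  shows "integrable lborel (\<lambda>x. f x * (\<Prod>i\<in>UNIV. root_gamma_density (z $ i) (v $ i) (x $ i)))"
proof -
  obtain \<rho> where \<rho>: "0 < \<rho>" "\<And>i. 2 * \<rho> * (v $ i + 1) \<le> 1"
    by (rule common_rate[OF v]) blast
  obtain C where "0 \<le> C" and C: "\<forall>i. \<forall>t\<in>{0..1}. \<forall>y. \<bar>root_gamma_density (z $ i) (v $ i + t) y\<bar> \<le> C * exp (- \<rho> * y\<^sup>2)"
    using gauss_bounded_uniform[where g="\<lambda>i t. root_gamma_density (z $ i) (v $ i + t)",
        OF gauss_bounded_root_gamma_density(1)[OF v \<rho>(1) \<rho>(2)]] by blast
  show ?thesis
  proof (rule integrable_times_gauss_bounded(1))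
    show "integrable lborel (\<lambda>x. \<bar>f x\<bar> * gauss_weight 0 \<rho> x)"
      using integrable(1)[OF \<rho>(1)] by (simp add: gauss_integrable_def)
    show "\<bar>\<Prod>i\<in>UNIV. root_gamma_density (z $ i) (v $ i) (x $ i)\<bar> \<le> C ^ CARD('d) * gauss_weight 0 \<rho> x" for x
      by (rule abs_prod_le_gauss_weight[where g="\<lambda>i. root_gamma_density (z $ i) (v $ i)"])
        (use C[rule_format, of 0] in simp)
  qed measurable
qed

lemma mixture_binomial_le:
  assumes V: "\<And>i. 0 < V $ i"
  shows "(\<Sum>x\<in>{x. \<forall>i. x $ i \<le> z $ i}. (\<Prod>i\<in>UNIV. binomial_coeff (z $ i) (V $ i) (x $ i) 1) * mixture (\<chi> i. V $ i + 1) x)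
    \<le> mixture V z"
proof -
  obtain \<rho> where \<rho>: "0 < \<rho>" "\<And>i. 2 * \<rho> * (V $ i + 1) \<le> 1"
    by (rule common_rate[OF V]) blast
  note b = gauss_bounded_root_gamma_flow[OF V \<rho>(1) \<rho>(2)]
  obtain C0 where C0: "0 \<le> C0" "\<forall>i. \<forall>t\<in>{0..1}. \<forall>y. \<bar>root_gamma_flow (z $ i) (V $ i) t y\<bar> \<le> C0 * exp (- \<rho> * y\<^sup>2)"
    using gauss_bounded_uniform[where g="\<lambda>i. root_gamma_flow (z $ i) (V $ i)", OF b(1)] by blast
  obtain C1 where C1: "0 \<le> C1" "\<forall>i. \<forall>t\<in>{0..1}. \<forall>y. \<bar>root_gamma_flow' (z $ i) (V $ i) t y\<bar> \<le> C1 * exp (- \<rho> * y\<^sup>2)"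
    using gauss_bounded_uniform[where g="\<lambda>i. root_gamma_flow' (z $ i) (V $ i)", OF b(2)] by blast
  obtain C2 where C2: "0 \<le> C2" "\<forall>i. \<forall>t\<in>{0..1}. \<forall>y. \<bar>root_gamma_flow'' (z $ i) (V $ i) t y\<bar> \<le> C2 * exp (- \<rho> * y\<^sup>2)"
    using gauss_bounded_uniform[where g="\<lambda>i. root_gamma_flow'' (z $ i) (V $ i)", OF b(3)] by blast
  define C where "C = C0 + C1 + C2"
  have le: "c * exp (- \<rho> * y\<^sup>2) \<le> C * exp (- \<rho> * y\<^sup>2)" if "c = C0 \<or> c = C1 \<or> c = C2" for c y
    using that C0(1) C1(1) C2(1) by (intro mult_right_mono) (auto simp: C_def)
  \<comment> \<open>Unit time raises every scale from \<open>V $ i\<close> to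
    \<open>V $ i + 1\<close>, while at time zero the flow is the density itself.\<close>
  have "(\<integral>x. f x * (\<Prod>i\<in>UNIV. root_gamma_flow (z $ i) (V $ i) 1 (x $ i)) \<partial>lborel) \<le>
      (\<integral>x. f x * (\<Prod>i\<in>UNIV. root_gamma_flow (z $ i) (V $ i) 0 (x $ i)) \<partial>lborel)"
  proof (rule superharmonic_heat_flow_mono[OF superharmonic, where C=C and \<rho>=\<rho>])
    fix i :: 'd and t y :: real assume t: "t \<in> {0..1}"
    then have Vt: "0 < V $ i + t" using V[of i] by simp
    show "(root_gamma_flow (z $ i) (V $ i) t has_real_derivative root_gamma_flow' (z $ i) (V $ i) t y) (at y)"
      unfolding root_gamma_flow_def[abs_def] root_gamma_flow'_def
      by (intro DERIV_sum DERIV_cmult root_gamma_density_has_derivative Vt)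
    show "(root_gamma_flow' (z $ i) (V $ i) t has_real_derivative root_gamma_flow'' (z $ i) (V $ i) t y) (at y)"
      unfolding root_gamma_flow'_def[abs_def] root_gamma_flow''_def
      by (intro DERIV_sum DERIV_cmult root_gamma_density'_has_derivative Vt)
    show "((\<lambda>t. root_gamma_flow (z $ i) (V $ i) t y) has_real_derivative root_gamma_flow'' (z $ i) (V $ i) t y / 4) (at t)"
      using root_gamma_flow_heat_equation[OF V] t by simp
    show "\<bar>root_gamma_flow (z $ i) (V $ i) t y\<bar> \<le> C * exp (- \<rho> * y\<^sup>2)"
      by (rule order_trans[OF C0(2)[rule_format, OF t] le]) simp
    show "\<bar>root_gamma_flow' (z $ i) (V $ i) t y\<bar> \<le> C * exp (- \<rho> * y\<^sup>2)"
      by (rule order_trans[OF C1(2)[rule_format, OF t] le]) simp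
    show "\<bar>root_gamma_flow'' (z $ i) (V $ i) t y\<bar> \<le> C * exp (- \<rho> * y\<^sup>2)"
      by (rule order_trans[OF C2(2)[rule_format, OF t] le]) simp
    show "0 \<le> root_gamma_flow (z $ i) (V $ i) t y"
      using root_gamma_flow_nonneg[OF V] t by simp
  qed (use integrable[OF \<rho>(1)] in auto)
  also have "\<dots> = mixture V z"
    by (simp add: mixture_def root_gamma_flow_0[OF V])
  \<comment> \<open>The chain now continues on its left-hand side: by distributivity, the product of
    coordinate mixtures is a mixture over vectors with product weights.\<close>
  also have "(\<integral>x. f x * (\<Prod>i\<in>UNIV. root_gamma_flow (z $ i) (V $ i) 1 (x $ i)) \<partial>lborel) =
    (\<integral>x. (\<Sum>k\<in>{k. \<forall>i. k $ i \<le> z $ i}. (\<Prod>i\<in>UNIV. binomial_coeff (z $ i) (V $ i) (k $ i) 1) *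
        (f x * (\<Prod>i\<in>UNIV. root_gamma_density (k $ i) ((\<chi> i. V $ i + 1) $ i) (x $ i)))) \<partial>lborel)"
    unfolding root_gamma_flow_def prod_sum_vec[where F="\<lambda>i k. binomial_coeff (z $ i) (V $ i) k 1 * root_gamma_density k (V $ i + 1) (x $ i)" for x :: "real ^ 'd"]
    by (simp add: sum_distrib_left prod.distrib mult_ac)
  also have "\<dots> = (\<Sum>k\<in>{k. \<forall>i. k $ i \<le> z $ i}. (\<Prod>i\<in>UNIV. binomial_coeff (z $ i) (V $ i) (k $ i) 1) * mixture (\<chi> i. V $ i + 1) k)"
  proof -
    have "integrable lborel (\<lambda>x. f x * (\<Prod>i\<in>UNIV. root_gamma_density (k $ i) ((\<chi> i. V $ i + 1) $ i) (x $ i)))" for k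
      by (rule integrable_mixture) (use V in \<open>simp add: add_pos_pos\<close>)
    then show ?thesis
      by (subst Bochner_Integration.integral_sum) (auto intro!: integrable_mult_right simp: mixture_def simp del: vec_lambda_beta)
  qed
  finally show ?thesis .
qed

text \<open>The kernel is positive off the coordinate hyperplanes, so a vanishing integral would
  make \<open>f\<close> zero almost everywhere. By continuity the set where \<open>f\<close> is
  nonzero is open, and a nonempty open set is not negligible.\<close>

lemma mixture_pos:
  assumes v: "\<And>i. 0 < v $ i"
  shows "0 < mixture v z"
proof -
  let ?w = "\<lambda>x. \<Prod>i\<in>UNIV. root_gamma_density (z $ i) (v $ i) (x $ i)"
  have w: "0 < ?w x" if "\<forall>i. x $ i \<noteq> 0" for x
  proof (rule prod_pos)
    fix i :: 'd
    have "0 < x $ i ^ (2 * z $ i)" using that by (simp add: power_mult)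
    moreover have "0 < v $ i powr (real (z $ i) + 1 / 2)" using v[of i] by simp
    moreover have "0 < Gamma (real (z $ i) + 1 / 2)" by (rule Gamma_real_pos) simp
    ultimately show "0 < root_gamma_density (z $ i) (v $ i) (x $ i)"
      unfolding root_gamma_density_def by (intro divide_pos_pos mult_pos_pos) auto
  qed
  have w0: "0 \<le> ?w x" for x
    using v by (intro prod_nonneg) (auto intro: root_gamma_density_nonneg)
  have nn: "0 \<le> mixture v z"
    unfolding mixture_def using nonneg w0 by (intro integral_nonneg_AE AE_I2) simp
  have "mixture v z \<noteq> 0"
  proof
    assume "mixture v z = 0"
    then have "AE x in lborel. f x * ?w x = 0"
      unfolding mixture_def using nonneg w0 integrable_mixture[OF v]
      by (subst (asm) integral_nonneg_eq_0_iff_AE) auto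
    then have "AE x in lborel. f x = 0"
      using AE_lborel_nth_neq[of 0] 
    proof eventually_elim
      case (elim x)
      then show ?case using w[of x] by (metis less_irrefl mult_eq_0_iff)
    qed
    then have "{x \<in> space lborel. f x \<noteq> 0} \<in> null_sets lborel"
      using AE_iff_null[of lborel "\<lambda>x. f x = 0"] by simp
    then have "negligible {x. f x \<noteq> 0}"
      by (auto simp: negligible_iff_null_sets intro: null_sets_completionI)
    moreover have "open {x. f x \<noteq> 0}"
      by (intro open_Collect_neq continuous continuous_intros)
    ultimately show False
      using open_not_negligible nonzero by blast
  qed
  with nn show ?thesis by simp
qed

text \<open>Above, comparing densities costs a factor exponential in the counts. Below, only the
  term \<open>x = 0\<close> of \<open>mixture_binomial_le\<close> is kept, and its weight decays
  exponentially in the counts. So the logarithm grows at most linearly; the cruder powers of two are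
  used because they factorise over coordinates.\<close>

lemma abs_ln_mixture_le:
  assumes v: "\<And>i. 0 < v $ i"
  shows "\<exists>C\<ge>0. \<forall>z. \<bar>ln (mixture v z)\<bar> \<le> C * (\<Prod>i\<in>UNIV. 2 ^ (z $ i))"
proof -
  define n where "n z = (\<Sum>i\<in>UNIV. real (z $ i))" for z :: "nat ^ 'd"
  define L where "L = (\<Sum>i\<in>UNIV. ln (v $ i + 1))"
  have lnv: "0 < ln (v $ i + 1)" for i using v[of i] by simp
  have n0: "0 \<le> n z" for z by (simp add: n_def sum_nonneg)
  have L0: "0 \<le> L" unfolding L_def using lnv by (intro sum_nonneg) (auto intro: less_imp_le)
  define A where "A = sqrt 2 ^ CARD('d) * mixture (\<chi> i. 2 * v $ i) 0"
  define B where "B = mixture (\<chi> i. v $ i + 1) 0"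
  have A: "0 < A" unfolding A_def using v by (intro mult_pos_pos mixture_pos zero_less_power) auto
  have v1: "0 < (\<chi> i. v $ i + 1) $ i" for i using v[of i] by simp
  have B: "0 < B" unfolding B_def using v1 by (rule mixture_pos)
  have upper: "ln (mixture v z) \<le> ln A + ln 4 * n z" for z
  proof -
    have "mixture v z \<le> (\<integral>x. (\<Prod>i\<in>UNIV. 4 ^ (z $ i)) * sqrt 2 ^ CARD('d) * (f x * (\<Prod>i\<in>UNIV. root_gamma_density (0 $ i) ((\<chi> i. 2 * v $ i) $ i) (x $ i))) \<partial>lborel)"
      unfolding mixture_def
    proof (rule integral_mono)
      show "integrable lborel (\<lambda>x. f x * (\<Prod>i\<in>UNIV. root_gamma_density (z $ i) (v $ i) (x $ i)))"
        using v by (rule integrable_mixture)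
      show "integrable lborel (\<lambda>x. (\<Prod>i\<in>UNIV. 4 ^ (z $ i)) * sqrt 2 ^ CARD('d) * (f x * (\<Prod>i\<in>UNIV. root_gamma_density (0 $ i) ((\<chi> i. 2 * v $ i) $ i) (x $ i))))"
        using v by (intro integrable_mult_right integrable_mixture) auto
      fix x :: "real ^ 'd"
      have "(\<Prod>i\<in>UNIV. root_gamma_density (z $ i) (v $ i) (x $ i)) \<le> (\<Prod>i\<in>UNIV. 4 ^ (z $ i) * sqrt 2 * root_gamma_density 0 (2 * v $ i) (x $ i))"
        using root_gamma_density_le[OF v] root_gamma_density_nonneg[OF v] by (intro prod_mono) auto
      also have "\<dots> = (\<Prod>i\<in>UNIV. 4 ^ (z $ i)) * sqrt 2 ^ CARD('d) * (\<Prod>i\<in>UNIV. root_gamma_density 0 (2 * v $ i) (x $ i))"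
        by (simp add: prod.distrib)
      finally have "f x * (\<Prod>i\<in>UNIV. root_gamma_density (z $ i) (v $ i) (x $ i)) \<le>
          f x * ((\<Prod>i\<in>UNIV. 4 ^ (z $ i)) * sqrt 2 ^ CARD('d) * (\<Prod>i\<in>UNIV. root_gamma_density 0 (2 * v $ i) (x $ i)))"
        using nonneg by (rule mult_left_mono)
      then show "f x * (\<Prod>i\<in>UNIV. root_gamma_density (z $ i) (v $ i) (x $ i)) \<le>
         (\<Prod>i\<in>UNIV. 4 ^ (z $ i)) * sqrt 2 ^ CARD('d) * (f x * (\<Prod>i\<in>UNIV. root_gamma_density (0 $ i) ((\<chi> i. 2 * v $ i) $ i) (x $ i)))"
        by (simp add: mult_ac)
    qed
    also have "\<dots> = (\<Prod>i\<in>UNIV. 4 ^ (z $ i)) * A"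
      by (simp add: A_def mixture_def)
    finally have "ln (mixture v z) \<le> ln ((\<Prod>i\<in>UNIV. 4 ^ (z $ i)) * A)"
      using mixture_pos[OF v] by (intro ln_mono) 
    also have "\<dots> = ln A + ln 4 * n z"
      using A by (simp add: ln_mult prod_pos ln_prod ln_realpow n_def sum_distrib_left mult.commute)
    finally show ?thesis .
  qed
  have lower: "ln B - L * n z \<le> ln (mixture v z)" for z
  proof -
    have "(\<Prod>i\<in>UNIV. binomial_coeff (z $ i) (v $ i) (0 $ i) 1) * B \<le>
       (\<Sum>x\<in>{x. \<forall>i. x $ i \<le> z $ i}. (\<Prod>i\<in>UNIV. binomial_coeff (z $ i) (v $ i) (x $ i) 1) * mixture (\<chi> i. v $ i + 1) x)"
      unfolding B_def using mixture_pos[OF v1] v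
      by (intro member_le_sum[where f="\<lambda>x. (\<Prod>i\<in>UNIV. binomial_coeff (z $ i) (v $ i) (x $ i) 1) * mixture (\<chi> i. v $ i + 1) x"] finite_vec_le)
        (auto intro!: mult_nonneg_nonneg prod_nonneg simp: binomial_coeff_def less_imp_le)
    also have "\<dots> \<le> mixture v z"
      using v by (rule mixture_binomial_le)
    finally have le: "(\<Prod>i\<in>UNIV. 1 / (v $ i + 1) ^ (z $ i)) * B \<le> mixture v z"
      by (simp add: binomial_coeff_def)
    have p: "0 < (\<Prod>i\<in>UNIV. 1 / (v $ i + 1) ^ (z $ i))"
      using v1 by (intro prod_pos) simp
    have "ln B - L * n z \<le> ln B - (\<Sum>i\<in>UNIV. real (z $ i) * ln (v $ i + 1))"
    proof -
      have "real (z $ i) * ln (v $ i + 1) \<le> real (z $ i) * L" for i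
        unfolding L_def using lnv by (intro mult_left_mono member_le_sum) (auto intro: less_imp_le)
      then have "(\<Sum>i\<in>UNIV. real (z $ i) * ln (v $ i + 1)) \<le> (\<Sum>i\<in>UNIV. real (z $ i) * L)"
        by (rule sum_mono)
      then show ?thesis by (simp add: n_def sum_distrib_left mult.commute)
    qed
    also have "\<dots> = ln ((\<Prod>i\<in>UNIV. 1 / (v $ i + 1) ^ (z $ i)) * B)"
    proof -
      have "ln (\<Prod>i\<in>UNIV. 1 / (v $ i + 1) ^ (z $ i)) = (\<Sum>i\<in>UNIV. - (real (z $ i) * ln (v $ i + 1)))"
      proof -
        have "ln (1 / (v $ i + 1) ^ z $ i) = - (real (z $ i) * ln (v $ i + 1))" for i
          using v[of i] by (simp add: ln_div ln_realpow)
        moreover have "ln (\<Prod>i\<in>UNIV. 1 / (v $ i + 1) ^ (z $ i)) = (\<Sum>i\<in>UNIV. ln (1 / (v $ i + 1) ^ (z $ i)))"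
        proof (rule ln_prod)
          show "1 / (v $ i + 1) ^ (z $ i) \<noteq> 0" for i using v[of i] by auto
        qed simp
        ultimately show ?thesis by simp
      qed
      then show ?thesis
        using ln_mult_pos[OF p B] by (simp only: sum_negf)
    qed
    also have "\<dots> \<le> ln (mixture v z)"
      using le p B by (intro ln_mono) auto
    finally show ?thesis .
  qed
  define C where "C = \<bar>ln A\<bar> + \<bar>ln B\<bar> + ln 4 + L"
  have "\<bar>ln (mixture v z)\<bar> \<le> C * (\<Prod>i\<in>UNIV. 2 ^ (z $ i))" for z
  proof -
    have "n z + 1 \<le> 2 ^ (\<Sum>i\<in>UNIV. z $ i)"
      using of_nat_mono[OF Suc_leI[OF less_exp[of "\<Sum>i\<in>UNIV. z $ i"]], where 'a=real] by (simp add: n_def)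
    then have n2: "n z + 1 \<le> (\<Prod>i\<in>UNIV. 2 ^ (z $ i))"
      by (simp add: power_sum)
    have "\<bar>ln (mixture v z)\<bar> \<le> C * (n z + 1)"
    proof -
      have "0 \<le> \<bar>ln A\<bar> * n z" "0 \<le> \<bar>ln B\<bar> * n z" "0 \<le> ln 4 * n z" "0 \<le> L * n z" "0 \<le> ln (4::real)"
        using n0[of z] L0 by auto
      then show ?thesis
        using upper[of z] lower[of z] L0 unfolding C_def distrib_right distrib_left abs_le_iff by linarith
    qed
    also have "\<dots> \<le> C * (\<Prod>i\<in>UNIV. 2 ^ (z $ i))"
      using n2 L0 by (intro mult_left_mono) (auto simp: C_def)
    finally show ?thesis .
  qed
  then show ?thesis using L0 by (intro exI[of _ C]) (auto simp: C_def)
qed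

text \<open>Substitute \<open>\<gamma> $ i * (x $ i)\<^sup>2\<close> for each coordinate of the
  rate, then pass from the orthant to the whole space. The prefactor is in fact 1, since there are
  as many sign vectors as its numerator says, but it suffices that it is nonzero and independent of
  \<open>z\<close> and \<open>t\<close>.\<close>

lemma F_gamma_eq_mixture:
  fixes \<gamma> t :: "real ^ 'd"
  assumes \<gamma>: "\<And>i. 0 < \<gamma> $ i" and t: "\<And>i. 0 < t $ i"
  shows "F_gamma \<gamma> f z t = 2 ^ CARD('d) / real (card (sign_vectors :: (real ^ 'd) set)) * mixture (\<chi> i. 1 / (t $ i * \<gamma> $ i)) z"
proof -
  let ?v = "\<chi> i. 1 / (t $ i * \<gamma> $ i)"
  let ?w = "\<lambda>x. \<Prod>i\<in>UNIV. root_gamma_density (z $ i) (?v $ i) (x $ i)"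
  have v: "0 < ?v $ i" for i using \<gamma> t by simp
  define H where "H lam = f (theta_of \<gamma> lam) * (\<Prod>i\<in>UNIV. t $ i powr (real (z $ i) + 1 / 2) * lam $ i powr (real (z $ i) - 1 / 2) *
         exp (- (t $ i * lam $ i)) / Gamma (real (z $ i) + 1 / 2))" for lam
  have [measurable]: "theta_of \<gamma> \<in> borel_measurable borel"
    unfolding theta_of_def[abs_def] divide_inverse by (intro borel_measurable_continuous_onI continuous_intros)
  have "H \<in> borel_measurable borel"
    unfolding H_def[abs_def] by measurable
  then have "F_gamma \<gamma> f z t = (LINT x:pos_orthant|lborel. (\<Prod>i\<in>UNIV. 2 * \<gamma> $ i * x $ i) * H (\<chi> i. \<gamma> $ i * (x $ i)\<^sup>2))"
    unfolding F_gamma_def H_def[symmetric] by (rule set_integral_theta_of[OF \<gamma>])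
  also have "\<dots> = (LINT x:pos_orthant|lborel. 2 ^ CARD('d) * (f x * ?w x))"
  proof (rule set_lebesgue_integral_cong)
    show "\<forall>x. x \<in> pos_orthant \<longrightarrow> (\<Prod>i\<in>UNIV. 2 * \<gamma> $ i * x $ i) * H (\<chi> i. \<gamma> $ i * (x $ i)\<^sup>2) = 2 ^ CARD('d) * (f x * ?w x)"
    proof (intro allI impI)
      fix x :: "real ^ 'd" assume "x \<in> pos_orthant"
      then have x: "0 < x $ i" for i by (simp add: pos_orthant_def)
      have th: "theta_of \<gamma> (\<chi> i. \<gamma> $ i * (x $ i)\<^sup>2) = x"
      proof -
        have "sqrt (\<gamma> $ i * (x $ i)\<^sup>2 / \<gamma> $ i) = x $ i" for i
          using x[of i] \<gamma>[of i] by simp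
        then show ?thesis by (simp add: theta_of_def vec_eq_iff)
      qed
      \<comment> \<open>One coordinate of the substitution. The factor 2 appears because the signed
        root spreads the mass of a gamma variable over both half-lines.\<close>
      have comp: "(2 * g * y) * (s powr (real k + 1 / 2) * (g * y\<^sup>2) powr (real k - 1 / 2) * exp (- (s * (g * y\<^sup>2))) / Gamma (real k + 1 / 2)) =
         2 * root_gamma_density k (1 / (s * g)) y" if "0 < g" "0 < s" "0 < y" for g s y k
      proof -
        have "(g * y\<^sup>2) powr (real k - 1 / 2) = g powr (real k + 1 / 2) / g * (y ^ (2 * k) / y)"
        proof -
          have "(y\<^sup>2) powr (real k - 1 / 2) = y powr (2 * real k - 1)"
          proof -
            have "y\<^sup>2 = y powr 2" using that by simp
            then have "(y\<^sup>2) powr (real k - 1 / 2) = y powr (2 * (real k - 1 / 2))"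
              by (simp only: powr_powr)
            then show ?thesis by (simp add: right_diff_distrib)
          qed
          also have "\<dots> = y ^ (2 * k) / y"
            using that powr_realpow[of y "2 * k"] by (simp add: powr_diff)
          finally have "(y\<^sup>2) powr (real k - 1 / 2) = y ^ (2 * k) / y" .
          moreover have "g powr (real k - 1 / 2) = g powr (real k + 1 / 2) / g"
            using that powr_diff[of g "real k + 1 / 2" 1] by simp
          ultimately show ?thesis using that by (simp add: powr_mult)
        qed
        moreover have "(1 / (s * g)) powr (real k + 1 / 2) = 1 / (s powr (real k + 1 / 2) * g powr (real k + 1 / 2))"
          using that by (simp add: powr_divide powr_mult)
        ultimately show ?thesis
          using that by (simp add: root_gamma_density_def mult_ac)
      qed
      have "(\<Prod>i\<in>UNIV. 2 * \<gamma> $ i * x $ i) * H (\<chi> i. \<gamma> $ i * (x $ i)\<^sup>2) = f x * (\<Prod>i\<in>UNIV. (2 * \<gamma> $ i * x $ i) *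
         (t $ i powr (real (z $ i) + 1 / 2) * (\<gamma> $ i * (x $ i)\<^sup>2) powr (real (z $ i) - 1 / 2) *
         exp (- (t $ i * (\<gamma> $ i * (x $ i)\<^sup>2))) / Gamma (real (z $ i) + 1 / 2)))"
        unfolding H_def th by (subst (2) prod.distrib) simp
      also have "\<dots> = f x * (\<Prod>i\<in>UNIV. 2 * root_gamma_density (z $ i) (?v $ i) (x $ i))"
        by (simp only: comp[OF \<gamma> t x] vec_lambda_beta)
      finally show "(\<Prod>i\<in>UNIV. 2 * \<gamma> $ i * x $ i) * H (\<chi> i. \<gamma> $ i * (x $ i)\<^sup>2) = 2 ^ CARD('d) * (f x * ?w x)"
        by (simp add: prod.distrib)
    qed
  qed simp
  also have "\<dots> = 2 ^ CARD('d) * (LINT x:pos_orthant|lborel. f x * ?w x)"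
    by simp
  also have "(LINT x:pos_orthant|lborel. f x * ?w x) = mixture ?v z / real (card (sign_vectors :: (real ^ 'd) set))"
  proof -
    have "mixture ?v z = real (card (sign_vectors :: (real ^ 'd) set)) * (LINT x:pos_orthant|lborel. f x * ?w x)"
      unfolding mixture_def
    proof (rule integral_even_orthant)
      show "f (a * x) * ?w (a * x) = f x * ?w x" if "a \<in> sign_vectors" for a x
      proof -
        have "root_gamma_density k u (a $ i * y) = root_gamma_density k u y" for k u y i
          by (simp add: root_gamma_density_def power_mult power_mult_distrib times_sign_vector(3)[OF that])
        then have "?w (a * x) = ?w x" by (simp add: times_vec_def)
        then show ?thesis by (simp only: even[OF that])
      qed
      show "set_integrable lborel pos_orthant (\<lambda>x. f x * ?w x)"
        using integrable_mixture[OF v] unfolding set_integrable_def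
        by (intro integrable_mult_indicator) auto
    qed measurable
    moreover note card_sign_vectors_neq_0[where 'd='d]
    ultimately show ?thesis by simp
  qed
  finally show ?thesis by simp
qed

end

subsection \<open>Kullback--Leibler risks of predictive distributions\<close>

lemma abs_summable_on_iff_summable_real:
  "Infinite_Set_Sum.abs_summable_on g A \<longleftrightarrow> g summable_on A" for g :: "'a \<Rightarrow> real"
  by (metis abs_summable_equivalent summable_on_iff_abs_summable_on_real)

lemma ereal_sum_ereal:
  fixes g :: "'a \<Rightarrow> real"
  assumes "g summable_on UNIV"
  shows "ereal_sum (\<lambda>x. ereal (g x)) = ereal (infsum g UNIV)"
proof -
  have abs: "Infinite_Set_Sum.abs_summable_on g UNIV"
    using assms by (simp add: abs_summable_on_iff_summable_real)
  then have int: "integrable (count_space UNIV) g"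
    by (simp add: Infinite_Set_Sum.abs_summable_on_def)
  have e: "e2ennreal (ereal a) = ennreal a" for a
    by (cases "0 \<le> a") (auto simp: ennreal_def e2ennreal_def max_def)
  have fin: "(\<integral>\<^sup>+x. ennreal (g x) \<partial>count_space UNIV) \<noteq> \<infinity>" "(\<integral>\<^sup>+x. ennreal (- g x) \<partial>count_space UNIV) \<noteq> \<infinity>"
    using int by (auto simp: real_integrable_def)
  have real: "enn2ereal u = ereal (enn2real u)" if "u \<noteq> \<infinity>" for u
    using that by (cases u) (auto simp: enn2real_def)
  have "ereal_sum (\<lambda>x. ereal (g x)) = ereal (enn2real (\<integral>\<^sup>+x. ennreal (g x) \<partial>count_space UNIV) -
      enn2real (\<integral>\<^sup>+x. ennreal (- g x) \<partial>count_space UNIV))"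
    unfolding ereal_sum_def uminus_ereal.simps e real[OF fin(1)] real[OF fin(2)] by simp
  also have "enn2real (\<integral>\<^sup>+x. ennreal (g x) \<partial>count_space UNIV) - enn2real (\<integral>\<^sup>+x. ennreal (- g x) \<partial>count_space UNIV)
     = integral\<^sup>L (count_space UNIV) g"
    by (rule real_lebesgue_integral_def[OF int, symmetric])
  also have "\<dots> = infsum g UNIV"
    using infsetsum_infsum[OF abs] by (simp add: infsetsum_def)
  finally show ?thesis .
qed

section \<open>Summability against Poisson weights\<close>

lemma summable_on_vec_prod:
  fixes g :: "'d::finite \<Rightarrow> nat \<Rightarrow> real"
  assumes "\<And>i. summable (\<lambda>n. \<bar>g i n\<bar>)"
  shows "(\<lambda>x :: nat ^ 'd. \<Prod>i\<in>UNIV. g i (x $ i)) summable_on UNIV"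
proof -
  have "Infinite_Set_Sum.abs_summable_on (\<lambda>h. \<Prod>i\<in>(UNIV::'d set). g i (h i)) (PiE UNIV (\<lambda>_. UNIV))"
    using assms by (intro abs_summable_on_prod_PiE) (auto simp: abs_summable_on_nat_iff')
  then have "(\<lambda>h. \<Prod>i\<in>(UNIV::'d set). g i (h i)) summable_on UNIV"
    by (simp add: abs_summable_on_iff_summable_real)
  moreover have "bij_betw vec_nth (UNIV :: (nat ^ 'd) set) UNIV"
    by (rule bij_betwI[where g=vec_lambda]) (auto simp: vec_lambda_inverse vec_nth_inverse)
  ultimately show ?thesis
    using summable_on_reindex_bij_betw[of vec_nth UNIV UNIV "\<lambda>h. \<Prod>i\<in>UNIV. g i (h i)"] by simp
qed

lemma summable_on_product:
  fixes f :: "'a \<Rightarrow> real" and g :: "'b \<Rightarrow> real"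
  assumes "f summable_on A" "g summable_on B" "countable A" "countable B"
  shows "(\<lambda>(x, y). f x * g y) summable_on A \<times> B"
  using assms abs_summable_on_product[of A B f g]
  by (simp add: abs_summable_on_iff_summable_real)

text \<open>A growth scale that dominates every linear function of the counts up to a constant, is
  multiplicative under addition of counts, and has finite Poisson expectation.\<close>

definition pow2 :: "nat ^ 'd::finite \<Rightarrow> real"
  where "pow2 x = (\<Prod>i\<in>UNIV. 2 ^ (x $ i))"

lemma pow2_add: "pow2 (x + y) = pow2 x * pow2 y"
  by (simp add: pow2_def power_add prod.distrib)

lemma pow2_ge: "2 ^ (x $ i) \<le> pow2 x" and pow2_ge_1: "1 \<le> pow2 x"
proof -
  have "pow2 x = 2 ^ (\<Sum>i\<in>UNIV. x $ i)"
    by (simp add: pow2_def power_sum)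
  moreover have "x $ i \<le> (\<Sum>i\<in>UNIV. x $ i)"
    by (rule member_le_sum) auto
  ultimately show "2 ^ (x $ i) \<le> pow2 x" "1 \<le> pow2 x"
    by (simp_all add: power_increasing)
qed

lemma poisson_prob_pos:
  assumes "\<And>i. 0 < r $ i" "\<And>i. 0 < lam $ i"
  shows "0 < poisson_prob r lam x"
  using assms by (auto simp: poisson_prob_def intro!: prod_pos divide_pos_pos mult_pos_pos)

lemma summable_poisson_pow2:
  fixes r :: "real ^ 'd::finite"
  shows "(\<lambda>x. poisson_prob r lam x * pow2 x) summable_on UNIV"
proof -
  have "summable (\<lambda>n. \<bar>(a ^ n * exp (- a) / fact n) * 2 ^ n\<bar>)" for a :: real
  proof -
    have "summable (\<lambda>n. exp (- a) * (inverse (fact n) * \<bar>2 * a\<bar> ^ n))"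
      by (intro summable_mult summable_exp)
    then show ?thesis
      by (simp add: abs_mult power_abs power_mult_distrib field_simps)
  qed
  then have "(\<lambda>x :: nat ^ 'd. \<Prod>i\<in>UNIV. ((r $ i * lam $ i) ^ (x $ i) * exp (- (r $ i * lam $ i)) / fact (x $ i)) * 2 ^ (x $ i)) summable_on UNIV"
    by (rule summable_on_vec_prod)
  then show ?thesis
    by (simp only: poisson_prob_def pow2_def prod.distrib)
qed

lemma countable_nat_vec: "countable (UNIV :: (nat ^ 'd::finite) set)"
proof -
  have "countable (PiE (UNIV :: 'd set) (\<lambda>_. UNIV :: nat set))"
    by (intro countable_PiE) auto
  then have "countable (range (vec_lambda :: ('d \<Rightarrow> nat) \<Rightarrow> nat ^ 'd))"
    by simp
  moreover have "range (vec_lambda :: ('d \<Rightarrow> nat) \<Rightarrow> nat ^ 'd) = UNIV"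
    by (metis surjI vec_nth_inverse)
  ultimately show ?thesis by simp
qed

lemma summable_poisson_pair:
  fixes r s lam :: "real ^ 'd::finite"
  assumes "\<And>i. 0 < r $ i" "\<And>i. 0 < s $ i" "\<And>i. 0 < lam $ i"
    and g: "\<And>x y. \<bar>g x y\<bar> \<le> C * (pow2 x * pow2 y)"
  shows "(\<lambda>(x, y). poisson_prob r lam x * poisson_prob s lam y * g x y) summable_on UNIV"
proof -
  have "(\<lambda>(x, y). (poisson_prob r lam x * pow2 x) * (poisson_prob s lam y * pow2 y)) summable_on UNIV \<times> UNIV"
    by (intro summable_on_product summable_poisson_pow2 countable_nat_vec)
  then have "(\<lambda>p. C * (case p of (x, y) \<Rightarrow> (poisson_prob r lam x * pow2 x) * (poisson_prob s lam y * pow2 y))) summable_on UNIV"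
    by (intro summable_on_cmult_right) simp
  then have "(\<lambda>p. norm (case p of (x, y) \<Rightarrow> poisson_prob r lam x * poisson_prob s lam y * g x y)) summable_on UNIV"
  proof (rule Infinite_Sum.abs_summable_on_comparison_test')
    fix p :: "(nat ^ 'd) \<times> (nat ^ 'd)"
    obtain x y where p: "p = (x, y)" by (cases p)
    have "poisson_prob r lam x * poisson_prob s lam y * \<bar>g x y\<bar> \<le> poisson_prob r lam x * poisson_prob s lam y * (C * (pow2 x * pow2 y))"
      using g assms by (intro mult_left_mono) (auto intro!: mult_nonneg_nonneg less_imp_le[OF poisson_prob_pos])
    then show "norm (case p of (x, y) \<Rightarrow> poisson_prob r lam x * poisson_prob s lam y * g x y)
      \<le> C * (case p of (x, y) \<Rightarrow> (poisson_prob r lam x * pow2 x) * (poisson_prob s lam y * pow2 y))"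
      using poisson_prob_pos[of r lam x] poisson_prob_pos[of s lam y] assms by (simp add: p abs_mult mult_ac)
  qed
  then show ?thesis
    by (rule summable_on_iff_abs_summable_on_real[THEN iffD2])
qed

text \<open>The bound makes the double family absolutely summable. Hence every inner sum and the
  outer sum are finite, no infinite value of \<open>ereal_sum\<close> or \<open>log_ratio\<close>
  occurs, and the iterated sums merge into one that can be reordered.\<close>

lemma kl_risk_eq_infsum:
  fixes r s lam :: "real ^ 'd::finite"
  assumes pos: "\<And>i. 0 < r $ i" "\<And>i. 0 < s $ i" "\<And>i. 0 < lam $ i"
    and q: "\<And>x y. q y x \<noteq> 0" and g: "\<And>x y. ln (poisson_prob s lam y / q y x) = g x y"
    and bound: "\<And>x y. \<bar>g x y\<bar> \<le> C * (pow2 x * pow2 y)"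
  shows "kl_risk r s q lam = ereal (\<Sum>\<^sub>\<infinity>(x, y)\<in>UNIV. poisson_prob r lam x * poisson_prob s lam y * g x y)"
proof -
  let ?w = "\<lambda>x y. poisson_prob r lam x * poisson_prob s lam y * g x y"
  have sum: "(\<lambda>(x, y). ?w x y) summable_on UNIV"
    using pos bound by (rule summable_poisson_pair)
  have r0: "poisson_prob r lam x \<noteq> 0" for x
    using poisson_prob_pos[OF pos(1,3), of x] by simp
  have "(\<lambda>y. ?w x y) summable_on UNIV" for x
    using summable_on_SigmaD1[of "\<lambda>x y. ?w x y" UNIV "\<lambda>_. UNIV" x] sum by simp
  then have "(\<lambda>y. poisson_prob r lam x * (poisson_prob s lam y * g x y)) summable_on UNIV" for x
    by (simp add: mult.assoc)
  then have s1: "(\<lambda>y. poisson_prob s lam y * g x y) summable_on UNIV" for x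
    using r0 by (simp add: summable_on_cmult_right')
  have "kl_risk r s q lam = ereal_sum (\<lambda>x. ereal (poisson_prob r lam x * (\<Sum>\<^sub>\<infinity>y. poisson_prob s lam y * g x y)))"
    unfolding kl_risk_def log_ratio_def using q by (simp add: g ereal_sum_ereal[OF s1])
  also have "(\<lambda>x. poisson_prob r lam x * (\<Sum>\<^sub>\<infinity>y. poisson_prob s lam y * g x y)) = (\<lambda>x. \<Sum>\<^sub>\<infinity>y. ?w x y)"
    by (simp add: infsum_cmult_right' mult.assoc)
  also have "ereal_sum (\<lambda>x. ereal (\<Sum>\<^sub>\<infinity>y. ?w x y)) = ereal (\<Sum>\<^sub>\<infinity>x. \<Sum>\<^sub>\<infinity>y. ?w x y)"
    using summable_on_Sigma_banach[of "\<lambda>x y. ?w x y" UNIV "\<lambda>_. UNIV"] sum by (intro ereal_sum_ereal) simp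
  also have "(\<Sum>\<^sub>\<infinity>x. \<Sum>\<^sub>\<infinity>y. ?w x y) = (\<Sum>\<^sub>\<infinity>(x, y)\<in>UNIV. ?w x y)"
    using infsum_Sigma'_banach[of "\<lambda>x y. ?w x y" UNIV "\<lambda>_. UNIV"] sum by simp
  finally show ?thesis .
qed

section \<open>Closed form of the predictive distributions\<close>

definition predictive_numerator :: "real ^ 'd::finite \<Rightarrow> real ^ 'd \<Rightarrow> nat ^ 'd \<Rightarrow> nat ^ 'd \<Rightarrow> real"
  where "predictive_numerator r s x y = (\<Prod>i\<in>UNIV. r $ i ^ (x $ i) * s $ i ^ (y $ i) * Gamma (real (x $ i + y $ i) + 1 / 2) /
    (fact (x $ i) * fact (y $ i) * (r $ i + s $ i) powr (real (x $ i + y $ i) + 1 / 2)))"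

definition predictive_denominator :: "real ^ 'd::finite \<Rightarrow> nat ^ 'd \<Rightarrow> real"
  where "predictive_denominator r x = (\<Prod>i\<in>UNIV. Gamma (real (x $ i) + 1 / 2) / (fact (x $ i) * sqrt (r $ i)))"

lemma predictive_pos:
  assumes "\<And>i. 0 < r $ i" "\<And>i. 0 < s $ i"
  shows "0 < predictive_numerator r s x y" "0 < predictive_denominator r x"
proof -
  have G: "0 < Gamma (real n + 1 / 2)" for n by (rule Gamma_real_pos) simp
  have rs: "r $ i + s $ i \<noteq> 0" for i using assms[of i] by simp
  show "0 < predictive_numerator r s x y" "0 < predictive_denominator r x"
    unfolding predictive_numerator_def predictive_denominator_def
    using assms rs G by (auto intro!: prod_pos divide_pos_pos mult_pos_pos simp del: of_nat_add)
qed

lemma powr_half_shift: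
  assumes "0 < (l::real)"
  shows "l ^ k * l powr (- 1 / 2) = l powr (real k - 1 / 2)"
  using assms powr_add[of l "real k" "- 1 / 2"] by (simp add: powr_realpow)

text \<open>Conjugacy: the likelihood times the Jeffreys density is a constant times a product of
  gamma densities, with shapes \<open>x + 1/2\<close> and rates \<open>r\<close> below, and shapes
  \<open>x + y + 1/2\<close> and rates \<open>r + s\<close> above.
  \<open>predictive_denominator\<close> and \<open>predictive_numerator\<close> are these constants;
  their quotient is the Jeffreys predictive, a product of negative binomial probabilities.\<close>

lemma bayes_predictive_tilted:
  fixes r s \<gamma> :: "real ^ 'd::finite"
  assumes r: "\<And>i. 0 < r $ i" and s: "\<And>i. 0 < s $ i"
  shows "bayes_predictive r s (tilted_jeffreys_prior \<gamma> g) y x =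
    predictive_numerator r s x y * F_gamma \<gamma> g (x + y) (r + s) / (predictive_denominator r x * F_gamma \<gamma> g x r)"
proof -
  have G: "Gamma (real n + 1 / 2) \<noteq> 0" for n
    using Gamma_real_pos[of "real n + 1 / 2"] by linarith
  have den: "poisson_prob r lam x * tilted_jeffreys_prior \<gamma> g lam =
      predictive_denominator r x * (g (theta_of \<gamma> lam) *
      (\<Prod>i\<in>UNIV. r $ i powr (real (x $ i) + 1 / 2) * lam $ i powr (real (x $ i) - 1 / 2) *
         exp (- (r $ i * lam $ i)) / Gamma (real (x $ i) + 1 / 2)))" if lam: "lam \<in> pos_orthant" for lam
  proof -
    have "poisson_prob r lam x * jeffreys_prior lam = predictive_denominator r x *
      (\<Prod>i\<in>UNIV. r $ i powr (real (x $ i) + 1 / 2) * lam $ i powr (real (x $ i) - 1 / 2) *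
         exp (- (r $ i * lam $ i)) / Gamma (real (x $ i) + 1 / 2))"
      unfolding poisson_prob_def jeffreys_prior_def predictive_denominator_def prod.distrib[symmetric]
    proof (rule prod.cong[OF refl])
      fix i
      have l: "0 < lam $ i" using lam by (simp add: pos_orthant_def)
      have "r $ i powr (real (x $ i) + 1 / 2) = r $ i ^ (x $ i) * sqrt (r $ i)"
        using r[of i] by (simp add: powr_add powr_realpow powr_half_sqrt)
      moreover have "sqrt (r $ i) \<noteq> 0" using r[of i] by simp
      ultimately show "(r $ i * lam $ i) ^ x $ i * exp (- (r $ i * lam $ i)) / fact (x $ i) * lam $ i powr (- 1 / 2) =
        Gamma (real (x $ i) + 1 / 2) / (fact (x $ i) * sqrt (r $ i)) *
         (r $ i powr (real (x $ i) + 1 / 2) * lam $ i powr (real (x $ i) - 1 / 2) * exp (- (r $ i * lam $ i)) / Gamma (real (x $ i) + 1 / 2))"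
        using G[of "x $ i"] by (simp add: powr_half_shift[OF l, symmetric] power_mult_distrib)
    qed
    then show ?thesis by (simp add: tilted_jeffreys_prior_def mult_ac)
  qed
  have num: "poisson_prob r lam x * poisson_prob s lam y * tilted_jeffreys_prior \<gamma> g lam =
      predictive_numerator r s x y * (g (theta_of \<gamma> lam) *
      (\<Prod>i\<in>UNIV. (r + s) $ i powr (real ((x + y) $ i) + 1 / 2) * lam $ i powr (real ((x + y) $ i) - 1 / 2) *
         exp (- ((r + s) $ i * lam $ i)) / Gamma (real ((x + y) $ i) + 1 / 2)))" if lam: "lam \<in> pos_orthant" for lam
  proof -
    have "poisson_prob r lam x * poisson_prob s lam y * jeffreys_prior lam = predictive_numerator r s x y *
      (\<Prod>i\<in>UNIV. (r + s) $ i powr (real ((x + y) $ i) + 1 / 2) * lam $ i powr (real ((x + y) $ i) - 1 / 2) *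
         exp (- ((r + s) $ i * lam $ i)) / Gamma (real ((x + y) $ i) + 1 / 2))"
      unfolding poisson_prob_def jeffreys_prior_def predictive_numerator_def prod.distrib[symmetric]
    proof (rule prod.cong[OF refl])
      fix i
      have l: "0 < lam $ i" using lam by (simp add: pos_orthant_def)
      have "(r $ i + s $ i) powr (real (x $ i + y $ i) + 1 / 2) \<noteq> 0" using r[of i] s[of i] by simp
      moreover have "exp (- ((r $ i + s $ i) * lam $ i)) = exp (- (r $ i * lam $ i)) * exp (- (s $ i * lam $ i))"
        by (simp add: exp_add[symmetric] algebra_simps)
      ultimately show "(r $ i * lam $ i) ^ x $ i * exp (- (r $ i * lam $ i)) / fact (x $ i) *
          ((s $ i * lam $ i) ^ y $ i * exp (- (s $ i * lam $ i)) / fact (y $ i)) * lam $ i powr (- 1 / 2) =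
        r $ i ^ x $ i * s $ i ^ y $ i * Gamma (real (x $ i + y $ i) + 1 / 2) /
         (fact (x $ i) * fact (y $ i) * (r $ i + s $ i) powr (real (x $ i + y $ i) + 1 / 2)) *
         ((r + s) $ i powr (real ((x + y) $ i) + 1 / 2) * lam $ i powr (real ((x + y) $ i) - 1 / 2) *
         exp (- ((r + s) $ i * lam $ i)) / Gamma (real ((x + y) $ i) + 1 / 2))"
        using G[of "x $ i + y $ i"]
        by (simp add: powr_half_shift[OF l, symmetric] power_mult_distrib power_add mult_ac del: of_nat_add)
    qed
    then show ?thesis by (simp add: tilted_jeffreys_prior_def mult_ac)
  qed
  have "(LINT lam:pos_orthant|lborel. poisson_prob r lam x * poisson_prob s lam y * tilted_jeffreys_prior \<gamma> g lam) =
      predictive_numerator r s x y * F_gamma \<gamma> g (x + y) (r + s)"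
    unfolding F_gamma_def by (subst set_lebesgue_integral_cong[OF _ ballI[THEN iffD1[OF Ball_def], OF num]]) auto
  moreover have "(LINT lam:pos_orthant|lborel. poisson_prob r lam x * tilted_jeffreys_prior \<gamma> g lam) =
      predictive_denominator r x * F_gamma \<gamma> g x r"
    unfolding F_gamma_def by (subst set_lebesgue_integral_cong[OF _ ballI[THEN iffD1[OF Ball_def], OF den]]) auto
  ultimately show ?thesis
    by (simp add: bayes_predictive_def)
qed

lemma jeffreys_prior_eq_tilted: "jeffreys_prior = tilted_jeffreys_prior \<gamma> (\<lambda>_. 1)"
  by (simp add: tilted_jeffreys_prior_def fun_eq_iff)

text \<open>The weight in \<open>F_gamma\<close> is a product of normalised gamma densities.
  Nonnegative integrals let it split over coordinates without a prior integrability
  argument.\<close>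

lemma F_gamma_const:
  fixes t :: "real ^ 'd::finite"
  assumes t: "\<And>i. 0 < t $ i"
  shows "F_gamma \<gamma> (\<lambda>_. 1) z t = 1"
proof -
  define h where "h i l = t $ i powr (real (z $ i) + 1 / 2) * l powr (real (z $ i) - 1 / 2) * exp (- (t $ i * l)) / Gamma (real (z $ i) + 1 / 2)" for i l
  have G: "0 < Gamma (real n + 1 / 2)" for n by (rule Gamma_real_pos) simp
  have h0: "0 \<le> h i l" for i l
    unfolding h_def using G[of "z $ i"] by simp
  have [measurable]: "h i \<in> borel_measurable borel" for i
    unfolding h_def[abs_def] by measurable
  have int1: "(\<integral>\<^sup>+l. indicator {0<..} l * ennreal (h i l) \<partial>lborel) = 1" for i
  proof -
    define a where "a = real (z $ i) + 1 / 2"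
    have a: "0 < a" by (simp add: a_def)
    have "ennreal (Gamma a) = (\<integral>\<^sup>+l. ennreal (indicator {0..} l * l powr (a - 1) / exp l) \<partial>lborel)"
      by (rule Gamma_conv_nn_integral_real[OF a])
    also have "\<dots> = ennreal \<bar>t $ i\<bar> * (\<integral>\<^sup>+l. ennreal (indicator {0..} (0 + t $ i * l) * (0 + t $ i * l) powr (a - 1) / exp (0 + t $ i * l)) \<partial>lborel)"
      using t[of i] by (intro nn_integral_real_affine) auto
    also have "\<dots> = (\<integral>\<^sup>+l. ennreal (t $ i) * ennreal (indicator {0..} (t $ i * l) * (t $ i * l) powr (a - 1) / exp (t $ i * l)) \<partial>lborel)"
      using t[of i] by (subst nn_integral_cmult) auto
    also have "\<dots> = (\<integral>\<^sup>+l. ennreal (Gamma a) * (indicator {0<..} l * ennreal (h i l)) \<partial>lborel)"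
    proof (rule nn_integral_cong_AE, rule eventually_mono[OF AE_lborel_singleton[of 0]])
      fix l :: real
      assume elim: "l \<noteq> 0"
      show "ennreal (t $ i) * ennreal (indicator {0..} (t $ i * l) * (t $ i * l) powr (a - 1) / exp (t $ i * l)) =
          ennreal (Gamma a) * (indicator {0<..} l * ennreal (h i l))"
      proof (cases "0 < l")
        case True
        have "t $ i * (t $ i * l) powr (a - 1) / exp (t $ i * l) = Gamma a * h i l"
        proof -
          have "t $ i * t $ i powr (a - 1) = t $ i powr a"
            using t[of i] powr_add[of "t $ i" 1 "a - 1"] by simp
          moreover have "(t $ i * l) powr (a - 1) = t $ i powr (a - 1) * l powr (a - 1)"
            by (rule powr_mult)
          moreover have "Gamma a * h i l = t $ i powr a * l powr (a - 1) * exp (- (t $ i * l))"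
            using less_imp_neq[OF G[of "z $ i"]] unfolding h_def a_def by simp
          ultimately show ?thesis by (simp add: exp_minus divide_inverse mult.assoc[symmetric])
        qed
        then show ?thesis
          using True t[of i] G[of "z $ i"] h0[of i l] by (simp add: ennreal_mult[symmetric] a_def)
      next
        case False
        then have "t $ i * l < 0" using elim t[of i] by (simp add: mult_pos_neg)
        then show ?thesis using False by simp
      qed
    qed
    also have "\<dots> = ennreal (Gamma a) * (\<integral>\<^sup>+l. indicator {0<..} l * ennreal (h i l) \<partial>lborel)"
      by (rule nn_integral_cmult) measurable
    finally have eq: "ennreal (Gamma a) * 1 = ennreal (Gamma a) * (\<integral>\<^sup>+l. indicator {0<..} l * ennreal (h i l) \<partial>lborel)"
      by simp
    have "ennreal (Gamma a) \<noteq> 0" "ennreal (Gamma a) \<noteq> top"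
      using G[of "z $ i"] unfolding a_def[symmetric] by auto
    with eq show ?thesis
      by (subst (asm) ennreal_mult_cancel_left) auto
  qed
  have "F_gamma \<gamma> (\<lambda>_. 1) z t = (\<integral>x. indicator pos_orthant x * (\<Prod>i\<in>UNIV. h i (x $ i)) \<partial>lborel)"
    by (simp add: F_gamma_def h_def set_lebesgue_integral_def)
  also have "\<dots> = enn2real (\<integral>\<^sup>+x. ennreal (indicator pos_orthant x * (\<Prod>i\<in>UNIV. h i (x $ i))) \<partial>lborel)"
    by (rule integral_eq_nn_integral) (auto intro!: prod_nonneg h0 mult_nonneg_nonneg)
  also have "(\<integral>\<^sup>+x. ennreal (indicator pos_orthant x * (\<Prod>i\<in>UNIV. h i (x $ i))) \<partial>lborel) =
      (\<integral>\<^sup>+x. (\<Prod>i\<in>UNIV. indicator {0<..} (x $ i) * ennreal (h i (x $ i))) \<partial>lborel)"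
  proof (rule nn_integral_cong)
    fix x :: "real ^ 'd"
    have "indicator pos_orthant x = (\<Prod>i\<in>UNIV. indicator {0<..} (x $ i) :: real)"
      by (auto simp: indicator_def pos_orthant_def intro!: prod_zero)
    then have "indicator pos_orthant x * (\<Prod>i\<in>UNIV. h i (x $ i)) = (\<Prod>i\<in>UNIV. indicator {0<..} (x $ i) * h i (x $ i))"
      by (simp add: prod.distrib)
    then have "ennreal (indicator pos_orthant x * (\<Prod>i\<in>UNIV. h i (x $ i))) = (\<Prod>i\<in>UNIV. ennreal (indicator {0<..} (x $ i) * h i (x $ i)))"
      using h0 by (simp add: prod_ennreal)
    also have "\<dots> = (\<Prod>i\<in>UNIV. indicator {0<..} (x $ i) * ennreal (h i (x $ i)))"
      by (intro prod.cong refl) (auto simp: indicator_def)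
    finally show "ennreal (indicator pos_orthant x * (\<Prod>i\<in>UNIV. h i (x $ i))) =
        (\<Prod>i\<in>UNIV. indicator {0<..} (x $ i) * ennreal (h i (x $ i)))" .
  qed
  also have "\<dots> = (\<Prod>i\<in>UNIV. \<integral>\<^sup>+l. indicator {0<..} l * ennreal (h i l) \<partial>lborel)"
    by (rule nn_integral_lborel_vec_prod) measurable
  finally show ?thesis
    by (simp add: int1)
qed

text \<open>The recursion adds \<open>ln (real n + 1 / 2)\<close>, of modulus at most
  \<open>2 ^ n\<close>, so the bound doubles at each step; it starts from \<open>sqrt pi\<close>,
  which lies between 1 and 2.\<close>

lemma abs_ln_Gamma_half_le: "\<bar>ln (Gamma (real n + 1 / 2))\<bar> \<le> 2 ^ n"
proof (induction n)
  case 0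
  have "1 < sqrt pi" using pi_gt3 by (simp add: real_less_rsqrt)
  moreover have "sqrt pi \<le> 2" using pi_less_4 by (intro real_le_lsqrt) auto
  then have "ln (sqrt pi) \<le> sqrt pi - 1" "sqrt pi - 1 \<le> 1"
    using ln_le_minus_one[of "sqrt pi"] by auto
  ultimately show ?case
    by (simp add: Gamma_one_half_real del: ln_sqrt)
next
  case (Suc n)
  have G: "0 < Gamma (real n + 1 / 2)" by (rule Gamma_real_pos) simp
  have "\<bar>ln (real n + 1 / 2)\<bar> \<le> 2 ^ n"
  proof (cases n)
    case 0
    have "ln (1 / 2 :: real) = - ln 2" by (simp add: ln_div)
    moreover have "ln (2::real) \<le> 1" using ln_le_minus_one[of "2::real"] by simp
    ultimately show ?thesis using 0 by simp
  next
    case (Suc m)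
    have "real n \<le> 2 ^ n" using less_exp[of n] by (metis less_imp_le of_nat_less_numeral_power_cancel_iff)
    moreover have "ln (real n + 1 / 2) \<le> real n + 1 / 2 - 1"
      by (rule ln_le_minus_one) simp
    ultimately have "ln (real n + 1 / 2) \<le> 2 ^ n" by linarith
    moreover have "0 \<le> ln (real n + 1 / 2)" using Suc by (intro ln_ge_zero) simp
    ultimately show ?thesis by simp
  qed
  moreover have "ln (Gamma (real (Suc n) + 1 / 2)) = ln (real n + 1 / 2) + ln (Gamma (real n + 1 / 2))"
    unfolding Gamma_Suc_half using G by (intro ln_mult_pos) auto
  ultimately show ?case
    using Suc by simp
qed

subsection \<open>Comparison of the risks\<close>

text \<open>Apart from the logarithms of Gamma values, all terms are affine in the counts, and
  powers of two dominate both kinds. This is what makes the Jeffreys risk finite.\<close>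

lemma abs_ln_predictive_ratio_le:
  fixes r s lam :: "real ^ 'd::finite"
  assumes r: "\<And>i. 0 < r $ i" and s: "\<And>i. 0 < s $ i" and l: "\<And>i. 0 < lam $ i"
  shows "\<exists>C. \<forall>x y. \<bar>ln (poisson_prob s lam y / (predictive_numerator r s x y / predictive_denominator r x))\<bar>
    \<le> C * (pow2 x * pow2 y)"
proof -
  define c where "c i m n = lam $ i ^ n * exp (- (s $ i * lam $ i)) * ((r $ i + s $ i) powr (real (m + n) + 1 / 2) / r $ i powr (real m + 1 / 2)) *
     (Gamma (real m + 1 / 2) / Gamma (real (m + n) + 1 / 2))" for i m n
  \<comment> \<open>Each term of \<open>ln (c i m n)\<close> has a coefficient of modulus at most
    \<open>2 ^ m * 2 ^ n\<close>; the summand 2 covers the two Gamma terms.\<close>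
  define K where "K i = \<bar>ln (lam $ i)\<bar> + s $ i * lam $ i + \<bar>ln (r $ i + s $ i)\<bar> + \<bar>ln (r $ i)\<bar> + 2" for i
  have G: "0 < Gamma (real n + 1 / 2)" for n by (rule Gamma_real_pos) simp
  have G2: "0 < Gamma (real (m + n) + 1 / 2)" for m n by (rule G)
  have rs: "0 < r $ i + s $ i" for i using r[of i] s[of i] by simp
  have cpos: "0 < c i m n" for i m n
    unfolding c_def using G G2 l[of i] r[of i] rs[of i] by (intro mult_pos_pos divide_pos_pos) auto
  have ratio: "poisson_prob s lam y / (predictive_numerator r s x y / predictive_denominator r x) = (\<Prod>i\<in>UNIV. c i (x $ i) (y $ i))" for x y
    unfolding poisson_prob_def predictive_numerator_def predictive_denominator_def prod_dividef[symmetric]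
  proof (rule prod.cong[OF refl])
    fix i
    have alg: "S * A * B / F2 / (R * S * G2 / (F1 * F2 * P) / (G1 / (F1 * Q))) = A * B * (P / (R * Q)) * (G1 / G2)"
      if "S \<noteq> 0" "R \<noteq> 0" "F1 \<noteq> 0" "F2 \<noteq> 0" "G1 \<noteq> 0" "G2 \<noteq> 0" "P \<noteq> 0" "Q \<noteq> 0"
      for S A B F1 F2 R G1 G2 P Q :: real
      using that by (simp add: divide_simps)
    have rp: "r $ i powr (real (x $ i) + 1 / 2) = r $ i ^ (x $ i) * sqrt (r $ i)"
      using r[of i] by (simp add: powr_add powr_realpow powr_half_sqrt)
    show "(s $ i * lam $ i) ^ y $ i * exp (- (s $ i * lam $ i)) / fact (y $ i) /
         (r $ i ^ x $ i * s $ i ^ y $ i * Gamma (real (x $ i + y $ i) + 1 / 2) /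
          (fact (x $ i) * fact (y $ i) * (r $ i + s $ i) powr (real (x $ i + y $ i) + 1 / 2)) /
          (Gamma (real (x $ i) + 1 / 2) / (fact (x $ i) * sqrt (r $ i)))) = c i (x $ i) (y $ i)"
      unfolding c_def power_mult_distrib rp
    proof (rule alg)
      show "Gamma (real (x $ i) + 1 / 2) \<noteq> 0" "Gamma (real (x $ i + y $ i) + 1 / 2) \<noteq> 0"
        using G[of "x $ i"] G2[of "x $ i" "y $ i"] by linarith+
      show "s $ i ^ y $ i \<noteq> 0" "r $ i ^ x $ i \<noteq> 0" "sqrt (r $ i) \<noteq> 0"
        "(r $ i + s $ i) powr (real (x $ i + y $ i) + 1 / 2) \<noteq> 0"
        using r[of i] s[of i] rs[of i] by simp_all
    qed simp_all
  qed
  have lnc: "\<bar>ln (c i m n)\<bar> \<le> K i * (2 ^ m * 2 ^ n)" for i m n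
  proof -
    define P where "P = (2::real) ^ m * 2 ^ n"
    have P: "P = 2 ^ (m + n)" by (simp add: P_def power_add)
    have mn: "real (m + n) + 1 \<le> P"
      using of_nat_mono[OF Suc_leI[OF less_exp[of "m + n"]], where 'a=real] by (simp add: P)
    have "ln (c i m n) = real n * ln (lam $ i) - s $ i * lam $ i + ((real (m + n) + 1 / 2) * ln (r $ i + s $ i) - (real m + 1 / 2) * ln (r $ i))
       + (ln (Gamma (real m + 1 / 2)) - ln (Gamma (real (m + n) + 1 / 2)))"
    proof -
      have "0 < lam $ i ^ n" using l[of i] by simp
      moreover have "0 < (r $ i + s $ i) powr (real (m + n) + 1 / 2)" "0 < r $ i powr (real m + 1 / 2)"
        using rs[of i] r[of i] by auto
      ultimately show ?thesis
        unfolding c_def using G[of m] G2[of m n] l[of i] r[of i] rs[of i]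
        by (simp add: ln_mult_pos ln_divide_pos ln_realpow ln_powr del: of_nat_add)
    qed
    moreover have "\<bar>real n * ln (lam $ i)\<bar> \<le> \<bar>ln (lam $ i)\<bar> * P"
      using mn mult_left_mono[of "real n" P "\<bar>ln (lam $ i)\<bar>"] by (simp add: abs_mult mult.commute)
    moreover have "\<bar>s $ i * lam $ i\<bar> \<le> s $ i * lam $ i * P"
      using mn s[of i] l[of i] mult_left_mono[of 1 P "s $ i * lam $ i"] by simp
    moreover have "\<bar>(real (m + n) + 1 / 2) * ln (r $ i + s $ i)\<bar> \<le> \<bar>ln (r $ i + s $ i)\<bar> * P"
      using mn mult_left_mono[of "real (m + n) + 1 / 2" P "\<bar>ln (r $ i + s $ i)\<bar>"] by (simp add: abs_mult mult.commute)
    moreover have "\<bar>(real m + 1 / 2) * ln (r $ i)\<bar> \<le> \<bar>ln (r $ i)\<bar> * P"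
      using mn mult_left_mono[of "real m + 1 / 2" P "\<bar>ln (r $ i)\<bar>"] by (simp add: abs_mult mult.commute)
    moreover have "\<bar>ln (Gamma (real m + 1 / 2))\<bar> \<le> P"
      using abs_ln_Gamma_half_le[of m] power_increasing[of m "m + n" "2::real"] unfolding P by linarith
    moreover have "\<bar>ln (Gamma (real (m + n) + 1 / 2))\<bar> \<le> P"
      unfolding P by (rule abs_ln_Gamma_half_le)
    ultimately have "\<bar>ln (c i m n)\<bar> \<le> K i * P"
      unfolding K_def distrib_right abs_le_iff by (elim conjE, intro conjI) linarith+
    then show ?thesis by (simp only: P_def)
  qed
  have K0: "0 \<le> K i" for i
    unfolding K_def using s[of i] l[of i] by simp
  have "\<bar>ln (poisson_prob s lam y / (predictive_numerator r s x y / predictive_denominator r x))\<bar> \<le> (\<Sum>i\<in>UNIV. K i) * (pow2 x * pow2 y)" for x y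
  proof -
    have "ln (\<Prod>i\<in>UNIV. c i (x $ i) (y $ i)) = (\<Sum>i\<in>UNIV. ln (c i (x $ i) (y $ i)))"
    proof (rule ln_prod)
      show "c i (x $ i) (y $ i) \<noteq> 0" for i
        using cpos[of i "x $ i" "y $ i"] by simp
    qed simp
    then have "\<bar>ln (\<Prod>i\<in>UNIV. c i (x $ i) (y $ i))\<bar> \<le> (\<Sum>i\<in>UNIV. \<bar>ln (c i (x $ i) (y $ i))\<bar>)"
      by simp
    also have "\<dots> \<le> (\<Sum>i\<in>UNIV. K i * (pow2 x * pow2 y))"
    proof (rule sum_mono)
      fix i
      have "2 ^ (x $ i) * 2 ^ (y $ i) \<le> pow2 x * pow2 y"
        using pow2_ge_1[of x] by (intro mult_mono pow2_ge) auto
      then have "K i * (2 ^ (x $ i) * 2 ^ (y $ i)) \<le> K i * (pow2 x * pow2 y)"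
        using K0 by (rule mult_left_mono)
      with lnc show "\<bar>ln (c i (x $ i) (y $ i))\<bar> \<le> K i * (pow2 x * pow2 y)"
        by (rule order_trans)
    qed
    finally show ?thesis
      unfolding ratio by (simp add: sum_distrib_right)
  qed
  then show ?thesis by blast
qed

text \<open>Poisson splitting: the totals have rates \<open>r + s\<close>, and given them each
  coordinate of \<open>x\<close> is binomial with success probability
  \<open>r $ i / (r $ i + s $ i)\<close>. These are the weights of the heat flow at time one for
  \<open>V = r / s\<close>, which is the link between the risk and the flow.\<close>

lemma poisson_prob_split:
  fixes r s lam :: "real ^ 'd::finite"
  assumes r: "\<And>i. 0 < r $ i" and s: "\<And>i. 0 < s $ i" and le: "\<And>i. x $ i \<le> z $ i"
  shows "poisson_prob r lam x * poisson_prob s lam (z - x) =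
    poisson_prob (r + s) lam z * (\<Prod>i\<in>UNIV. binomial_coeff (z $ i) (r $ i / s $ i) (x $ i) 1)"
  unfolding poisson_prob_def prod.distrib[symmetric]
proof (rule prod.cong[OF refl])
  fix i
  obtain n where z: "z $ i = x $ i + n" using le[of i] le_Suc_ex by blast
  have pos: "r $ i + s $ i \<noteq> 0" "s $ i \<noteq> 0" "r $ i \<noteq> 0" using r[of i] s[of i] by auto
  have ch: "real ((x $ i + n) choose (x $ i)) = fact (x $ i + n) / (fact (x $ i) * fact n)"
    by (simp add: binomial_fact)
  have b: "binomial_coeff (z $ i) (r $ i / s $ i) (x $ i) 1 = fact (x $ i + n) / (fact (x $ i) * fact n) * r $ i ^ (x $ i) * s $ i ^ n / (r $ i + s $ i) ^ (x $ i + n)"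
  proof -
    have "r $ i / s $ i + 1 = (r $ i + s $ i) / s $ i" using pos by (simp add: field_simps)
    then show ?thesis
      using pos by (simp add: binomial_coeff_def z ch power_divide power_add)
  qed
  have e: "exp (- ((r $ i + s $ i) * lam $ i)) = exp (- (r $ i * lam $ i)) * exp (- (s $ i * lam $ i))"
    by (simp add: exp_add[symmetric] algebra_simps)
  show "(r $ i * lam $ i) ^ x $ i * exp (- (r $ i * lam $ i)) / fact (x $ i) *
      ((s $ i * lam $ i) ^ (z - x) $ i * exp (- (s $ i * lam $ i)) / fact ((z - x) $ i)) =
      ((r + s) $ i * lam $ i) ^ z $ i * exp (- ((r + s) $ i * lam $ i)) / fact (z $ i) *
      binomial_coeff (z $ i) (r $ i / s $ i) (x $ i) 1"
    unfolding b using pos by (simp add: z e power_mult_distrib power_add)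
qed

lemma sum_binomial_coeff: "0 < V \<Longrightarrow> (\<Sum>k\<le>z. binomial_coeff z V k 1) = 1"
proof -
  assume "0 < V"
  then have "(V + 1) ^ z \<noteq> 0" by simp
  moreover have "(\<Sum>k\<le>z. binomial_coeff z V k 1) = (V + 1) ^ z / (V + 1) ^ z"
    unfolding binomial_ring[of V 1 z, unfolded power_one mult_1_right] sum_divide_distrib
    by (simp add: binomial_coeff_def binomial_ring[of V 1 z])
  ultimately show ?thesis by simp
qed

text \<open>All three claims are read off from \<open>g = s / (r * (r + s))\<close>.\<close>

lemma gamma_rescale:
  fixes r s g :: real
  assumes "0 < r" "0 < s" "g = 1 / r - 1 / (r + s)"
  shows "0 < g" "1 / ((r + s) * g) = r / s" "1 / (r * g) = r / s + 1"
proof -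
  have n: "r \<noteq> 0" "s \<noteq> 0" "r + s \<noteq> 0" using assms by auto
  then have g: "g = s / (r * (r + s))"
    unfolding assms(3) by (simp add: field_simps)
  show "0 < g" unfolding g using assms by simp
  have "(r + s) * g = s / r" "r * g = s / (r + s)"
    unfolding g using n by simp_all
  then show "1 / ((r + s) * g) = r / s" "1 / (r * g) = r / s + 1"
    using n by (simp_all add: add_divide_distrib)
qed

section \<open>The risk difference and its sign\<close>

context even_superharmonic
begin

text \<open>The Jeffreys risk minus the tilted risk. A sum over pairs, rather than an iterated one,
  can be regrouped by totals.\<close>

definition risk_gain :: "real ^ 'd \<Rightarrow> real ^ 'd \<Rightarrow> real ^ 'd \<Rightarrow> real"
  where "risk_gain r s lam = (\<Sum>\<^sub>\<infinity>(x, y)\<in>UNIV. poisson_prob r lam x * poisson_prob s lam y *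
    (ln (mixture (\<chi> i. r $ i / s $ i) (x + y)) - ln (mixture (\<chi> i. r $ i / s $ i + 1) x)))"

lemma abs_ln_mixture_diff_le:
  fixes r s :: "real ^ 'd"
  assumes r: "\<And>i. 0 < r $ i" and s: "\<And>i. 0 < s $ i"
  shows "\<exists>C. \<forall>x y. \<bar>ln (mixture (\<chi> i. r $ i / s $ i) (x + y)) - ln (mixture (\<chi> i. r $ i / s $ i + 1) x)\<bar> \<le> C * (pow2 x * pow2 y)"
proof -
  have V: "0 < (\<chi> i. r $ i / s $ i) $ i" for i using r s by simp
  have V1: "0 < (\<chi> i. r $ i / s $ i + 1) $ i" for i using r[of i] s[of i] by (simp add: add_pos_pos)
  obtain C1 where C1: "0 \<le> C1" "\<And>z. \<bar>ln (mixture (\<chi> i. r $ i / s $ i) z)\<bar> \<le> C1 * pow2 z"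
    using abs_ln_mixture_le[OF V] unfolding pow2_def by blast
  obtain C2 where C2: "0 \<le> C2" "\<And>z. \<bar>ln (mixture (\<chi> i. r $ i / s $ i + 1) z)\<bar> \<le> C2 * pow2 z"
    using abs_ln_mixture_le[OF V1] unfolding pow2_def by blast
  have "\<bar>ln (mixture (\<chi> i. r $ i / s $ i) (x + y)) - ln (mixture (\<chi> i. r $ i / s $ i + 1) x)\<bar> \<le> (C1 + C2) * (pow2 x * pow2 y)" for x y
  proof -
    have "C2 * pow2 x \<le> C2 * (pow2 x * pow2 y)"
      using C2(1) pow2_ge_1[of x] pow2_ge_1[of y] mult_left_mono[of 1 "pow2 y" "pow2 x"] by (intro mult_left_mono) auto
    then show ?thesis
      using C1(2)[of "x + y"] C2(2)[of x] unfolding pow2_add distrib_right by linarith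
  qed
  then show ?thesis by blast
qed

text \<open>The tilted predictive is the Jeffreys predictive times a quotient of mixtures, so the
  losses differ by the summand of \<open>risk_gain\<close>. The finite value \<open>J\<close> keeps
  the subtraction within the reals, so that a positive gain yields a strict inequality of extended
  reals.\<close>

lemma kl_risk_tilted:
  fixes r s \<gamma> lam :: "real ^ 'd"
  assumes r: "\<And>i. 0 < r $ i" and s: "\<And>i. 0 < s $ i" and \<gamma>: "\<And>i. \<gamma> $ i = 1 / r $ i - 1 / (r $ i + s $ i)"
    and l: "\<And>i. 0 < lam $ i"
  shows "\<exists>J. kl_risk r s (bayes_predictive r s jeffreys_prior) lam = ereal J \<and>
    kl_risk r s (bayes_predictive r s (tilted_jeffreys_prior \<gamma> f)) lam = ereal (J - risk_gain r s lam)"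
proof -
  define M0 where "M0 = mixture (\<chi> i. r $ i / s $ i)"
  define M1 where "M1 = mixture (\<chi> i. r $ i / s $ i + 1)"
  define qJ where "qJ x y = predictive_numerator r s x y / predictive_denominator r x" for x y
  define a where "a x y = ln (poisson_prob s lam y / qJ x y)" for x y
  define D where "D x y = ln (M0 (x + y)) - ln (M1 x)" for x y
  have \<gamma>pos: "0 < \<gamma> $ i" for i
    using gamma_rescale(1)[OF r s \<gamma>] .
  have v0: "(\<chi> i. 1 / ((r + s) $ i * \<gamma> $ i)) = (\<chi> i. r $ i / s $ i)"
    and v1: "(\<chi> i. 1 / (r $ i * \<gamma> $ i)) = (\<chi> i. r $ i / s $ i + 1)"
    by (simp_all add: vec_eq_iff gamma_rescale(2,3)[OF r s \<gamma>])
  have rs: "0 < (r + s) $ i" for i using r[of i] s[of i] by simp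
  have M: "0 < M0 z" "0 < M1 z" for z
    unfolding M0_def M1_def using r s by (auto intro!: mixture_pos simp: add_pos_pos)
  note pp = predictive_pos[OF r s]
  have qJpos: "0 < qJ x y" for x y unfolding qJ_def using pp by simp
  have J: "bayes_predictive r s jeffreys_prior y x = qJ x y" for x y
    unfolding jeffreys_prior_eq_tilted[of \<gamma>] bayes_predictive_tilted[OF r s] F_gamma_const[OF r] F_gamma_const[OF rs] qJ_def by simp
  note card = card_sign_vectors_neq_0[where 'd='d]
  have T: "bayes_predictive r s (tilted_jeffreys_prior \<gamma> f) y x = qJ x y * (M0 (x + y) / M1 x)" for x y
    unfolding bayes_predictive_tilted[OF r s] F_gamma_eq_mixture[OF \<gamma>pos r] F_gamma_eq_mixture[OF \<gamma>pos rs] v0 v1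
      M0_def[symmetric] M1_def[symmetric] qJ_def using card by simp
  have lnT: "ln (poisson_prob s lam y / (qJ x y * (M0 (x + y) / M1 x))) = a x y - D x y" for x y
  proof -
    have "poisson_prob s lam y / (qJ x y * (M0 (x + y) / M1 x)) = (poisson_prob s lam y / qJ x y) / (M0 (x + y) / M1 x)"
      by simp
    then show ?thesis
      using poisson_prob_pos[OF s l, of y] qJpos[of x y] M(1)[of "x + y"] M(2)[of x]
      by (simp only: a_def D_def ln_divide_pos divide_pos_pos)
  qed
  obtain C1 where C1: "\<And>x y. \<bar>a x y\<bar> \<le> C1 * (pow2 x * pow2 y)"
    using abs_ln_predictive_ratio_le[OF r s l] unfolding a_def qJ_def by blast
  obtain C2 where C2: "\<And>x y. \<bar>D x y\<bar> \<le> C2 * (pow2 x * pow2 y)"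
    using abs_ln_mixture_diff_le[OF r s] unfolding D_def M0_def M1_def by blast
  have C3: "\<bar>a x y - D x y\<bar> \<le> (C1 + C2) * (pow2 x * pow2 y)" for x y
    using C1[of x y] C2[of x y] unfolding distrib_right by linarith
  let ?w = "\<lambda>x y. poisson_prob r lam x * poisson_prob s lam y"
  have "kl_risk r s (bayes_predictive r s jeffreys_prior) lam = ereal (\<Sum>\<^sub>\<infinity>(x, y)\<in>UNIV. ?w x y * a x y)"
  proof (rule kl_risk_eq_infsum[OF r s l _ _ C1])
    show "bayes_predictive r s jeffreys_prior y x \<noteq> 0" for x y
      using qJpos[of x y] by (simp add: J)
  qed (simp only: J a_def)
  moreover have "kl_risk r s (bayes_predictive r s (tilted_jeffreys_prior \<gamma> f)) lam = ereal (\<Sum>\<^sub>\<infinity>(x, y)\<in>UNIV. ?w x y * (a x y - D x y))"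
  proof (rule kl_risk_eq_infsum[OF r s l _ _ C3])
    show "bayes_predictive r s (tilted_jeffreys_prior \<gamma> f) y x \<noteq> 0" for x y
      using qJpos[of x y] M(1)[of "x + y"] M(2)[of x] by (simp add: T)
  qed (simp only: T lnT)
  moreover have "(\<Sum>\<^sub>\<infinity>(x, y)\<in>UNIV. ?w x y * (a x y - D x y)) = (\<Sum>\<^sub>\<infinity>(x, y)\<in>UNIV. ?w x y * a x y) - risk_gain r s lam"
  proof -
    have "(\<Sum>\<^sub>\<infinity>p\<in>UNIV. (case p of (x, y) \<Rightarrow> ?w x y * (a x y - D x y)) + (case p of (x, y) \<Rightarrow> ?w x y * D x y)) =
      (\<Sum>\<^sub>\<infinity>(x, y)\<in>UNIV. ?w x y * (a x y - D x y)) + (\<Sum>\<^sub>\<infinity>(x, y)\<in>UNIV. ?w x y * D x y)"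
      by (rule infsum_add[OF summable_poisson_pair[OF r s l C3] summable_poisson_pair[OF r s l C2]])
    then show ?thesis
      by (simp add: risk_gain_def D_def M0_def M1_def case_prod_beta' right_diff_distrib)
  qed
  ultimately show ?thesis by auto
qed

text \<open>Given the total \<open>z = x + y\<close>, the count \<open>x\<close> is binomial, with a law that does not depend on \<open>lam\<close>. Applying
  \<open>ln u \<ge> 1 - 1 / u\<close> to \<open>u = mixture _ z / mixture _ x\<close> therefore reduces the claim to \<open>mixture_binomial_le\<close>.\<close>

lemma risk_gain_nonneg:
  fixes r s lam :: "real ^ 'd"
  assumes r: "\<And>i. 0 < r $ i" and s: "\<And>i. 0 < s $ i" and l: "\<And>i. 0 < lam $ i"
  shows "0 \<le> risk_gain r s lam"
    and "risk_gain r s lam = 0 \<Longrightarrow> \<exists>c. \<forall>x. mixture (\<chi> i. r $ i / s $ i + 1) x = c"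
proof -
  define V where "V = (\<chi> i. r $ i / s $ i)"
  define M0 where "M0 = mixture V"
  define M1 where "M1 = mixture (\<chi> i. V $ i + 1)"
  define L where "L z = {x :: nat ^ 'd. \<forall>i. x $ i \<le> z $ i}" for z
  define b where "b z x = (\<Prod>i\<in>UNIV. binomial_coeff (z $ i) (V $ i) (x $ i) 1)" for z x :: "nat ^ 'd"
  have V: "0 < V $ i" for i using r s by (simp add: V_def)
  have V1: "0 < (\<chi> i. V $ i + 1) $ i" for i using V[of i] by simp
  have M: "0 < M0 z" "0 < M1 z" for z
    unfolding M0_def M1_def using V V1 by (auto intro!: mixture_pos)
  have finL: "finite (L z)" for z unfolding L_def by (rule finite_vec_le)
  have bpos: "0 < b z x" if "x \<in> L z" for z x
    unfolding b_def
  proof (rule prod_pos)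
    fix i
    have "x $ i \<le> z $ i" using that by (simp add: L_def)
    then have "0 < (z $ i choose x $ i)" by simp
    then show "0 < binomial_coeff (z $ i) (V $ i) (x $ i) 1"
      unfolding binomial_coeff_def using V[of i] by (intro divide_pos_pos mult_pos_pos zero_less_power) auto
  qed
  have bsum: "(\<Sum>x\<in>L z. b z x) = 1" for z
    unfolding L_def b_def prod_sum_vec[where F="\<lambda>i k. binomial_coeff (z $ i) (V $ i) k 1", symmetric]
    by (simp add: sum_binomial_coeff V)
  have key: "(\<Sum>x\<in>L z. b z x * M1 x) \<le> M0 z" for z
    unfolding L_def b_def M0_def M1_def by (rule mixture_binomial_le[OF V])
  define w where "w x y = poisson_prob r lam x * poisson_prob s lam y" for x y
  define D where "D z x = ln (M0 z) - ln (M1 x)" for z x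
  \<comment> \<open>\<open>E z x\<close> is the gap in \<open>ln u \<ge> 1 - 1 / u\<close> at
    \<open>u = M0 z / M1 x\<close>. It is kept rather than dropped because it vanishes only when the
    two mixtures agree, which settles the case of equality.\<close>
  define E where "E z x = D z x - 1 + M1 x / M0 z" for z x
  have E0: "0 \<le> E z x" for z x
  proof -
    have "ln (M1 x / M0 z) \<le> M1 x / M0 z - 1"
      using M by (intro ln_le_minus_one divide_pos_pos)
    then show ?thesis using M[of z] M[of x] by (simp add: E_def D_def ln_divide_pos)
  qed
  have E_eq: "M1 x = M0 z" if "E z x = 0" for z x
  proof -
    have "ln (M1 x / M0 z) = M1 x / M0 z - 1"
      using that M[of z] M[of x] by (simp add: E_def D_def ln_divide_pos)
    then have "M1 x / M0 z = 1"
      using M[of z] M[of x] by (intro ln_eq_minus_one) auto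
    then show ?thesis using M[of z] by simp
  qed
  define T where "T z = (\<Sum>x\<in>L z. w x (z - x) * D z x)" for z
  have p: "0 < poisson_prob (r + s) lam z" for z
    using r s l by (intro poisson_prob_pos) (auto simp: add_pos_pos)
  \<comment> \<open>The weights sum to one and average \<open>M1\<close> to at most
    \<open>M0 z\<close>, so the average of \<open>1 - M1 x / M0 z\<close> is nonnegative and the
    average of \<open>D\<close> is at least that of \<open>E\<close>.\<close>
  have T_ge: "poisson_prob (r + s) lam z * (\<Sum>x\<in>L z. b z x * E z x) \<le> T z" for z
  proof -
    have "T z = (\<Sum>x\<in>L z. poisson_prob (r + s) lam z * (b z x * D z x))"
      unfolding T_def
    proof (rule sum.cong[OF refl])
      fix x assume "x \<in> L z"
      then have "w x (z - x) = poisson_prob (r + s) lam z * b z x"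
        unfolding w_def b_def V_def using poisson_prob_split[OF r s, of x z lam] by (simp add: L_def)
      then show "w x (z - x) * D z x = poisson_prob (r + s) lam z * (b z x * D z x)"
        by simp
    qed
    then have T: "T z = poisson_prob (r + s) lam z * (\<Sum>x\<in>L z. b z x * D z x)"
      by (simp add: sum_distrib_left)
    have "(\<Sum>x\<in>L z. b z x * E z x) = (\<Sum>x\<in>L z. b z x * D z x) - (\<Sum>x\<in>L z. b z x) + (\<Sum>x\<in>L z. b z x * M1 x) / M0 z"
      unfolding sum_divide_distrib sum_subtractf[symmetric] sum.distrib[symmetric]
      by (intro sum.cong refl) (simp add: E_def algebra_simps)
    also have "\<dots> \<le> (\<Sum>x\<in>L z. b z x * D z x)"
      using key[of z] M(1)[of z] by (simp add: bsum)
    finally show ?thesis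
      unfolding T using p[of z] by (intro mult_left_mono) auto
  qed
  have bE: "0 \<le> (\<Sum>x\<in>L z. b z x * E z x)" for z
    using bpos E0 by (intro sum_nonneg mult_nonneg_nonneg) (auto intro: less_imp_le)
  have T0: "0 \<le> T z" for z
    by (rule order_trans[OF mult_nonneg_nonneg[OF less_imp_le[OF p] bE] T_ge])
  let ?g = "\<lambda>(x, y). w x y * D (x + y) x"
  let ?h = "\<lambda>(z, x). w x (z - x) * D z x"
  obtain C where C: "\<And>x y. \<bar>D (x + y) x\<bar> \<le> C * (pow2 x * pow2 y)"
    using abs_ln_mixture_diff_le[OF r s] unfolding D_def M0_def M1_def V_def vec_lambda_beta by blast
  have sg: "?g summable_on UNIV"
    unfolding w_def by (rule summable_poisson_pair[OF r s l C])
  \<comment> \<open>Pairs of counts are regrouped by their total; the coordinatewise subtraction is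
    exact because \<open>L z\<close> contains only vectors below \<open>z\<close>.\<close>
  have "bij_betw (\<lambda>(z, x). (x, z - x)) (Sigma UNIV L) UNIV"
    by (rule bij_betw_byWitness[where f'="\<lambda>(x, y). (x + y, x)"]) (auto simp: L_def vec_eq_iff)
  note bij = this
  have gh: "?g ((\<lambda>(z, x). (x, z - x)) q) = ?h q" if "q \<in> Sigma UNIV L" for q
  proof -
    obtain z x where q: "q = (z, x)" "x \<in> L z" using \<open>q \<in> Sigma UNIV L\<close> by (cases q) auto
    then have "x + (z - x) = z" by (auto simp: L_def vec_eq_iff)
    then show ?thesis by (simp add: q)
  qed
  have sh: "?h summable_on Sigma UNIV L"
  proof -
    have "(\<lambda>q. ?g ((\<lambda>(z, x). (x, z - x)) q)) summable_on Sigma UNIV L"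
      using sg summable_on_reindex_bij_betw[OF bij, of ?g] by (rule iffD2[rotated])
    then show ?thesis
      using summable_on_cong[of "Sigma UNIV L", OF gh] by (rule iffD1[rotated])
  qed
  have "risk_gain r s lam = infsum ?g UNIV"
    by (simp add: risk_gain_def w_def D_def M0_def M1_def V_def)
  also have "\<dots> = infsum ?h (Sigma UNIV L)"
    unfolding infsum_reindex_bij_betw[OF bij, of ?g, symmetric] by (rule infsum_cong) (rule gh)
  also have "\<dots> = (\<Sum>\<^sub>\<infinity>z. \<Sum>\<^sub>\<infinity>x\<in>L z. w x (z - x) * D z x)"
    using infsum_Sigma'_banach[OF sh] by simp
  also have "\<dots> = infsum T UNIV"
    by (simp add: T_def[abs_def] finL)
  finally have gain: "risk_gain r s lam = infsum T UNIV" .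
  have sT: "T summable_on UNIV"
    using summable_on_Sigma_banach[OF sh] by (simp add: T_def[abs_def] finL)
  show "0 \<le> risk_gain r s lam"
    unfolding gain using T0 by (intro infsum_nonneg)
  assume "risk_gain r s lam = 0"
  \<comment> \<open>A vanishing sum of nonnegative terms forces every total to contribute zero; as
    all weights on \<open>L z\<close> are positive, every gap is then zero.\<close>
  then have "T z = 0" for z
    using nonneg_infsum_le_0D[OF _ sT, of z] T0 by (simp add: gain)
  then have "(\<Sum>x\<in>L z. b z x * E z x) \<le> 0" for z
    using T_ge[of z] p[of z] by (auto simp: mult_le_0_iff)
  then have S0: "(\<Sum>x\<in>L z. b z x * E z x) = 0" for z
    using bE by (rule order_antisym)
  have eq: "M1 x = M0 z" if x: "x \<in> L z" for z x
  proof (rule E_eq)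
    have "0 \<le> b z x * E z x" if "x \<in> L z" for x
      using bpos[OF that] E0 by (intro mult_nonneg_nonneg) auto
    then have "\<forall>x\<in>L z. b z x * E z x = 0"
      using sum_nonneg_eq_0_iff[OF finL, of z "\<lambda>x. b z x * E z x"] S0[of z] by simp
    then show "E z x = 0"
      using x bpos[OF x] by auto
  qed
  \<comment> \<open>Both \<open>x\<close> and \<open>0\<close> lie in \<open>L x\<close>, so both
    mixtures equal \<open>M0 x\<close>.\<close>
  have "M1 x = M1 0" for x
    using eq[of x x] eq[of 0 x] unfolding L_def by simp
  then show "\<exists>c. \<forall>x. mixture (\<chi> i. r $ i / s $ i + 1) x = c"
    by (auto simp: M1_def V_def)
qed

end

theorem corollary3:
  fixes r s \<gamma> :: "real ^ 'd::finite" and h f :: "real ^ 'd \<Rightarrow> real"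
  assumes "\<And>i. 0 < r $ i" and "\<And>i. 0 < s $ i"
    and "\<And>i. \<gamma> $ i = 1 / r $ i - 1 / (r $ i + s $ i)"
    and "superharmonic h"
    and "f = sign_sum h"
    and "\<And>\<theta>. \<theta> \<in> nonneg_orthant \<Longrightarrow> 0 \<le> f \<theta>"
    and "\<exists>\<theta>\<in>nonneg_orthant. f \<theta> \<noteq> 0"
    and "\<And>z \<rho>. 0 < \<rho> \<Longrightarrow>
      set_integrable lborel nonneg_orthant (\<lambda>\<theta>. f \<theta> * gauss_weight z \<rho> \<theta>)"
    and "\<And>z \<rho> i. 0 < \<rho> \<Longrightarrow>
      set_integrable lborel nonneg_orthant (\<lambda>\<theta>. \<bar>partial i f \<theta>\<bar> * gauss_weight z \<rho> \<theta>)"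
    and "\<And>z \<rho> i. 0 < \<rho> \<Longrightarrow>
      set_integrable lborel nonneg_orthant (\<lambda>\<theta>. \<bar>partial i (partial i f) \<theta>\<bar> * gauss_weight z \<rho> \<theta>)"
  shows "weakly_dominates r s
           (bayes_predictive r s (tilted_jeffreys_prior \<gamma> f)) (bayes_predictive r s jeffreys_prior)
       \<and> (\<not> (\<exists>c. \<forall>z. F_gamma \<gamma> f z r = c) \<longrightarrow>
         dominates r s
           (bayes_predictive r s (tilted_jeffreys_prior \<gamma> f)) (bayes_predictive r s jeffreys_prior))"
proof -
  note r = assms(1) and s = assms(2) and \<gamma> = assms(3)
  have sh: "superharmonic f"
    using assms(4,5) by (simp add: superharmonic_sign_sum)
  then have C1: "C1_on_space f" "\<And>i. C1_on_space (partial i f)"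
    by (auto simp: superharmonic_def C2_on_space_def)
  have even: "f (a * x) = f x" if "a \<in> sign_vectors" for a x
    unfolding assms(5) using that by (rule sign_sum_even)
  have even1: "partial i f (a * x) = a $ i * partial i f x" if "a \<in> sign_vectors" for a i x
    using partial_even[OF C1(1) that, of 1] even[OF that] by simp
  have even2: "partial i (partial i f) (a * x) = partial i (partial i f) x" if "a \<in> sign_vectors" for a i x
    using partial_even[OF C1(2) that even1[OF that]] times_sign_vector(3)[OF that] by (simp add: power2_eq_square)
  have nonneg: "0 \<le> f x" for x
  proof -
    \<comment> \<open>Reflecting \<open>x\<close> into the closed orthant carries nonnegativity over
      to the whole space.\<close>
    let ?a = "\<chi> i. if x $ i < 0 then -1 else 1"
    have "?a \<in> sign_vectors" "?a * x \<in> nonneg_orthant"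
      by (auto simp: sign_vectors_def nonneg_orthant_def times_vec_def)
    then show ?thesis using assms(6)[of "?a * x"] even[of ?a x] by simp
  qed
  interpret even_superharmonic f
  proof
    show "superharmonic f" by (rule sh)
    show "f (a * x) = f x" if "a \<in> sign_vectors" for a x using that by (rule even)
    show "0 \<le> f x" for x by (rule nonneg)
    show "\<exists>x. f x \<noteq> 0" using assms(7) by blast
  next
    fix \<rho> :: real and i :: 'd assume \<rho>: "0 < \<rho>"
    show "gauss_integrable \<rho> f"
    proof (rule gauss_integrable_even[OF C1_on_space_imp_continuous[OF C1(1)]])
      show "set_integrable lborel nonneg_orthant (\<lambda>x. \<bar>f x\<bar> * gauss_weight 0 \<rho> x)"
        using assms(8)[OF \<rho>, of 0] nonneg by simp
    qed (simp add: even)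
    show "gauss_integrable \<rho> (partial i f)"
      by (rule gauss_integrable_even[OF C1_on_space_imp_continuous[OF C1(2)] _ assms(9)[OF \<rho>]])
        (simp add: even1 abs_mult times_sign_vector(2))
    show "gauss_integrable \<rho> (partial i (partial i f))"
      by (rule gauss_integrable_even[OF C1_on_spaceD(2)[OF C1(2)] _ assms(10)[OF \<rho>]]) (simp add: even2)
  qed
  have gain: "weakly_dominates r s (bayes_predictive r s (tilted_jeffreys_prior \<gamma> f)) (bayes_predictive r s jeffreys_prior)"
    unfolding weakly_dominates_def
  proof
    fix lam :: "real ^ 'd" assume "lam \<in> pos_orthant"
    then have l: "0 < lam $ i" for i by (simp add: pos_orthant_def)
    show "kl_risk r s (bayes_predictive r s (tilted_jeffreys_prior \<gamma> f)) lam \<le> kl_risk r s (bayes_predictive r s jeffreys_prior) lam"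
      using kl_risk_tilted[OF r s \<gamma> l] risk_gain_nonneg(1)[OF r s l] by auto
  qed
  moreover have "\<exists>lam\<in>pos_orthant. kl_risk r s (bayes_predictive r s (tilted_jeffreys_prior \<gamma> f)) lam < kl_risk r s (bayes_predictive r s jeffreys_prior) lam"
    if nc: "\<not> (\<exists>c. \<forall>z. F_gamma \<gamma> f z r = c)"
  proof
    \<comment> \<open>Any point would do: zero gain at a single \<open>lam\<close> already forces
      the mixture to be constant.\<close>
    let ?l = "(\<chi> i. 1) :: real ^ 'd"
    have l: "0 < ?l $ i" for i by simp
    show "?l \<in> pos_orthant" by (simp add: pos_orthant_def)
    note g = gamma_rescale(1,3)[OF r s \<gamma>]
    have "\<not> (\<exists>c. \<forall>x. mixture (\<chi> i. r $ i / s $ i + 1) x = c)"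
    proof
      assume "\<exists>c. \<forall>x. mixture (\<chi> i. r $ i / s $ i + 1) x = c"
      then obtain c where "\<And>x. mixture (\<chi> i. r $ i / s $ i + 1) x = c" by blast
      then show False
        using nc F_gamma_eq_mixture[OF g(1) r] by (simp add: g(2))
    qed
    then have "0 < risk_gain r s ?l"
      using risk_gain_nonneg[OF r s l] by (auto simp: less_le)
    then show "kl_risk r s (bayes_predictive r s (tilted_jeffreys_prior \<gamma> f)) ?l < kl_risk r s (bayes_predictive r s jeffreys_prior) ?l"
      using kl_risk_tilted[OF r s \<gamma> l] by auto
  qed
  ultimately show ?thesis
    by (simp add: dominates_def)
qed

end
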